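(* Let $\tilde\alpha,\tilde\beta\in\mathbb{C}$ and let $(h_n)_{n\in\mathbb{Z}}$ be nonzero complex numbers satisfying the second order map $$h_{n-1}h_nh_{n+1}=\tilde\alpha h_n+\tilde\beta\quad\text{for all }n\in\mathbb{Z}.$$ Then the quantity $\tilde J=h_{n-1}+h_n+\tilde\alpha\big(\frac1{h_{n-1}}+\frac1{h_n}\big)+\frac{\tilde\beta}{h_{n-1}h_n}$ is independent of $n$. Moreover, with $h_{-1}=(\tilde\alpha h_0+\tilde\beta)/(h_0h_1)$, define $$\tilde\mu=(\tilde\beta+\tilde\alpha\tilde J)^{1/4},\qquad \tilde\lambda=\frac{1}{3\tilde\mu^2}\Big(\frac{\tilde J^2}{4}+\tilde\alpha\Big),\qquad g_2=12\tilde\lambda^2-2\tilde J,\qquad g_3=4\tilde\lambda^3-g_2\tilde\lambda-\tilde\mu^2,$$ $$x_0=\tilde\lambda+\frac{\tilde\mu^2}{h_{-1}+h_0-\tilde J},$$ (for some choice of the fourth root, assuming the denominators are nonzero and the curve $E:\ y^2=4x^3-g_2x-g_3$ is nonsingular), let $\sigma(z)=\sigma(z;g_2,g_3)$ and $\wp(z)=\wp(z;g_2,g_3)$ be the Weierstrass functions of $E$, and let $\kappa,z_0\in\mathbb{C}$ be given by the elliptic integrals $z_0=\pm\int_\infty^{x_0}\frac{dx}{y}$, $\kappa=\pm\int_\infty^{\tilde\lambda}\frac{dx}{y}$ on $E$ (so $\wp(z_0)=x_0$, $\wp(\kappa)=\tilde\lambda$), with signs chosen so that $\wp'(\kappa)=\tilde\mu$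 and $\wp'(\kappa)\wp'(z_0)=(x_0-\tilde\lambda)(h_{-1}-h_0)$. Then for all $n\in\mathbb{Z}$, $$h_n=\frac{\sigma(z_0+(n+2)\kappa)\,\sigma(z_0+(n-1)\kappa)}{\sigma(\kappa)^4\,\sigma(z_0+n\kappa)\,\sigma(z_0+(n+1)\kappa)}=-\frac{\wp'(\kappa)}{2}\left(\frac{\wp'(z_0+n\kappa)-\wp'(\kappa)}{\wp(z_0+n\kappa)-\wp(\kappa)}\right)+\frac{\wp''(\kappa)}{2}.$$
   Context: $\sigma(z;g_2,g_3)$ and $\wp(z;g_2,g_3)$ denote the Weierstrass sigma and elliptic functions associated with the curve $y^2=4x^3-g_2x-g_3$. *)

theory Defs
  imports "HOL-Analysis.Analysis"
begin

definition somos5_J :: "complex \<Rightarrow> complex \<Rightarrow> (int \<Rightarrow> complex) \<Rightarrow> int \<Rightarrow> complex" where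
  "somos5_J \<alpha> \<beta> h n =
     h (n - 1) + h n + \<alpha> * (1 / h (n - 1) + 1 / h n) + \<beta> / (h (n - 1) * h n)"

definition complex_lattice :: "complex \<Rightarrow> complex \<Rightarrow> complex set" where
  "complex_lattice \<omega>1 \<omega>2 = {of_int m * \<omega>1 + of_int n * \<omega>2 | m n. True}"

text \<open>
  The Weierstrass functions of a curve \<open>y\<^sup>2 = 4x\<^sup>3 - g2 x - g3\<close> are those of its period lattice,
  i.e. of the rank 2 lattice with invariants \<open>g2\<close> and \<open>g3\<close>.  The condition on
  \<open>\<omega>2 / \<omega>1\<close> says that the two periods are linearly independent over the reals (in particular
  both are nonzero).
\<close>
definition is_period_lattice :: "complex \<Rightarrow> complex \<Rightarrow> complex set \<Rightarrow> bool" where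
  "is_period_lattice g2 g3 \<Lambda> \<longleftrightarrow>
     (\<exists>\<omega>1 \<omega>2. Im (\<omega>2 / \<omega>1) \<noteq> 0 \<and> \<Lambda> = complex_lattice \<omega>1 \<omega>2) \<and>
     g2 = 60 * (\<Sum>\<^sub>\<infinity>\<omega>\<in>\<Lambda> - {0}. 1 / \<omega> ^ 4) \<and>
     g3 = 140 * (\<Sum>\<^sub>\<infinity>\<omega>\<in>\<Lambda> - {0}. 1 / \<omega> ^ 6)"

text \<open>Meaningful for \<open>z \<notin> \<Lambda>\<close> only; at its poles the function has a junk value.\<close>
definition weierstrass_wp :: "complex set \<Rightarrow> complex \<Rightarrow> complex" where
  "weierstrass_wp \<Lambda> z = 1 / z ^ 2 + (\<Sum>\<^sub>\<infinity>\<omega>\<in>\<Lambda> - {0}. (1 / (z - \<omega>) ^ 2 - 1 / \<omega> ^ 2))"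

text \<open>
  The product converges unconditionally; as for \<open>infsum\<close>, its value is the limit of the
  finite partial products along the filter of finite subsets of the index set.
\<close>
definition weierstrass_sigma :: "complex set \<Rightarrow> complex \<Rightarrow> complex" where
  "weierstrass_sigma \<Lambda> z =
     z * Lim (finite_subsets_at_top (\<Lambda> - {0}))
           (\<lambda>F. \<Prod>\<omega>\<in>F. (1 - z / \<omega>) * exp (z / \<omega> + z ^ 2 / (2 * \<omega> ^ 2)))"

definition nonsingular_curve :: "complex \<Rightarrow> complex \<Rightarrow> bool" where
  "nonsingular_curve g2 g3 \<longleftrightarrow>
     \<not> (\<exists>x y. y ^ 2 = 4 * x ^ 3 - g2 * x - g3 \<and> 2 * y = 0 \<and> 12 * x ^ 2 - g2 = 0)"

text \<open>
  \<open>elliptic_integral g2 g3 x w\<close>: the number \<open>w\<close> is a value of the (multivalued) integral of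
  \<open>dx / y\<close> from \<open>\<infinity>\<close> to \<open>x\<close>, taken along a path \<open>t \<mapsto> (X t, Y t)\<close>, \<open>0 < t < 1\<close>, on the curve.
  The interior of the path avoids the branch points \<open>y = 0\<close>, but its end \<open>x\<close> may be one.
  The choices of path and of the branch \<open>Y\<close> account for the ambiguity of the integral by
  periods and sign.  The Henstock-Kurzweil integral over \<open>[0, 1]\<close> is the improper one, and the
  values of the integrand at the two end points do not matter.
\<close>
definition elliptic_integral :: "complex \<Rightarrow> complex \<Rightarrow> complex \<Rightarrow> complex \<Rightarrow> bool" where
  "elliptic_integral g2 g3 x w \<longleftrightarrow>
     (\<exists>X Y :: real \<Rightarrow> complex.
        X C1_differentiable_on {0<..<1} \<and> continuous_on {0<..<1} Y \<and>
        (\<forall>t\<in>{0<..<1}. Y t \<noteq> 0 \<and> Y t ^ 2 = 4 * X t ^ 3 - g2 * X t - g3) \<and>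
        filterlim X at_infinity (at_right 0) \<and> (X \<longlongrightarrow> x) (at_left 1) \<and>
        ((\<lambda>t. vector_derivative X (at t) / Y t) has_integral w) {0..1})"

end

theory Submission
  imports Defs "HOL-Complex_Analysis.Complex_Analysis"
begin

text \<open>
  Fix \<open>\<kappa>\<close>. The function
  \<open>F(z) = \<wp>''(\<kappa>) / 2 - \<wp>'(\<kappa>) / 2 \<cdot> (\<wp>'(z) - \<wp>'(\<kappa>)) / (\<wp>(z) - \<wp>(\<kappa>))\<close> equals
  \<open>(\<wp>(z) - \<wp>(\<kappa>)) (\<wp>(z + \<kappa>) - \<wp>(\<kappa>))\<close>, because the difference is elliptic without poles.
  Hence \<open>F(-z - \<kappa>) = F(z)\<close>, so \<open>F(-z)\<close>, \<open>F(z)\<close> and \<open>F(z + \<kappa>)\<close> are expressed by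
  \<open>u = \<wp>(z) - \<wp>(\<kappa>)\<close> and \<open>u' = \<wp>(z + \<kappa>) - \<wp>(\<kappa>)\<close>: the middle one is \<open>u u'\<close>, and the equation
  of the curve gives \<open>u + u'\<close> as a polynomial in \<open>u u'\<close>, whence
  \<open>F(-z) F(z) F(z + \<kappa>) = \<alpha> F(z) + \<beta>\<close>.
  The choice of \<open>x0\<close> and of the signs means \<open>h(-1) = F(-z0)\<close> and \<open>h(0) = F(z0)\<close>, and the map
  determines all further values, the orbit never meeting the lattice since no \<open>h n\<close> vanishes.
  The product form of \<open>F\<close> turns into the sigma quotient by
  \<open>\<wp>(a) - \<wp>(b) = - \<sigma>(a + b) \<sigma>(a - b) / (\<sigma>(a)\<^sup>2 \<sigma>(b)\<^sup>2)\<close>.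
  That \<open>\<wp>\<close> inverts the elliptic integral along a path \<open>(X, Y)\<close> follows from lifting: the set
  of parameters where \<open>(\<wp>, \<wp>')\<close> at the partial integral, shifted by a constant, equals \<open>(X, Y)\<close>
  is open and closed, and the behaviour of \<open>X\<close> at the initial point forces that constant into the lattice.
\<close>

section \<open>Termwise differentiation and period lattices\<close>

text \<open>The parameters of the theorem form a dictionary. When \<open>wp k = lam\<close>, the
  prescribed \<open>g2\<close> and \<open>g3\<close> say that \<open>wp''(k) = J\<close> and
  \<open>wp'(k)^2 = \<mu>^2\<close>; the formula for \<open>lam\<close> then encodes \<alpha>, and
  the fourth power of \<mu> encodes \<beta>. With \<open>x = lam + u\<close> the curve reads
  \<open>y^2 = 4 u^3 + 12 lam u^2 + 2 J u + \<mu>^2\<close>, the form in which the recurrence is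
  derived from it. The obstacle is that sums, products and quotients take arbitrary values where
  they diverge or have poles. Identities of elliptic functions are therefore proved off the lattice,
  by a version of Liouville's theorem that sees only limits at the finitely many classes of possible
  singularities; the constant is read off one of these limits. The condition \<mu> nonzero keeps
  \<open>2 k\<close> out of the lattice, so that the two zeros \<open>k\<close> and
  \<open>-k\<close> of \<open>wp - lam\<close> are distinct modulo the lattice.\<close>

lemma higher_deriv_sum:
  fixes f :: "'i \<Rightarrow> complex \<Rightarrow> complex"
  assumes "finite X" "\<And>i. i \<in> X \<Longrightarrow> f i holomorphic_on A" "open A" "z \<in> A"
  shows "(deriv ^^ m) (\<lambda>z. \<Sum>i\<in>X. f i z) z = (\<Sum>i\<in>X. (deriv ^^ m) (f i) z)"
  using assms(1,2)
proof (induction X rule: finite_induct)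
  case empty
  have "(deriv ^^ m) (\<lambda>z::complex. 0::complex) = (\<lambda>z. 0)"
    by (induction m) (auto simp: fun_eq_iff)
  then show ?case by simp
next
  case (insert i X)
  then show ?case
    using higher_deriv_add[of "f i" A "\<lambda>z. \<Sum>i\<in>X. f i z" z m] assms(3,4)
    by (simp add: holomorphic_on_sum)
qed

text \<open>The majorant is only required off a finite set of indices, since a series such as
  \<open>\<Sum>1 / (z - \<omega>)\<^sup>2\<close> has no uniform majorant for the \<open>\<omega>\<close> near a given disc.\<close>
lemma
  fixes f :: "'i \<Rightarrow> complex \<Rightarrow> complex"
  assumes A: "open A" and holo: "\<And>i. i \<in> I \<Longrightarrow> f i holomorphic_on A"
    and bound: "\<And>R. \<exists>J M. finite J \<and> M summable_on (I - J) \<and>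
                  (\<forall>i\<in>I-J. \<forall>z\<in>A \<inter> cball 0 R. norm (f i z) \<le> M i)"
  shows summable_on_locally_bounded: "z \<in> A \<Longrightarrow> (\<lambda>i. f i z) summable_on I" (is "_ \<Longrightarrow> ?thesis1")
    and holomorphic_on_infsum: "(\<lambda>z. \<Sum>\<^sub>\<infinity>i\<in>I. f i z) holomorphic_on A" (is ?thesis2)
    and has_sum_higher_deriv:
      "z \<in> A \<Longrightarrow> ((\<lambda>i. (deriv ^^ m) (f i) z) has_sum (deriv ^^ m) (\<lambda>z. \<Sum>\<^sub>\<infinity>i\<in>I. f i z) z) I"
      (is "_ \<Longrightarrow> ?thesis3")
proof -
  define F where "F = (\<lambda>z. \<Sum>\<^sub>\<infinity>i\<in>I. f i z)"
  \<comment> \<open>Local uniform convergence is the common source of all three claims: it gives the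
    pointwise sum, holomorphy of the limit, and convergence of all derivatives.\<close>
  have uniform: "\<exists>r>0. cball z r \<subseteq> A \<and>
      uniform_limit (cball z r) (\<lambda>X z. \<Sum>i\<in>X. f i z) F (finite_subsets_at_top I)"
    if z: "z \<in> A" for z
  proof -
    obtain r where r: "r > 0" "cball z r \<subseteq> A"
      using A z by (meson open_contains_cball)
    obtain J M where JM: "finite J" "M summable_on (I - J)"
        "\<And>i y. i \<in> I - J \<Longrightarrow> y \<in> A \<Longrightarrow> norm y \<le> norm z + r \<Longrightarrow> norm (f i y) \<le> M i"
      using bound[of "norm z + r"] by (fastforce simp: dist_norm)
    have "\<exists>B. \<forall>y\<in>cball z r. norm (f i y) \<le> B" if "i \<in> I" for i
    proof -
      have "continuous_on (cball z r) (f i)"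
        using holo[OF that] r by (meson holomorphic_on_imp_continuous_on continuous_on_subset)
      hence "bounded (f i ` cball z r)"
        by (intro compact_imp_bounded compact_continuous_image) auto
      thus ?thesis by (auto simp: bounded_iff)
    qed
    then obtain B where B: "\<And>i y. i \<in> I \<Longrightarrow> y \<in> cball z r \<Longrightarrow> norm (f i y) \<le> B i"
      by metis
    \<comment> \<open>On the exceptional indices the maximum over the compact disc serves as
      majorant; there are only finitely many of them, so summability survives.\<close>
    define M' where "M' = (\<lambda>i. if i \<in> J then B i else M i)"
    have "M' summable_on (I - J)"
      using JM(2) by (rule summable_on_cong[THEN iffD1, rotated]) (auto simp: M'_def)
    moreover have "M' summable_on (I \<inter> J)"
      using JM(1) by (intro summable_on_finite) auto
    ultimately have "M' summable_on ((I - J) \<union> (I \<inter> J))"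
      by (rule summable_on_union)
    moreover have "(I - J) \<union> (I \<inter> J) = I" by auto
    ultimately have M': "M' summable_on I" by simp
    have "norm y \<le> norm z + r" if "y \<in> cball z r" for y
    proof -
      have "norm y \<le> norm z + norm (y - z)" by (rule norm_triangle_sub)
      thus ?thesis using that by (simp add: dist_norm norm_minus_commute)
    qed
    hence "uniform_limit (cball z r) (\<lambda>X z. \<Sum>i\<in>X. f i z) F (finite_subsets_at_top I)"
      unfolding F_def using r
      by (intro Weierstrass_m_test_general[OF _ M']) (auto simp: M'_def intro!: B JM(3))
    thus ?thesis using r by blast
  qed
  show ?thesis1 if z: "z \<in> A"
  proof -
    obtain r where r: "r > 0" "uniform_limit (cball z r) (\<lambda>X z. \<Sum>i\<in>X. f i z) F (finite_subsets_at_top I)"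
      using uniform[OF z] by blast
    have "((\<lambda>X. \<Sum>i\<in>X. f i z) \<longlongrightarrow> F z) (finite_subsets_at_top I)"
      by (rule tendsto_uniform_limitI[OF r(2)]) (use r in auto)
    thus ?thesis unfolding summable_on_def has_sum_def by blast
  qed
  have ev: "\<forall>\<^sub>F X in finite_subsets_at_top I. finite X \<and> X \<subseteq> I"
    by (intro eventually_finite_subsets_at_top_weakI) auto
  show ?thesis2
  proof -
    have "F field_differentiable (at z)" if z: "z \<in> A" for z
    proof -
      obtain r where r: "r > 0" "cball z r \<subseteq> A"
        "uniform_limit (cball z r) (\<lambda>X z. \<Sum>i\<in>X. f i z) F (finite_subsets_at_top I)"
        using uniform[OF z] by blast
      have "\<forall>\<^sub>F X in finite_subsets_at_top I. continuous_on (cball z r) (\<lambda>z. \<Sum>i\<in>X. f i z) \<and>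
              (\<lambda>z. \<Sum>i\<in>X. f i z) holomorphic_on ball z r"
        using ev
      proof eventually_elim
        case (elim X)
        have "(\<lambda>z. \<Sum>i\<in>X. f i z) holomorphic_on cball z r"
          using elim holo r(2) by (intro holomorphic_on_sum) (meson holomorphic_on_subset subsetD)
        thus ?case
          by (meson ball_subset_cball holomorphic_on_imp_continuous_on holomorphic_on_subset)
      qed
      from holomorphic_uniform_limit[OF this r(3)] have "F holomorphic_on ball z r" by auto
      thus ?thesis using r(1) by (simp add: holomorphic_on_imp_differentiable_at)
    qed
    thus ?thesis unfolding F_def holomorphic_on_def
      by (meson field_differentiable_at_within)
  qed
  show ?thesis3 if z: "z \<in> A"
  proof -
    obtain r where r: "r > 0" "cball z r \<subseteq> A"
      "uniform_limit (cball z r) (\<lambda>X z. \<Sum>i\<in>X. f i z) F (finite_subsets_at_top I)"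
      using uniform[OF z] by blast
    have sub: "ball z r \<subseteq> A" using r(2) ball_subset_cball by blast
    have "((\<lambda>X. (deriv ^^ m) (\<lambda>z. \<Sum>i\<in>X. f i z) z) \<longlongrightarrow> (deriv ^^ m) F z) (finite_subsets_at_top I)"
    proof (rule higher_deriv_complex_uniform_limit)
      show "uniform_limit (ball z r) (\<lambda>X z. \<Sum>i\<in>X. f i z) F (finite_subsets_at_top I)"
        using r(3) ball_subset_cball by (rule uniform_limit_on_subset)
      show "\<forall>\<^sub>F X in finite_subsets_at_top I. (\<lambda>z. \<Sum>i\<in>X. f i z) holomorphic_on ball z r"
        using ev by eventually_elim
          (intro holomorphic_on_sum, meson holo holomorphic_on_subset sub subsetD)
    qed (use r(1) in auto)
    moreover have "\<forall>\<^sub>F X in finite_subsets_at_top I.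
        (deriv ^^ m) (\<lambda>z. \<Sum>i\<in>X. f i z) z = (\<Sum>i\<in>X. (deriv ^^ m) (f i) z)"
      using ev by eventually_elim (rule higher_deriv_sum, use holo A z in auto)
    ultimately show ?thesis unfolding has_sum_def F_def
      by (simp add: filterlim_cong)
  qed
qed

text \<open>The exponent is half of 3: a product of two such terms, one for each lattice coordinate,
  will dominate the inverse cube of the norm of a lattice point.\<close>

lemma summable_on_int_powr: "(\<lambda>m::int. (1 + \<bar>real_of_int m\<bar>) powr (-3/2)) summable_on UNIV"
proof -
  let ?f = "\<lambda>m::int. (1 + \<bar>real_of_int m\<bar>) powr (-3/2)"
  have "summable (\<lambda>n. real (Suc n) powr (-3/2))"
    by (subst summable_Suc_iff) (simp add: summable_real_powr_iff)
  hence s: "(\<lambda>n. (1 + real n) powr (-3/2)) summable_on UNIV"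
    by (subst summable_on_UNIV_nonneg_real_iff) (auto simp: add.commute)
  have "?f summable_on (range int)"
    using s by (subst summable_on_reindex) (auto simp: inj_on_def o_def)
  moreover have "?f summable_on (range (\<lambda>n. - int n))"
    using s by (subst summable_on_reindex) (auto simp: inj_on_def o_def)
  ultimately have "?f summable_on (range int \<union> range (\<lambda>n. - int n))"
    by (rule summable_on_union)
  moreover have "range int \<union> range (\<lambda>n. - int n) = UNIV"
    by (metis (no_types, lifting) UNIV_eq_I UnI1 UnI2 int_cases2 rangeI)
  ultimately show ?thesis by simp
qed

section \<open>Discreteness of a rank two lattice and summability over it\<close>

locale period_lattice =
  fixes w1 w2 :: complex and L :: "complex set"
  assumes indep: "Im (w2 / w1) \<noteq> 0" and L_eq: "L = complex_lattice w1 w2"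
begin

lemma in_L_iff: "w \<in> L \<longleftrightarrow> (\<exists>m n. w = of_int m * w1 + of_int n * w2)"
  unfolding L_eq complex_lattice_def by simp

lemma in_L: "of_int m * w1 + of_int n * w2 \<in> L"
  unfolding in_L_iff by blast

lemma zero_in [simp]: "0 \<in> L"
  using in_L[of 0 0] by simp

lemma minus_in: assumes "w \<in> L" shows "-w \<in> L"
proof -
  obtain m n where "w = of_int m * w1 + of_int n * w2" using assms unfolding in_L_iff by blast
  thus ?thesis using in_L[of "-m" "-n"] by simp
qed

lemma minus_in_iff [simp]: "-w \<in> L \<longleftrightarrow> w \<in> L"
  using minus_in[of w] minus_in[of "-w"] by auto

lemma add_in: assumes "v \<in> L" "w \<in> L" shows "v + w \<in> L"
proof -
  obtain m n where "v = of_int m * w1 + of_int n * w2" using assms(1) unfolding in_L_iff by blast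
  moreover obtain m' n' where "w = of_int m' * w1 + of_int n' * w2"
    using assms(2) unfolding in_L_iff by blast
  ultimately show ?thesis using in_L[of "m + m'" "n + n'"] by (simp add: algebra_simps)
qed

lemma diff_in: "v \<in> L \<Longrightarrow> w \<in> L \<Longrightarrow> v - w \<in> L"
  using add_in[of v "-w"] by simp

lemma add_in_iff [simp]: "w \<in> L \<Longrightarrow> z + w \<in> L \<longleftrightarrow> z \<in> L" "w \<in> L \<Longrightarrow> w + z \<in> L \<longleftrightarrow> z \<in> L"
  "w \<in> L \<Longrightarrow> z - w \<in> L \<longleftrightarrow> z \<in> L" "w \<in> L \<Longrightarrow> w - z \<in> L \<longleftrightarrow> z \<in> L"
proof -
  assume w: "w \<in> L"
  have *: "z + w \<in> L \<longleftrightarrow> z \<in> L" for z using add_in[of z w] diff_in[of "z + w" w] w by auto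
  show "z + w \<in> L \<longleftrightarrow> z \<in> L" by (rule *)
  show "w + z \<in> L \<longleftrightarrow> z \<in> L" using *[of z] by (simp add: add.commute[of w])
  show 1: "z - w \<in> L \<longleftrightarrow> z \<in> L" using *[of "z - w"] by simp
  show "w - z \<in> L \<longleftrightarrow> z \<in> L" using 1 minus_in_iff[of "z - w"] by simp
qed

lemma periods_nonzero: "w1 \<noteq> 0" "w2 \<noteq> 0"
  using indep by auto

text \<open>Divide by \<open>w1\<close> and put \<open>\<tau> = w2 / w1\<close>. The imaginary part
  of \<open>x + y * \<tau>\<close> controls \<open>y\<close> because \<open>Im \<tau>\<close> is
  nonzero, and subtracting \<open>y * \<tau>\<close> then controls \<open>x\<close>; adding up the
  two bounds gives \<open>K\<close>.\<close>

lemma ex_norm_bound: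
  obtains K where "K > 0"
    "\<And>x y::real. \<bar>x\<bar> + \<bar>y\<bar> \<le> K * norm (of_real x * w1 + of_real y * w2)"
proof -
  define \<tau> where "\<tau> = w2 / w1"
  have \<tau>: "\<bar>Im \<tau>\<bar> > 0" using indep by (simp add: \<tau>_def)
  define K where "K = (1 + (1 + norm \<tau>) / \<bar>Im \<tau>\<bar>) / norm w1"
  have w1: "norm w1 > 0" using periods_nonzero by simp
  have "\<bar>x\<bar> + \<bar>y\<bar> \<le> K * norm (of_real x * w1 + of_real y * w2)" for x y :: real
  proof -
    define N where "N = norm (of_real x + of_real y * \<tau>)"
    have "of_real x * w1 + of_real y * w2 = w1 * (of_real x + of_real y * \<tau>)"
      using w1 by (simp add: \<tau>_def field_simps)
    hence N: "norm (of_real x * w1 + of_real y * w2) = norm w1 * N"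
      by (simp add: norm_mult N_def)
    have "\<bar>Im (of_real x + of_real y * \<tau>)\<bar> \<le> N" unfolding N_def by (rule abs_Im_le_cmod)
    hence y: "\<bar>y\<bar> \<le> N / \<bar>Im \<tau>\<bar>" using \<tau> by (simp add: abs_mult field_simps)
    have "norm (of_real x :: complex) \<le> N + norm (of_real y * \<tau>)"
      unfolding N_def by (metis add_diff_cancel_right' norm_triangle_ineq4)
    hence "\<bar>x\<bar> \<le> N + \<bar>y\<bar> * norm \<tau>" by (simp add: norm_mult)
    also have "\<dots> \<le> N + N / \<bar>Im \<tau>\<bar> * norm \<tau>" using y by (intro add_left_mono mult_right_mono) auto
    finally have "\<bar>x\<bar> + \<bar>y\<bar> \<le> N + N / \<bar>Im \<tau>\<bar> * norm \<tau> + N / \<bar>Im \<tau>\<bar>" using y by linarith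
    also have "\<dots> = K * (norm w1 * N)" using w1 \<tau> by (simp add: K_def field_simps)
    finally show ?thesis by (simp add: N)
  qed
  moreover have "K > 0" unfolding K_def using w1 \<tau> by (intro divide_pos_pos add_pos_nonneg) auto
  ultimately show ?thesis using that by blast
qed

lemma L_image: "L = (\<lambda>(m, n). of_int m * w1 + of_int n * w2) ` UNIV"
  unfolding L_eq complex_lattice_def by auto

lemma countable_L: "countable L"
  unfolding L_image by (intro countable_image) auto

lemma finite_norm_le: "finite {w \<in> L. norm w \<le> R}"
proof -
  obtain K where K: "K > 0" "\<And>x y. \<bar>x\<bar> + \<bar>y\<bar> \<le> K * norm (of_real x * w1 + of_real y * w2)"
    by (rule ex_norm_bound) blast
  define N where "N = \<lceil>K * R\<rceil>"
  have "{w \<in> L. norm w \<le> R} \<subseteq> (\<lambda>(m, n). of_int m * w1 + of_int n * w2) ` ({-N..N} \<times> {-N..N})"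
  proof
    fix w assume "w \<in> {w \<in> L. norm w \<le> R}"
    then obtain m n where w: "w = of_int m * w1 + of_int n * w2" "norm w \<le> R"
      unfolding L_image by auto
    have "\<bar>real_of_int m\<bar> + \<bar>real_of_int n\<bar> \<le> K * norm w"
      using K(2)[of m n] w(1) by simp
    also have "\<dots> \<le> K * R" using w K by (intro mult_left_mono) auto
    finally have "\<bar>real_of_int m\<bar> + \<bar>real_of_int n\<bar> \<le> N" unfolding N_def by linarith
    hence "\<bar>m\<bar> \<le> N" "\<bar>n\<bar> \<le> N" by linarith+
    hence "(m, n) \<in> {-N..N} \<times> {-N..N}" by auto
    thus "w \<in> (\<lambda>(m, n). of_int m * w1 + of_int n * w2) ` ({-N..N} \<times> {-N..N})"
      by (rule rev_image_eqI) (simp add: w(1))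
  qed
  thus ?thesis by (rule finite_subset) auto
qed

lemma inj_lattice: "inj (\<lambda>(m::int, n::int). of_int m * w1 + of_int n * w2)"
proof (rule injI, clarify)
  fix m n m' n' :: int
  assume eq: "of_int m * w1 + of_int n * w2 = of_int m' * w1 + of_int n' * w2"
  obtain K where K: "K > 0" "\<And>x y. \<bar>x\<bar> + \<bar>y\<bar> \<le> K * norm (of_real x * w1 + of_real y * w2)"
    by (rule ex_norm_bound) blast
  have "of_int (m - m') * w1 + of_int (n - n') * w2 = 0" using eq by (simp add: algebra_simps)
  hence "norm (of_real (of_int (m - m')) * w1 + of_real (of_int (n - n')) * w2) = 0"
    by (simp only: of_real_of_int_eq norm_zero)
  hence "\<bar>real_of_int (m - m')\<bar> + \<bar>real_of_int (n - n')\<bar> \<le> 0"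
    using K(2)[of "of_int (m - m')" "of_int (n - n')"] by (simp only: mult_zero_right)
  hence "real_of_int (m - m') = 0" "real_of_int (n - n') = 0" by linarith+
  thus "m = m' \<and> n = n'" by simp
qed

text \<open>The double sum is compared with a product of two single sums, which needs an upper bound
  for \<open>(1 + \<bar>m\<bar>) * (1 + \<bar>n\<bar>)\<close> by a multiple of the squared norm.
  The factor \<open>27/8 * K ^ 3\<close> is the cube of the \<open>3/2 * K\<close> that arises
  there.\<close>

lemma summable_inverse_cube: "(\<lambda>w. 1 / norm w ^ 3) summable_on (L - {0})"
proof -
  obtain K where K: "K > 0" "\<And>x y. \<bar>x\<bar> + \<bar>y\<bar> \<le> K * norm (of_real x * w1 + of_real y * w2)"
    by (rule ex_norm_bound) blast
  let ?g = "\<lambda>(m::int, n::int). of_int m * w1 + of_int n * w2"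
  let ?p = "\<lambda>m::int. (1 + \<bar>real_of_int m\<bar>) powr (-3/2)"
  obtain s where s: "(?p has_sum s) UNIV"
    using summable_on_int_powr by (auto simp: summable_on_def)
  have "(\<lambda>(m, n). ?p m * ?p n) summable_on (Sigma UNIV (\<lambda>_. UNIV))"
  proof (rule summable_on_SigmaI)
    show "((\<lambda>y. case (x, y) of (m, n) \<Rightarrow> ?p m * ?p n) has_sum (?p x * s)) UNIV" for x
      using has_sum_cmult_right[OF s] by simp
    show "(\<lambda>x. ?p x * s) summable_on UNIV"
      using summable_on_int_powr by (rule summable_on_cmult_left)
  qed auto
  hence "(\<lambda>(m, n). ?p m * ?p n) summable_on (UNIV - {(0,0)})"
    by (rule summable_on_subset) auto
  hence "(\<lambda>x. (27/8 * K ^ 3) * (case x of (m, n) \<Rightarrow> ?p m * ?p n)) summable_on (UNIV - {(0,0)})"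
    by (rule summable_on_cmult_right)
  hence "(\<lambda>x. 1 / norm (?g x) ^ 3) summable_on (UNIV - {(0,0)})"
  proof (rule summable_on_comparison_test)
    fix x :: "int \<times> int" assume x: "x \<in> UNIV - {(0,0)}"
    obtain m n where mn: "x = (m, n)" by (cases x)
    define u where "u = \<bar>real_of_int m\<bar> + \<bar>real_of_int n\<bar>"
    have "\<bar>m\<bar> + \<bar>n\<bar> \<ge> 1" using x mn by auto
    hence "real_of_int (\<bar>m\<bar> + \<bar>n\<bar>) \<ge> real_of_int 1" by (rule of_int_le_iff[THEN iffD2])
    hence u1: "u \<ge> 1" by (simp add: u_def)
    define G where "G = norm (?g x)"
    have uG: "u \<le> K * G" using K(2)[of m n] by (simp add: mn u_def G_def)
    define ab where "ab = (1 + \<bar>real_of_int m\<bar>) * (1 + \<bar>real_of_int n\<bar>)"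
    have ab: "ab > 0" unfolding ab_def by (intro mult_pos_pos) auto
    \<comment> \<open>The inequality of arithmetic and geometric means for the factors
      \<open>1 + \<bar>m\<bar>\<close> and \<open>1 + \<bar>n\<bar>\<close>, whose sum is
      \<open>2 + u\<close>.\<close>
    have "4 * ab \<le> (2 + u)\<^sup>2"
      unfolding ab_def u_def using zero_le_power2[of "\<bar>real_of_int m\<bar> - \<bar>real_of_int n\<bar>"]
      by (simp add: power2_eq_square algebra_simps)
    also have "\<dots> \<le> (3 * u)\<^sup>2" using u1 by (intro power_mono) auto
    finally have "ab \<le> (3/2 * u) ^ 2" by (simp add: power2_eq_square)
    hence "ab powr (3/2) \<le> ((3/2 * u) ^ 2) powr (3/2)" using ab by (intro powr_mono2) auto
    also have "\<dots> = (3/2 * u) ^ 3"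
      using u1 by (simp add: powr_numeral[symmetric] powr_powr del: powr_numeral)
    also have "\<dots> \<le> (3/2 * (K * G)) ^ 3"
      using uG u1 by (intro power_mono) auto
    also have "\<dots> = 27/8 * K ^ 3 * G ^ 3"
      by (simp add: power_mult_distrib power_divide)
    finally have le: "ab powr (3/2) \<le> 27/8 * K ^ 3 * G ^ 3" .
    have abp: "ab powr (3/2) > 0" using ab by simp
    have G: "G > 0" using uG u1 K(1) by (metis less_le_trans zero_less_mult_pos zero_less_one)
    have "?p m * ?p n = ab powr (-3/2)" unfolding ab_def by (subst powr_mult) auto
    also have "\<dots> = 1 / ab powr (3/2)" by (simp add: powr_minus divide_simps)
    finally have "27/8 * K ^ 3 * (?p m * ?p n) = 27/8 * K ^ 3 / ab powr (3/2)" by simp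
    moreover have "1 / G ^ 3 \<le> 27/8 * K ^ 3 / ab powr (3/2)"
      using le abp G by (simp add: field_simps)
    ultimately show "1 / norm (?g x) ^ 3 \<le> 27/8 * K ^ 3 * (case x of (m, n) \<Rightarrow> ?p m * ?p n)"
      by (simp add: mn G_def)
  qed auto
  hence "(\<lambda>w. 1 / norm w ^ 3) summable_on (?g ` (UNIV - {(0,0)}))"
    by (subst summable_on_reindex) (auto intro: inj_on_subset[OF inj_lattice] simp: o_def)
  moreover have "?g ` (UNIV - {(0,0)}) = L - {0}"
  proof -
    have "?g x = 0 \<longleftrightarrow> x = (0, 0)" for x
      using inj_eq[OF inj_lattice, of x "(0, 0)"] by simp
    thus ?thesis unfolding L_image by (auto simp del: split_paired_All)
  qed
  ultimately show ?thesis by simp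
qed

lemma eventually_notin_L: "eventually (\<lambda>w. w \<notin> L) (at z)"
proof -
  \<comment> \<open>Lattice points in the unit disc around \<open>z\<close> have norm at most
    \<open>norm z + 1\<close>, so finitely many must be avoided; \<open>z\<close> itself is kept
    because it may lie in \<open>L\<close>.\<close>
  define T where "T = - ({w \<in> L. norm w \<le> norm z + 1} - {z})"
  have "open T"
    unfolding T_def by (intro open_Compl finite_imp_closed finite_Diff finite_norm_le)
  moreover have "z \<in> T" by (simp add: T_def)
  ultimately have "eventually (\<lambda>w. w \<in> T) (nhds z)" by (rule eventually_nhds_in_open)
  moreover have "eventually (\<lambda>w. w \<in> ball z 1) (nhds z)"
    by (intro eventually_nhds_in_open) auto
  ultimately show ?thesis unfolding eventually_at_filter
  proof eventually_elim
    case (elim w)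
    have "norm w \<le> norm z + dist z w" by (metis dist_norm norm_minus_commute norm_triangle_sub)
    with elim show ?case by (auto simp: T_def)
  qed
qed

lemma closed_subset_L: "T \<subseteq> L \<Longrightarrow> closed T"
proof -
  assume T: "T \<subseteq> L"
  have "\<not> z islimpt T" for z
  proof -
    have "eventually (\<lambda>w. w \<notin> T) (at z)"
      using eventually_notin_L[of z] by eventually_elim (use T in auto)
    thus ?thesis by (simp add: islimpt_iff_eventually)
  qed
  thus "closed T" by (auto simp: closed_limpt)
qed

lemma open_compl_L: "open (- L)" "open (- (L - {0}))"
  using closed_subset_L[of L] closed_subset_L[of "L - {0}"] by (simp_all only: open_Compl subset_refl Diff_subset)

text \<open>This is what turns a vanishing derivative off the lattice into a single constant, for
  the first order equation of \<open>wp\<close> and for the quasi-periods of \<open>zeta\<close> and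
  \<open>sigma\<close>.\<close>

lemma connected_compl_L: "connected (- L)"
  using connected_open_diff_countable[of UNIV L] countable_L by (simp add: Compl_eq_Diff_UNIV connected_UNIV)

end

section \<open>The Weierstrass elliptic function\<close>

text \<open>Reads Taylor coefficients as limits, so that Laurent expansions at the origin can be
  handled by the limit calculus alone. With \<open>n = 0\<close> it is just continuity, which
  explains the factors \<open>z ^ 0\<close> in later limits.\<close>

lemma tendsto_divide_power_taylor:
  fixes f :: "complex \<Rightarrow> complex"
  assumes "f has_fps_expansion F" "\<And>k. k < n \<Longrightarrow> fps_nth F k = 0"
  shows "((\<lambda>z. f z / z ^ n) \<longlongrightarrow> fps_nth F n) (at 0)"
proof (cases "F = 0")
  case True
  have "eventually (\<lambda>z. eval_fps F z = f z) (nhds 0)"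
    using assms(1) by (simp add: has_fps_expansion_def)
  hence "eventually (\<lambda>z. f z / z ^ n = 0) (at 0)"
    unfolding eventually_at_filter by eventually_elim (simp add: True)
  thus ?thesis using True by (simp add: tendsto_eventually)
next
  case False
  hence "n \<le> subdegree F" using assms(2) by (intro subdegree_geI) auto
  hence "(\<lambda>x. if x = 0 then fps_nth F n else f x / x ^ n) has_fps_expansion (fps_shift n F)"
    using assms(1) by (intro has_fps_expansion_shift) auto
  hence "isCont (\<lambda>x. if x = 0 then fps_nth F n else f x / x ^ n) 0"
    by (rule has_fps_expansion_imp_continuous)
  hence "((\<lambda>x. if x = 0 then fps_nth F n else f x / x ^ n) \<longlongrightarrow> fps_nth F n) (at 0)"
    by (simp add: isCont_def)
  moreover have "eventually (\<lambda>x. (if x = 0 then fps_nth F n else f x / x ^ n) = f x / x ^ n) (at 0)"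
    by (auto simp: eventually_at_filter)
  ultimately show ?thesis by (rule Lim_transform_eventually)
qed

lemma has_field_derivative_inverse_power:
  fixes w :: complex
  assumes "z \<noteq> w"
  shows "((\<lambda>z. 1 / (z - w) ^ n) has_field_derivative - of_nat n / (z - w) ^ Suc n) (at z)"
proof -
  define m where "m = - int n"
  have pow: "(z - w) powi m = 1 / (z - w) ^ n" for z
    unfolding m_def power_int_minus power_int_of_nat by (simp add: inverse_eq_divide)
  have "m - 1 = - int (Suc n)" by (simp add: m_def)
  hence pow': "(z - w) powi (m - 1) = 1 / (z - w) ^ Suc n"
    by (simp only: power_int_minus power_int_of_nat inverse_eq_divide)
  have "((\<lambda>z. z - w) has_field_derivative (1 - 0)) (at z)"
    by (intro DERIV_diff DERIV_ident DERIV_const)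
  from DERIV_power_int[OF this, of m] assms
  have "((\<lambda>z. (z - w) powi m) has_field_derivative of_int m * (z - w) powi (m - 1) * (1 - 0)) (at z)"
    by simp
  thus ?thesis unfolding pow pow' by (simp add: m_def)
qed

text \<open>The case \<open>k = 0\<close> is left out because the constant \<open>c\<close>, the
  convergence correction of the lattice sum, disappears only after one differentiation.\<close>

lemma higher_deriv_inverse_square:
  fixes w c :: complex
  assumes "k > 0" "z \<noteq> w"
  shows "(deriv ^^ k) (\<lambda>z. 1 / (z - w)\<^sup>2 - c) z = (-1) ^ k * fact (k + 1) / (z - w) ^ (k + 2)"
  using assms
proof (induction k arbitrary: z rule: nat_induct_non_zero)
  case 1
  have "((\<lambda>z. 1 / (z - w)\<^sup>2 - c) has_field_derivative - of_nat 2 / (z - w) ^ Suc 2 - 0) (at z)"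
    using 1 by (intro DERIV_diff has_field_derivative_inverse_power DERIV_const)
  thus ?case by (simp add: DERIV_imp_deriv numeral_3_eq_3)
next
  case (Suc k)
  let ?g = "\<lambda>z. (-1) ^ k * fact (k + 1) * (1 / (z - w) ^ (k + 2)) :: complex"
  have "eventually (\<lambda>z. z \<in> - {w}) (nhds z)"
    using Suc.prems by (intro eventually_nhds_in_open) auto
  hence "eventually (\<lambda>z. (deriv ^^ k) (\<lambda>z. 1 / (z - w)\<^sup>2 - c) z = ?g z) (nhds z)"
    by eventually_elim (use Suc.IH in auto)
  hence "(deriv ^^ Suc k) (\<lambda>z. 1 / (z - w)\<^sup>2 - c) z = deriv ?g z"
    by (simp add: deriv_cong_ev)
  also have "deriv ?g z = (-1) ^ k * fact (k + 1) * (- of_nat (k + 2) / (z - w) ^ Suc (k + 2))"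
    using Suc.prems by (intro DERIV_imp_deriv DERIV_cmult has_field_derivative_inverse_power)
  also have "\<dots> = (-1) ^ Suc k * (of_nat (k + 2) * fact (k + 1)) / (z - w) ^ Suc (k + 2)"
    by (simp only: power_Suc[of "-1"] times_divide_eq_right mult_minus_left mult_minus_right mult_1_left ac_simps)
  also have "of_nat (k + 2) * fact (k + 1) = (fact (Suc k + 1) :: complex)"
    using fact_Suc[of "k + 1", where ?'a = complex] by (simp only: add_Suc add_Suc_right add_2_eq_Suc' Suc_eq_plus1[symmetric])
  finally have "(deriv ^^ Suc k) (\<lambda>z. 1 / (z - w)\<^sup>2 - c) z =
      (-1) ^ Suc k * fact (Suc k + 1) / (z - w) ^ Suc (k + 2)" .
  thus ?case by (simp only: add_Suc)
qed

context period_lattice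
begin

text \<open>Produces the hypothesis of the termwise differentiation lemmas from a cubic decay
  estimate; the exceptional indices are the lattice points of norm at most \<open>2 * R\<close>,
  beyond which \<open>z - w\<close> is comparable to \<open>w\<close>.\<close>

lemma lattice_majorant:
  fixes f :: "complex \<Rightarrow> complex \<Rightarrow> complex"
  assumes "\<And>R. \<exists>C. \<forall>w\<in>L-{0}. \<forall>z. norm z \<le> R \<and> 2 * R \<le> norm w \<longrightarrow> norm (f w z) \<le> C / norm w ^ 3"
  shows "\<exists>J M. finite J \<and> M summable_on (L - {0} - J) \<and>
           (\<forall>w\<in>L-{0}-J. \<forall>z\<in>A \<inter> cball 0 R. norm (f w z) \<le> (M w :: real))"
proof -
  obtain C where C: "\<And>w z. w \<in> L - {0} \<Longrightarrow> norm z \<le> R \<Longrightarrow> 2 * R \<le> norm w \<Longrightarrow> norm (f w z) \<le> C / norm w ^ 3"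
    using assms[of R] by blast
  define J where "J = {w \<in> L. norm w \<le> 2 * R}"
  have "(\<lambda>w. C * (1 / norm w ^ 3)) summable_on (L - {0} - J)"
    by (rule summable_on_cmult_right, rule summable_on_subset[OF summable_inverse_cube]) auto
  hence "(\<lambda>w. C / norm w ^ 3) summable_on (L - {0} - J)" by simp
  moreover have "finite J" unfolding J_def by (rule finite_norm_le)
  moreover have "\<forall>w\<in>L-{0}-J. \<forall>z\<in>A \<inter> cball 0 R. norm (f w z) \<le> C / norm w ^ 3"
    by (auto simp: J_def intro!: C)
  ultimately show ?thesis by blast
qed

lemma norm_diff_ge_half:
  assumes "norm (z::complex) \<le> R" "2 * R \<le> norm w"
  shows "norm (z - w) \<ge> norm w / 2"
proof -
  have "norm w - norm z \<le> norm (w - z)" by (rule norm_triangle_ineq2)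
  thus ?thesis using assms by (simp add: norm_minus_commute)
qed

definition wp_term :: "complex \<Rightarrow> complex \<Rightarrow> complex" where
  "wp_term w z = 1 / (z - w)\<^sup>2 - 1 / w\<^sup>2"

text \<open>What remains of \<open>wp\<close> after removing its principal part at the origin. It is
  holomorphic there, hence has a power series to compute with.\<close>

definition wp_reg :: "complex \<Rightarrow> complex" where
  "wp_reg z = (\<Sum>\<^sub>\<infinity>w\<in>L - {0}. wp_term w z)"

abbreviation wp where "wp \<equiv> weierstrass_wp L"
abbreviation wp' where "wp' \<equiv> deriv wp"

lemma wp_eq: "wp z = 1 / z\<^sup>2 + wp_reg z"
  unfolding weierstrass_wp_def wp_reg_def wp_term_def ..

lemma wp_term_bound:
  "\<exists>C. \<forall>w\<in>L-{0}. \<forall>z. norm z \<le> R \<and> 2 * R \<le> norm w \<longrightarrow> norm (wp_term w z) \<le> C / norm w ^ 3"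
proof (intro exI[of _ "10 * R"] ballI allI impI)
  fix w z :: complex assume w: "w \<in> L - {0}" and z: "norm z \<le> R \<and> 2 * R \<le> norm w"
  define N where "N = norm w"
  have N: "N > 0" using w by (simp add: N_def)
  have zw: "norm (z - w) \<ge> N / 2" using norm_diff_ge_half[of z R w] z by (simp add: N_def)
  hence nz: "z \<noteq> w" using N by auto
  have R: "0 \<le> R" using z norm_ge_zero[of z] by linarith
  have "wp_term w z = z * (2 * w - z) / (w\<^sup>2 * (z - w)\<^sup>2)"
    unfolding wp_term_def using w nz by (simp add: divide_simps) (simp add: power2_eq_square algebra_simps)
  also have "norm \<dots> = norm z * norm (2 * w - z) / (N\<^sup>2 * norm (z - w) ^ 2)"
    by (simp add: norm_mult norm_divide norm_power N_def)
  \<comment> \<open>Since \<open>norm z\<close> is at most \<open>N / 2\<close>, the factor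
    \<open>2 * w - z\<close> has norm at most \<open>5/2 * N\<close> and \<open>z - w\<close> has
    norm at least \<open>N / 2\<close>; together these give the constant 10.\<close>
  also have "\<dots> \<le> R * (5/2 * N) / (N\<^sup>2 * (N / 2) ^ 2)"
  proof (intro frac_le mult_mono mult_nonneg_nonneg power_mono)
    have "norm (2 * w - z) \<le> 2 * N + norm z" using norm_triangle_ineq4[of "2 * w" z] by (simp add: norm_mult N_def)
    thus "norm (2 * w - z) \<le> 5/2 * N" using z by (simp add: N_def)
  qed (use z zw N R in auto)
  also have "\<dots> = 10 * R / N ^ 3" using N by (simp add: field_simps power2_eq_square power3_eq_cube)
  finally show "norm (wp_term w z) \<le> 10 * R / norm w ^ 3" by (simp add: N_def)
qed

lemma wp_term_holomorphic: "w \<in> L - {0} \<Longrightarrow> wp_term w holomorphic_on - (L - {0})"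
  unfolding wp_term_def by (intro holomorphic_intros) auto

lemma wp_reg_holomorphic: "wp_reg holomorphic_on - (L - {0})"
  unfolding wp_reg_def
  by (rule holomorphic_on_infsum[OF open_compl_L(2) wp_term_holomorphic lattice_majorant[OF wp_term_bound]])

lemma wp_term_summable: "z \<in> - (L - {0}) \<Longrightarrow> (\<lambda>w. wp_term w z) summable_on (L - {0})"
  by (rule summable_on_locally_bounded[OF open_compl_L(2) wp_term_holomorphic lattice_majorant[OF wp_term_bound]])

lemma higher_deriv_wp_reg:
  assumes "z \<in> - (L - {0})" "k > 0"
  shows "((\<lambda>w. (-1) ^ k * fact (k + 1) / (z - w) ^ (k + 2)) has_sum (deriv ^^ k) wp_reg z) (L - {0})"
proof -
  have "((\<lambda>w. (deriv ^^ k) (wp_term w) z) has_sum (deriv ^^ k) wp_reg z) (L - {0})"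
    unfolding wp_reg_def
    by (rule has_sum_higher_deriv[OF open_compl_L(2) wp_term_holomorphic lattice_majorant[OF wp_term_bound] assms(1)])
  thus ?thesis
  proof (rule has_sum_cong[THEN iffD1, rotated])
    fix w assume "w \<in> L - {0}"
    hence "z \<noteq> w" using assms by auto
    thus "(deriv ^^ k) (wp_term w) z = (-1) ^ k * fact (k + 1) / (z - w) ^ (k + 2)"
      unfolding wp_term_def using higher_deriv_inverse_square[OF assms(2)] by blast
  qed
qed

text \<open>The Eisenstein sums without normalisation: the invariants of the curve are
  \<open>60 * eisenstein 4\<close> and \<open>140 * eisenstein 6\<close>.\<close>

definition eisenstein :: "nat \<Rightarrow> complex" where
  "eisenstein k = (\<Sum>\<^sub>\<infinity>w\<in>L - {0}. 1 / w ^ k)"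

lemma higher_deriv_wp_reg_0:
  assumes "k > 0"
  shows "(deriv ^^ k) wp_reg 0 = fact (k + 1) * eisenstein (k + 2)"
proof -
  have eq: "(-1) ^ k * fact (k + 1) / (0 - w) ^ (k + 2) = fact (k + 1) * (1 / w ^ (k + 2))" for w :: complex
    using power_minus[of w "k + 2"] by (auto simp: divide_simps uminus_power_if split: if_splits)
  have "((\<lambda>w. fact (k + 1) * (1 / w ^ (k + 2))) has_sum (deriv ^^ k) wp_reg 0) (L - {0})"
    using higher_deriv_wp_reg[of 0 k] assms unfolding eq by simp
  hence "(deriv ^^ k) wp_reg 0 = (\<Sum>\<^sub>\<infinity>w\<in>L-{0}. fact (k + 1) * (1 / w ^ (k + 2)))"
    by (simp add: infsumI)
  thus ?thesis unfolding eisenstein_def by (simp only: infsum_cmult_right')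
qed

lemma infsum_lattice_minus: "(\<Sum>\<^sub>\<infinity>w\<in>L - {0}. f (-w)) = (\<Sum>\<^sub>\<infinity>w\<in>L - {0}. f w)"
  by (rule infsum_reindex_bij_witness[of _ uminus uminus]) auto

lemma wp_reg_0: "wp_reg 0 = 0"
  unfolding wp_reg_def wp_term_def by simp

lemma wp_reg_minus: "wp_reg (-z) = wp_reg z"
proof -
  have "wp_term w (-z) = wp_term (-w) z" for w
    unfolding wp_term_def by (simp add: power2_eq_square algebra_simps)
  thus ?thesis unfolding wp_reg_def using infsum_lattice_minus[of "\<lambda>w. wp_term w z"] by simp
qed

lemma wp_minus [simp]: "wp (-z) = wp z"
  by (simp add: wp_eq wp_reg_minus)

lemma eisenstein_odd: "odd k \<Longrightarrow> eisenstein k = 0"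
proof -
  assume k: "odd k"
  have "1 / (-w) ^ k = - (1 / w ^ k)" for w :: complex using k by (simp add: power_minus_odd)
  hence "eisenstein k = (\<Sum>\<^sub>\<infinity>w\<in>L - {0}. - (1 / w ^ k))"
    unfolding eisenstein_def using infsum_lattice_minus[of "\<lambda>w. 1 / w ^ k"] by (simp only:)
  also have "\<dots> = - eisenstein k" unfolding eisenstein_def by (rule infsum_uminus)
  finally show ?thesis by simp
qed

lemma zero_in_compl: "0 \<in> - (L - {0})" by simp

text \<open>For positive \<open>k\<close> the coefficient is
  \<open>(k + 1) * eisenstein (k + 2)\<close>, which vanishes for odd \<open>k\<close> by symmetry
  of the lattice. Order four suffices: in \<open>wp'^2\<close> and \<open>wp^3\<close>, which have
  poles of order six, the constant term sees no further coefficient.\<close>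

lemma wp_reg_fps:
  obtains F where "wp_reg has_fps_expansion F" "fps_nth F 0 = 0" "fps_nth F 1 = 0"
    "fps_nth F 2 = 3 * eisenstein 4" "fps_nth F 3 = 0" "fps_nth F 4 = 5 * eisenstein 6"
proof -
  have "wp_reg analytic_on {0}"
    using wp_reg_holomorphic open_compl_L(2) zero_in_compl analytic_at by blast
  then obtain F where F: "wp_reg has_fps_expansion F"
    using analytic_at_imp_has_fps_expansion_0 by blast
  have nth: "fps_nth F k = (deriv ^^ k) wp_reg 0 / fact k" for k
    by (rule fps_nth_fps_expansion[OF F])
  show ?thesis
    using nth[of 0] nth[of 1] nth[of 2] nth[of 3] nth[of 4]
      higher_deriv_wp_reg_0[of 1] higher_deriv_wp_reg_0[of 2] higher_deriv_wp_reg_0[of 3] higher_deriv_wp_reg_0[of 4]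
      eisenstein_odd[of 3] eisenstein_odd[of 5]
    by (intro that[OF F]) (simp_all add: wp_reg_0 fact_numeral numeral_3_eq_3[symmetric])
qed

lemma wp_holomorphic: "wp holomorphic_on - L"
proof -
  have "(\<lambda>z. 1 / z\<^sup>2 + wp_reg z) holomorphic_on - L"
    by (intro holomorphic_intros holomorphic_on_subset[OF wp_reg_holomorphic]) auto
  thus ?thesis by (simp add: wp_eq[abs_def])
qed

lemma wp'_holomorphic: "wp' holomorphic_on - L"
  using wp_holomorphic open_compl_L(1) by (rule holomorphic_deriv)

lemma wp_has_deriv: "z \<notin> L \<Longrightarrow> (wp has_field_derivative wp' z) (at z)"
  using holomorphic_derivI[OF wp_holomorphic open_compl_L(1)] by simp

lemma wp'_has_deriv: "z \<notin> L \<Longrightarrow> (wp' has_field_derivative deriv wp' z) (at z)"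
  using holomorphic_derivI[OF wp'_holomorphic open_compl_L(1)] by simp

lemma ev_notin: "z \<notin> L \<Longrightarrow> eventually (\<lambda>z. z \<notin> L) (nhds z)"
  using eventually_nhds_in_open[OF open_compl_L(1)] by simp

text \<open>The decomposition is valid at every point off the lattice; it is meant for limits at the
  origin, where the second summands stay regular.\<close>

lemma deriv_near_0:
  assumes "z \<notin> L"
  shows "wp' z = -2 / z ^ 3 + deriv wp_reg z" "deriv wp' z = 6 / z ^ 4 + deriv (deriv wp_reg) z"
proof -
  have *: "wp' z = -2 / z ^ 3 + deriv wp_reg z" if "z \<notin> L" for z
  proof -
    have [simp]: "z \<noteq> 0" using that by auto
    have "(wp_reg has_field_derivative deriv wp_reg z) (at z)"
      using that by (intro holomorphic_derivI[OF wp_reg_holomorphic open_compl_L(2)]) auto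
    from DERIV_add[OF has_field_derivative_inverse_power[of z 0 2] this]
    have "((\<lambda>z. 1 / z\<^sup>2 + wp_reg z) has_field_derivative (-2 / z ^ 3 + deriv wp_reg z)) (at z)"
      by (simp add: numeral_3_eq_3)
    thus ?thesis by (simp add: wp_eq[abs_def] DERIV_imp_deriv)
  qed
  show "wp' z = -2 / z ^ 3 + deriv wp_reg z" using * assms .
  have [simp]: "z \<noteq> 0" using assms by auto
  have "deriv wp' z = deriv (\<lambda>z. -2 / z ^ 3 + deriv wp_reg z) z"
    by (rule deriv_cong_ev) (use ev_notin[OF assms] in \<open>auto elim!: eventually_mono simp: *\<close>)
  also have "(deriv wp_reg has_field_derivative deriv (deriv wp_reg) z) (at z)"
    using assms by (intro holomorphic_derivI[OF holomorphic_deriv[OF wp_reg_holomorphic open_compl_L(2)] open_compl_L(2)]) auto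
  from DERIV_add[OF DERIV_cmult[OF has_field_derivative_inverse_power[of z 0 3], of "-2"] this]
  have "((\<lambda>z. -2 / z ^ 3 + deriv wp_reg z) has_field_derivative (6 / z ^ 4 + deriv (deriv wp_reg) z)) (at z)"
    by (simp add: eval_nat_numeral)
  hence "deriv (\<lambda>z. -2 / z ^ 3 + deriv wp_reg z) z = 6 / z ^ 4 + deriv (deriv wp_reg) z"
    by (rule DERIV_imp_deriv)
  finally show "deriv wp' z = 6 / z ^ 4 + deriv (deriv wp_reg) z" .
qed

text \<open>In a difference of two values the corrections \<open>1 / w\<^sup>2\<close> cancel and
  the principal part becomes the summand for \<open>w = 0\<close>. The sum then runs over the whole
  lattice, so a lattice translation is a mere reindexing.\<close>

lemma wp_diff_has_sum:
  assumes "z \<notin> L" "a \<notin> L"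
  shows "((\<lambda>w. 1 / (z - w)\<^sup>2 - 1 / (a - w)\<^sup>2) has_sum (wp z - wp a)) L"
proof -
  have "(wp_term_at has_sum wp_reg z) (L - {0})" if "wp_term_at = (\<lambda>w. wp_term w z)" "z \<notin> L" for wp_term_at z
    unfolding wp_reg_def that(1) by (intro has_sum_infsum wp_term_summable) (use that in auto)
  note sums = this[OF refl]
  have "((\<lambda>w. - wp_term w a) has_sum - wp_reg a) (L - {0})"
    using sums[OF assms(2)] by (simp add: has_sum_uminus)
  from has_sum_add[OF sums[OF assms(1)] this]
  have "((\<lambda>w. wp_term w z - wp_term w a) has_sum (wp_reg z - wp_reg a)) (L - {0})" by simp
  hence "((\<lambda>w. 1 / (z - w)\<^sup>2 - 1 / (a - w)\<^sup>2) has_sum (wp_reg z - wp_reg a)) (L - {0})"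
    unfolding wp_term_def by simp
  hence "((\<lambda>w. 1 / (z - w)\<^sup>2 - 1 / (a - w)\<^sup>2) has_sum
      ((1 / (z - 0)\<^sup>2 - 1 / (a - 0)\<^sup>2) + (wp_reg z - wp_reg a))) (insert 0 (L - {0}))"
    by (intro has_sum_insert) auto
  moreover have "insert 0 (L - {0}) = L" by auto
  ultimately show ?thesis by (simp add: wp_eq algebra_simps)
qed

lemma wp_diff_shift:
  assumes "z \<notin> L" "a \<notin> L" "v \<in> L"
  shows "wp (z + v) - wp (a + v) = wp z - wp a"
proof -
  have "((\<lambda>w. 1 / (z + v - w)\<^sup>2 - 1 / (a + v - w)\<^sup>2) has_sum (wp (z + v) - wp (a + v))) L"
    by (rule wp_diff_has_sum) (use assms in auto)
  also have "?this \<longleftrightarrow> ((\<lambda>w. 1 / (z - w)\<^sup>2 - 1 / (a - w)\<^sup>2) has_sum (wp (z + v) - wp (a + v))) L"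
    by (rule has_sum_reindex_bij_witness[of _ "\<lambda>w. w + v" "\<lambda>w. w - v"]) (simp_all add: assms(3) diff_diff_eq2)
  finally show ?thesis using wp_diff_has_sum[OF assms(1,2)] by (rule has_sum_unique)
qed

text \<open>The increment \<open>wp (z + v) - wp z\<close> is an odd function of \<open>v\<close> because it does not depend on
  \<open>z\<close>, and an even one because \<open>wp\<close> is even.\<close>
lemma wp_periodic:
  assumes "z \<notin> L" "v \<in> L"
  shows "wp (z + v) = wp z"
proof -
  have "wp ((z - v) + v) - wp (z + v) = wp (z - v) - wp z"
    using wp_diff_shift[of "z - v" z v] assms by simp
  moreover have "wp (- z + v) - wp (z + v) = wp (-z) - wp z"
    by (rule wp_diff_shift) (use assms in auto)
  moreover have "wp (-z + v) = wp (z - v)" using wp_minus[of "z - v"] by simp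
  ultimately show ?thesis by simp
qed

lemma wp'_periodic:
  assumes "z \<notin> L" "v \<in> L"
  shows "wp' (z + v) = wp' z"
proof -
  have "((\<lambda>z. wp (z + v)) has_field_derivative wp' (z + v)) (at z)"
    using wp_has_deriv[of "z + v"] assms by (simp add: DERIV_shift)
  moreover have "eventually (\<lambda>z. wp (z + v) = wp z) (nhds z)"
    using ev_notin[OF assms(1)] by eventually_elim (use assms in \<open>simp add: wp_periodic\<close>)
  ultimately have "(wp has_field_derivative wp' (z + v)) (at z)"
    by (subst (asm) DERIV_cong_ev[OF refl _ refl])
  thus ?thesis by (simp add: DERIV_imp_deriv)
qed

lemma wp'_minus: "z \<notin> L \<Longrightarrow> wp' (-z) = - wp' z"
proof -
  assume z: "z \<notin> L"
  have "((\<lambda>z. wp (-z)) has_field_derivative wp' (-z) * (-1)) (at z)"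
    using z by (intro DERIV_chain2[OF wp_has_deriv] DERIV_minus[OF DERIV_ident]) simp
  thus ?thesis by (simp add: DERIV_imp_deriv)
qed

end

section \<open>Elliptic functions without poles and the differential equation\<close>

context period_lattice
begin

text \<open>The set \<open>Q + L\<close>: all lattice translates of a finite list of possible
  singularities.\<close>

definition cosets :: "complex set \<Rightarrow> complex set" where
  "cosets Q = {z. \<exists>q\<in>Q. z - q \<in> L}"

lemma cosets_add_iff: "w \<in> L \<Longrightarrow> z + w \<in> cosets Q \<longleftrightarrow> z \<in> cosets Q"
proof -
  assume w: "w \<in> L"
  have "z + w - q \<in> L \<longleftrightarrow> z - q \<in> L" for q
    using add_in_iff(1)[OF w, of "z - q"] by (simp only: diff_add_eq[symmetric])
  thus ?thesis by (simp add: cosets_def)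
qed

lemma eventually_notin_cosets:
  assumes "finite Q"
  shows "eventually (\<lambda>z. z \<notin> cosets Q) (at p)"
proof -
  have "eventually (\<lambda>z. z - q \<notin> L) (at p)" for q
    using eventually_notin_L[of "p - q"] unfolding filtermap_at_shift[symmetric] eventually_filtermap .
  hence "eventually (\<lambda>z. \<forall>q\<in>Q. z - q \<notin> L) (at p)"
    using assms by (intro eventually_ball_finite) auto
  thus ?thesis by (simp add: cosets_def)
qed

lemma open_compl_cosets: "finite Q \<Longrightarrow> open (- cosets Q)"
proof -
  assume Q: "finite Q"
  have "\<not> z islimpt cosets Q" for z
    using eventually_notin_cosets[OF Q, of z] by (simp add: islimpt_iff_eventually)
  hence "closed (cosets Q)" by (auto simp: closed_limpt)
  thus ?thesis by (simp add: open_Compl)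
qed

text \<open>Subtracting the integer parts of the real coordinates moves \<open>z\<close> into the
  period parallelogram. Only a disc containing it is recorded, since compactness is all that is
  used.\<close>

lemma ex_reduced:
  obtains w where "w \<in> L" "norm (z + w) \<le> norm w1 + norm w2"
proof -
  define \<tau> where "\<tau> = w2 / w1"
  have \<tau>: "Im \<tau> \<noteq> 0" using indep by (simp add: \<tau>_def)
  define y where "y = Im (z / w1) / Im \<tau>"
  define x where "x = Re (z / w1) - y * Re \<tau>"
  have "z / w1 = of_real x + of_real y * \<tau>"
    using \<tau> by (intro complex_eqI) (simp_all add: x_def y_def)
  hence "z = (of_real x + of_real y * \<tau>) * w1" using periods_nonzero by (metis nonzero_divide_eq_eq)
  hence z: "z = of_real x * w1 + of_real y * w2"
    using periods_nonzero by (simp add: \<tau>_def distrib_right)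
  define w where "w = of_int (- \<lfloor>x\<rfloor>) * w1 + of_int (- \<lfloor>y\<rfloor>) * w2"
  have fr: "x - of_int \<lfloor>x\<rfloor> = frac x" for x :: real by (simp add: frac_def)
  have "z + w = of_real (x - of_int \<lfloor>x\<rfloor>) * w1 + of_real (y - of_int \<lfloor>y\<rfloor>) * w2"
    unfolding z w_def by (simp add: ring_distribs)
  hence "z + w = of_real (frac x) * w1 + of_real (frac y) * w2" by (simp only: fr)
  also have "norm \<dots> \<le> norm (of_real (frac x) * w1) + norm (of_real (frac y) * w2)"
    by (rule norm_triangle_ineq)
  also have "\<dots> \<le> 1 * norm w1 + 1 * norm w2"
    unfolding norm_mult norm_of_real
    by (intro add_mono mult_right_mono) (simp_all add: frac_lt_1 less_imp_le)
  finally have "norm (z + w) \<le> norm w1 + norm w2" by simp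
  moreover have "w \<in> L" unfolding w_def by (rule in_L)
  ultimately show ?thesis using that by blast
qed

text \<open>The limit condition makes each singularity removable. The extended function is entire
  and periodic, and by \<open>ex_reduced\<close> it takes all its values on one compact disc, so
  Liouville's theorem applies. The conclusion is confined to the complement of
  \<open>cosets Q\<close>, where the values of \<open>f\<close> are meaningful.\<close>

lemma elliptic_constant:
  assumes Q: "finite Q"
    and holo: "f holomorphic_on - cosets Q"
    and periodic: "\<And>z w. z \<notin> cosets Q \<Longrightarrow> w \<in> L \<Longrightarrow> f (z + w) = f z"
    and lim: "\<And>q. q \<in> Q \<Longrightarrow> ((\<lambda>z. (z - q) * f z) \<longlongrightarrow> 0) (at q)"
  obtains c where "\<And>z. z \<notin> cosets Q \<Longrightarrow> f z = c"
proof -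
  define S where "S = cosets Q"
  have opn: "open (- S)" and ev: "\<And>p. eventually (\<lambda>z. z \<notin> S) (at p)"
    unfolding S_def using open_compl_cosets[OF Q] eventually_notin_cosets[OF Q] by auto
  have ext: "\<exists>r g. r > 0 \<and> g holomorphic_on ball p r \<and> ball p r - {p} \<subseteq> - S \<and> (\<forall>z\<in>ball p r - {p}. g z = f z)"
    if p: "p \<in> S" for p
  proof -
    obtain q where q: "q \<in> Q" "p - q \<in> L" using p by (auto simp: S_def cosets_def)
    define w where "w = p - q"
    have qw: "q \<in> Q" "w \<in> L" "p = q + w" using q by (simp_all add: w_def)
    \<comment> \<open>The limit is assumed at the representatives in \<open>Q\<close> only;
      periodicity carries it over to every translate \<open>p = q + w\<close>.\<close>
    have "((\<lambda>z. (z + (-w) - q) * f (z + (-w))) \<longlongrightarrow> 0) (at (q - (-w)))"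
      by (rule LIM_offset[OF lim[OF qw(1)]])
    hence "((\<lambda>z. (z - p) * f (z - w)) \<longlongrightarrow> 0) (at p)"
      by (simp add: qw(3) diff_diff_eq add.commute)
    moreover have "eventually (\<lambda>z. (z - p) * f (z - w) = (z - p) * f z) (at p)"
      using ev[of p]
    proof eventually_elim
      case (elim z)
      hence "f (z + (-w)) = f z" using qw(2) unfolding S_def by (intro periodic) auto
      thus ?case by simp
    qed
    ultimately have lim': "((\<lambda>z. (z - p) * f z) \<longlongrightarrow> 0) (at p)"
      by (rule Lim_transform_eventually)
    obtain r where r: "r > 0" "\<And>z. z \<in> ball p r \<Longrightarrow> z \<noteq> p \<Longrightarrow> z \<notin> S"
      using ev[of p] unfolding eventually_at by (auto simp: dist_commute)
    have sub: "ball p r - {p} \<subseteq> - S" using r(2) by blast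
    have "f holomorphic_on ball p r - {p}" using holo sub unfolding S_def by (rule holomorphic_on_subset)
    from holomorphic_on_extend_lim[OF this] lim' r(1)
    obtain g where "g holomorphic_on ball p r" "\<forall>z\<in>ball p r - {p}. g z = f z" by auto
    thus ?thesis using r(1) sub by blast
  qed
  \<comment> \<open>Filling each hole with the limit of \<open>f\<close> gives one global function,
    while the extensions \<open>g\<close> exist only on separate discs.\<close>
  define F where "F = (\<lambda>z. if z \<in> S then Lim (at z) f else f z)"
  have F_diff: "F field_differentiable (at z)" for z
  proof (cases "z \<in> S")
    case True
    then obtain r g where rg: "r > 0" "g holomorphic_on ball z r" "ball z r - {z} \<subseteq> - S"
        "\<forall>y\<in>ball z r - {z}. g y = f y"
      using ext by blast
    have ev_ball: "eventually (\<lambda>y. y \<in> ball z r) (nhds z)"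
      using rg(1) by (intro eventually_nhds_in_open) auto
    have "isCont g z"
      using holomorphic_on_imp_continuous_on[OF rg(2)] rg(1) by (simp add: continuous_on_eq_continuous_at)
    hence "(g \<longlongrightarrow> g z) (at z)" by (simp add: isCont_def)
    moreover have "eventually (\<lambda>y. g y = f y) (at z)"
      using ev_ball unfolding eventually_at_filter by eventually_elim (use rg(4) in blast)
    ultimately have "(f \<longlongrightarrow> g z) (at z)" by (rule Lim_transform_eventually)
    hence lim_f: "Lim (at z) f = g z" by (intro tendsto_Lim) auto
    have "eventually (\<lambda>y. g y = F y) (nhds z)"
      using ev_ball
    proof eventually_elim
      case (elim y)
      show ?case
      proof (cases "y = z")
        case True
        thus ?thesis using lim_f \<open>z \<in> S\<close> by (simp add: F_def)
      next
        case False
        hence "y \<notin> S" "g y = f y" using elim rg(3,4) by auto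
        thus ?thesis by (simp add: F_def)
      qed
    qed
    moreover have "g field_differentiable (at z)"
      using rg(1,2) by (intro holomorphic_on_imp_differentiable_at[OF rg(2)]) auto
    ultimately show ?thesis
      unfolding field_differentiable_def using DERIV_cong_ev[OF refl _ refl] by blast
  next
    case False
    have "eventually (\<lambda>y. y \<in> - S) (nhds z)" using opn False by (intro eventually_nhds_in_open) auto
    hence "eventually (\<lambda>y. f y = F y) (nhds z)" by eventually_elim (simp add: F_def)
    moreover have "f field_differentiable (at z)"
      using holo opn False unfolding S_def by (intro holomorphic_on_imp_differentiable_at) auto
    ultimately show ?thesis
      unfolding field_differentiable_def using DERIV_cong_ev[OF refl _ refl] by blast
  qed
  hence F_holo: "F holomorphic_on UNIV" by (simp add: holomorphic_on_def field_differentiable_at_within)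
  have F_cont: "isCont F z" for z
    using F_diff field_differentiable_imp_continuous_at by blast
  have F_periodic: "F (z + w) = F z" if w: "w \<in> L" for z w
  proof -
    have "isCont (\<lambda>z. F (z + w)) z"
      by (intro isCont_o2[of z "\<lambda>z. z + w" F] F_cont continuous_intros)
    hence "((\<lambda>z. F (z + w)) \<longlongrightarrow> F (z + w)) (at z)" by (simp add: isCont_def)
    moreover have "eventually (\<lambda>z. F (z + w) = F z) (at z)"
      using ev[of z]
    proof eventually_elim
      case (elim y)
      thus ?case using periodic[of y w] w cosets_add_iff[OF w, of y Q] by (simp add: F_def S_def)
    qed
    ultimately have "(F \<longlongrightarrow> F (z + w)) (at z)" by (rule Lim_transform_eventually)
    moreover have "(F \<longlongrightarrow> F z) (at z)" using F_cont[of z] by (simp add: isCont_def)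
    ultimately show ?thesis by (intro tendsto_unique[of "at z" F]) auto
  qed
  have "continuous_on (cball 0 (norm w1 + norm w2)) F"
    using F_cont by (simp add: continuous_at_imp_continuous_on)
  hence "bounded (F ` cball 0 (norm w1 + norm w2))"
    by (intro compact_imp_bounded compact_continuous_image) auto
  then obtain B where B: "\<forall>y\<in>F ` cball 0 (norm w1 + norm w2). norm y \<le> B"
    unfolding bounded_iff by blast
  have "norm (F z) \<le> B" for z
  proof -
    obtain w where "w \<in> L" "norm (z + w) \<le> norm w1 + norm w2" by (rule ex_reduced)
    moreover from this have "F (z + w) \<in> F ` cball 0 (norm w1 + norm w2)" by (intro imageI) simp
    ultimately show ?thesis using B F_periodic[of w z] by metis
  qed
  hence "bounded (range F)" by (auto simp: bounded_iff)
  with F_holo have "F constant_on UNIV" by (rule Liouville_theorem)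
  then obtain c where "\<And>z. F z = c" by (auto simp: constant_on_def)
  hence "f z = c" if "z \<notin> cosets Q" for z
    using that unfolding F_def S_def by metis
  thus ?thesis using that by blast
qed

section \<open>The differential equations, by expansion at the origin\<close>

lemma cosets_0 [simp]: "cosets {0} = L"
  by (simp add: cosets_def)

lemma tendsto_wp_reg_0: "(wp_reg \<longlongrightarrow> 0) (at 0)"
proof -
  have "isCont wp_reg 0"
    using wp_reg_holomorphic open_compl_L(2) zero_in_compl
    by (meson continuous_on_eq_continuous_at holomorphic_on_imp_continuous_on)
  thus ?thesis by (simp add: isCont_def wp_reg_0)
qed

lemma ev_at_0: "eventually (\<lambda>z. z \<notin> L \<and> z \<noteq> 0) (at 0)"
  using eventually_notin_L[of 0] by eventually_elim auto

lemma wp''_periodic: "w \<in> L \<Longrightarrow> z \<notin> L \<Longrightarrow> deriv wp' (z + w) = deriv wp' z"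
proof -
  assume w: "w \<in> L" and z: "z \<notin> L"
  have "((\<lambda>z. wp' (z + w)) has_field_derivative deriv wp' (z + w)) (at z)"
    using wp'_has_deriv[of "z + w"] w z by (simp add: DERIV_shift)
  moreover have "eventually (\<lambda>z. wp' (z + w) = wp' z) (nhds z)"
    using ev_notin[OF z] by eventually_elim (use w in \<open>simp add: wp'_periodic\<close>)
  ultimately have "(wp' has_field_derivative deriv wp' (z + w)) (at z)"
    by (subst (asm) DERIV_cong_ev[OF refl _ refl])
  thus ?thesis by (simp add: DERIV_imp_deriv)
qed

text \<open>The poles of order four cancel at once. By the Taylor coefficient
  \<open>3 * eisenstein 4\<close> of \<open>wp_reg\<close>, what is left tends to
  \<open>(6 - 36 + 30) * eisenstein 4 = 0\<close> at the origin, so the elliptic function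
  \<open>f\<close> is the constant zero.\<close>

lemma wp_ode2:
  assumes "z \<notin> L"
  shows "deriv wp' z = 6 * wp z ^ 2 - 30 * eisenstein 4"
proof -
  define f where "f = (\<lambda>z. deriv wp' z - 6 * wp z ^ 2 + 30 * eisenstein 4)"
  obtain F where F: "wp_reg has_fps_expansion F" "fps_nth F 0 = 0" "fps_nth F 1 = 0"
    "fps_nth F 2 = 3 * eisenstein 4" "fps_nth F 3 = 0" "fps_nth F 4 = 5 * eisenstein 6"
    by (rule wp_reg_fps)
  have l1: "((\<lambda>z. wp_reg z / z ^ 2) \<longlongrightarrow> 3 * eisenstein 4) (at 0)"
  proof -
    have "fps_nth F k = 0" if "k < 2" for k
      using less_2_cases[OF that] F(2,3) by auto
    thus ?thesis using tendsto_divide_power_taylor[OF F(1), of 2] by (simp add: F(4))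
  qed
  have l2: "((\<lambda>z. deriv (deriv wp_reg) z / z ^ 0) \<longlongrightarrow> 6 * eisenstein 4) (at 0)"
    using tendsto_divide_power_taylor[OF has_fps_expansion_deriv[OF has_fps_expansion_deriv[OF F(1)]], of 0] F(4)
    by (simp add: fps_deriv_nth eval_nat_numeral mult.assoc)
  have "((\<lambda>z. deriv (deriv wp_reg) z / z ^ 0 - 12 * (wp_reg z / z ^ 2) - 6 * wp_reg z ^ 2 + 30 * eisenstein 4)
      \<longlongrightarrow> 6 * eisenstein 4 - 12 * (3 * eisenstein 4) - 6 * 0 ^ 2 + 30 * eisenstein 4) (at 0)"
    by (intro tendsto_intros l1 l2 tendsto_wp_reg_0)
  moreover have "eventually (\<lambda>z. deriv (deriv wp_reg) z / z ^ 0 - 12 * (wp_reg z / z ^ 2) - 6 * wp_reg z ^ 2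
      + 30 * eisenstein 4 = f z) (at 0)"
    using ev_at_0
  proof eventually_elim
    case (elim z)
    have "6 * wp z ^ 2 = 6 / z ^ 4 + 12 * (wp_reg z / z ^ 2) + 6 * wp_reg z ^ 2"
    proof -
      have "6 / z ^ 4 = 6 * (1 / z ^ 2) ^ 2" by (simp add: power_divide)
      moreover have "wp_reg z / z ^ 2 = wp_reg z * (1 / z ^ 2)" by simp
      ultimately show ?thesis unfolding wp_eq by algebra
    qed
    thus ?case unfolding f_def using deriv_near_0(2) elim by simp
  qed
  ultimately have "(f \<longlongrightarrow> 6 * eisenstein 4 - 12 * (3 * eisenstein 4) - 6 * 0 ^ 2 + 30 * eisenstein 4) (at 0)"
    by (rule Lim_transform_eventually)
  hence lim: "(f \<longlongrightarrow> 0) (at 0)" by simp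
  have "f holomorphic_on - L"
    unfolding f_def
    by (intro holomorphic_intros wp_holomorphic holomorphic_deriv[OF wp'_holomorphic open_compl_L(1)])
  moreover have "f (z + w) = f z" if "z \<notin> L" "w \<in> L" for z w
    unfolding f_def using that by (simp add: wp_periodic wp''_periodic)
  moreover have "((\<lambda>z. (z - 0) * f z) \<longlongrightarrow> (0 - 0) * 0) (at 0)"
    by (intro tendsto_intros lim)
  ultimately obtain c where c: "\<And>z. z \<notin> L \<Longrightarrow> f z = c"
    using elliptic_constant[of "{0}" f] by auto
  have "eventually (\<lambda>z. f z = c) (at 0)"
    using eventually_notin_L[of 0] by eventually_elim (rule c)
  hence "(f \<longlongrightarrow> c) (at 0)" by (rule tendsto_eventually)
  hence "c = 0" using lim by (intro tendsto_unique[of "at 0" f]) auto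
  hence "deriv wp' z - 6 * wp z ^ 2 + 30 * eisenstein 4 = 0" using c[OF assms] by (simp add: f_def)
  thus ?thesis by algebra
qed

text \<open>The first order equation is an integral of the second order one: by
  \<open>wp_ode2\<close> the derivative of \<open>f\<close> vanishes, and the constant
  \<open>k\<close> is found as the limit at the origin, namely \<open>-28 * d\<close>.\<close>

lemma wp_ode1:
  assumes "z \<notin> L"
  shows "wp' z ^ 2 = 4 * wp z ^ 3 - 60 * eisenstein 4 * wp z - 140 * eisenstein 6"
proof -
  define c where "c = 3 * eisenstein 4"
  define d where "d = 5 * eisenstein 6"
  define f where "f = (\<lambda>z. wp' z ^ 2 - 4 * wp z ^ 3 + 20 * c * wp z)"
  obtain F where F: "wp_reg has_fps_expansion F" "fps_nth F 0 = 0" "fps_nth F 1 = 0"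
    "fps_nth F 2 = c" "fps_nth F 3 = 0" "fps_nth F 4 = d"
    unfolding c_def d_def by (rule wp_reg_fps)
  have "(f has_field_derivative 0) (at z)" if z: "z \<notin> L" for z
  proof -
    have "(f has_field_derivative (of_nat 2 * (deriv wp' z * wp' z ^ (2 - Suc 0))
        - 4 * (of_nat 3 * (wp' z * wp z ^ (3 - Suc 0))) + 20 * c * wp' z)) (at z)"
      unfolding f_def
      by (intro DERIV_add DERIV_diff DERIV_cmult DERIV_power wp_has_deriv wp'_has_deriv z)
    moreover have "of_nat 2 * (deriv wp' z * wp' z ^ (2 - Suc 0))
        - 4 * (of_nat 3 * (wp' z * wp z ^ (3 - Suc 0))) + 20 * c * wp' z = 0"
      unfolding wp_ode2[OF z] c_def by (simp add: algebra_simps)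
    ultimately show ?thesis by simp
  qed
  hence "f constant_on - L"
    using has_field_derivative_0_imp_constant_on[of "- L" f] connected_compl_L open_compl_L(1) by auto
  then obtain k where k: "\<And>z. z \<notin> L \<Longrightarrow> f z = k" by (auto simp: constant_on_def)
  have less4: "n = 0 \<or> n = 1 \<or> n = 2 \<or> n = 3" if "n < (4::nat)" for n using that by linarith
  have l1: "((\<lambda>z. wp_reg z / z ^ 2) \<longlongrightarrow> c) (at 0)"
  proof -
    have "fps_nth F k = 0" if "k < 2" for k
      using less_2_cases[OF that] F(2,3) by auto
    thus ?thesis using tendsto_divide_power_taylor[OF F(1), of 2] by (simp add: F(4))
  qed
  have E2: "(\<lambda>z. wp_reg z - c * z ^ 2) has_fps_expansion (F - fps_const c * fps_X ^ 2)"
    by (intro has_fps_expansion_diff F(1) has_fps_expansion_cmult_left has_fps_expansion_fps_X_power)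
  have l2: "((\<lambda>z. (wp_reg z - c * z ^ 2) / z ^ 4) \<longlongrightarrow> d) (at 0)"
  proof -
    have "fps_nth (F - fps_const c * fps_X ^ 2) n = 0" if "n < 4" for n
      using less4[OF that] F(2-5) by (elim disjE) (simp_all add: fps_X_power_nth)
    moreover have "fps_nth (F - fps_const c * fps_X ^ 2) 4 = d"
      using F(6) by (simp add: fps_X_power_nth)
    ultimately show ?thesis using tendsto_divide_power_taylor[OF E2, of 4] by simp
  qed
  have E3: "(\<lambda>z. deriv wp_reg z - (2 * c) * z ^ 1) has_fps_expansion (fps_deriv F - fps_const (2 * c) * fps_X ^ 1)"
    by (intro has_fps_expansion_diff has_fps_expansion_deriv F(1) has_fps_expansion_cmult_left has_fps_expansion_fps_X_power)
  have less3: "n = 0 \<or> n = 1 \<or> n = 2" if "n < (3::nat)" for n using that by linarith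
  have l3: "((\<lambda>z. (deriv wp_reg z - (2 * c) * z ^ 1) / z ^ 3) \<longlongrightarrow> 4 * d) (at 0)"
  proof -
    let ?G = "fps_deriv F - fps_const (2 * c) * fps_X ^ 1"
    have nth: "fps_nth ?G n = of_nat (n + 1) * fps_nth F (n + 1) - 2 * c * (if n = 1 then 1 else 0)" for n
      by (simp only: fps_sub_nth fps_deriv_nth fps_mult_left_const_nth fps_X_power_nth)
    have "fps_nth ?G n = 0" if "n < 3" for n
      using less3[OF that]
    proof (elim disjE)
      assume n: "n = 0" thus ?thesis unfolding nth using F(3) by simp
    next
      assume n: "n = 1" thus ?thesis unfolding nth using F(4) by (simp only: one_add_one) simp
    next
      assume n: "n = 2" thus ?thesis unfolding nth using F(5) by simp
    qed
    moreover have "fps_nth ?G 3 = 4 * d" unfolding nth using F(6) by simp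
    ultimately show ?thesis using tendsto_divide_power_taylor[OF E3, of 3] by simp
  qed
  have l4: "((\<lambda>z. deriv wp_reg z / z ^ 0) \<longlongrightarrow> 0) (at 0)"
    using tendsto_divide_power_taylor[OF has_fps_expansion_deriv[OF F(1)], of 0] F(3) by simp
  \<comment> \<open>A regrouping of \<open>f\<close> in which every summand has a finite limit. The
    term \<open>20 * c / z ^ 2\<close> is split as 8 plus 12: the first part subtracts the Taylor
    term of \<open>deriv wp_reg\<close>, the second that of \<open>wp_reg\<close>.\<close>
  let ?g = "\<lambda>z. - 4 * ((deriv wp_reg z - (2 * c) * z ^ 1) / z ^ 3) - 12 * ((wp_reg z - c * z ^ 2) / z ^ 4)
      + (deriv wp_reg z / z ^ 0) ^ 2 - 12 * wp_reg z * (wp_reg z / z ^ 2) - 4 * wp_reg z ^ 3 + 20 * c * wp_reg z"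
  have lim: "(?g \<longlongrightarrow> - 4 * (4 * d) - 12 * d + 0 ^ 2 - 12 * 0 * c - 4 * 0 ^ 3 + 20 * c * 0) (at 0)"
    by (intro tendsto_intros l1 l2 l3 l4 tendsto_wp_reg_0)
  have ev: "eventually (\<lambda>z. ?g z = k) (at 0)"
    using ev_at_0
  proof eventually_elim
    case (elim z)
    define A where "A = wp_reg z"
    define A' where "A' = deriv wp_reg z"
    have [simp]: "z \<noteq> 0" using elim by simp
    have "k = (-2 / z ^ 3 + A') ^ 2 - 4 * (1 / z ^ 2 + A) ^ 3 + 20 * c * (1 / z ^ 2 + A)"
      using k[of z] elim unfolding f_def deriv_near_0(1)[OF elim[THEN conjunct1]] wp_eq A_def A'_def by simp
    moreover define u where "u = 1 / z"
    have u: "z * u = 1" by (simp add: u_def)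
    have "(A' - (2 * c) * z ^ 1) / z ^ 3 = (A' - (2 * c) * z) * u ^ 3"
      "(A - c * z ^ 2) / z ^ 4 = (A - c * z ^ 2) * u ^ 4" "A / z ^ 2 = A * u ^ 2"
      "-2 / z ^ 3 = -2 * u ^ 3" "1 / z ^ 2 = u ^ 2"
      by (simp_all add: u_def divide_inverse power_inverse)
    moreover have "- 4 * ((A' - (2 * c) * z) * u ^ 3) - 12 * ((A - c * z ^ 2) * u ^ 4)
        + A' ^ 2 - 12 * A * (A * u ^ 2) - 4 * A ^ 3 + 20 * c * A
        = (-2 * u ^ 3 + A') ^ 2 - 4 * (u ^ 2 + A) ^ 3 + 20 * c * (u ^ 2 + A)"
      using u by algebra
    ultimately have "- 4 * ((A' - (2 * c) * z ^ 1) / z ^ 3) - 12 * ((A - c * z ^ 2) / z ^ 4)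
      + (A' / z ^ 0) ^ 2 - 12 * A * (A / z ^ 2) - 4 * A ^ 3 + 20 * c * A = k"
      by (simp only: power_0 div_by_1)
    thus ?case unfolding A_def A'_def .
  qed
  have "((\<lambda>_. k) \<longlongrightarrow> - 4 * (4 * d) - 12 * d + 0 ^ 2 - 12 * 0 * c - 4 * 0 ^ 3 + 20 * c * 0) (at (0::complex))"
    using lim tendsto_cong[OF ev] by blast
  hence "k = - 4 * (4 * d) - 12 * d + 0 ^ 2 - 12 * 0 * c - 4 * 0 ^ 3 + 20 * c * 0"
    by (intro tendsto_unique[of "at (0::complex)" "\<lambda>_. k"]) auto
  hence "k = - 140 * eisenstein 6" by (simp add: d_def)
  moreover have "k = wp' z ^ 2 - 4 * wp z ^ 3 + 20 * (3 * eisenstein 4) * wp z"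
    using k[OF assms] by (simp add: f_def c_def)
  ultimately show ?thesis by algebra
qed

end

section \<open>The sigma function\<close>

context period_lattice
begin

definition zeta_term :: "complex \<Rightarrow> complex \<Rightarrow> complex" where
  "zeta_term w z = 1 / (z - w) + 1 / w + z / w\<^sup>2"

text \<open>The Weierstrass zeta function. It stands between \<open>sigma\<close>, whose logarithmic
  derivative it is, and \<open>wp\<close>, which is minus its derivative.\<close>

definition zeta :: "complex \<Rightarrow> complex" where
  "zeta z = 1 / z + (\<Sum>\<^sub>\<infinity>w\<in>L - {0}. zeta_term w z)"

abbreviation sigma where "sigma \<equiv> weierstrass_sigma L"

text \<open>Written as the elementary factor of genus two, each factor of the product inherits the
  estimate that it differs from 1 by at most \<open>3 * norm (z / w) ^ 3\<close> when
  \<open>norm (z / w)\<close> is at most one half.\<close>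

abbreviation sigma_factor :: "complex \<Rightarrow> complex \<Rightarrow> complex" where
  "sigma_factor w z \<equiv> weierstrass_factor 2 (z / w)"

lemma sigma_factor_eq: "sigma_factor w z = (1 - z / w) * exp (z / w + z\<^sup>2 / (2 * w\<^sup>2))"
proof -
  have "(\<Sum>k=1..2. (z / w) ^ k / of_nat k) = z / w + (z / w) ^ 2 / 2"
    by (simp add: numeral_2_eq_2)
  thus ?thesis by (simp add: weierstrass_factor_def power_divide mult.commute)
qed

lemma sigma_factor_deriv:
  assumes "w \<noteq> 0" "z \<noteq> w"
  shows "(sigma_factor w has_field_derivative sigma_factor w z * zeta_term w z) (at z)"
proof -
  let ?e = "exp (z / w + z\<^sup>2 / (2 * w\<^sup>2))"
  have "((\<lambda>z. (1 - z / w) * exp (z / w + z\<^sup>2 / (2 * w\<^sup>2))) has_field_derivative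
      (1 - z / w) * (?e * (1 / w + (of_nat 2 * (1 * z ^ (2 - Suc 0))) / (2 * w\<^sup>2))) + (0 - 1 / w) * ?e) (at z)"
    by (intro DERIV_mult' DERIV_diff DERIV_const DERIV_cdivide DERIV_ident DERIV_fun_exp DERIV_add DERIV_power)
  also have "(1 - z / w) * (?e * (1 / w + (of_nat 2 * (1 * z ^ (2 - Suc 0))) / (2 * w\<^sup>2))) + (0 - 1 / w) * ?e
      = ((1 - z / w) * ?e) * zeta_term w z"
  proof -
    have a: "(of_nat 2 * (1 * z ^ (2 - Suc 0))) / (2 * w\<^sup>2) = z / w\<^sup>2" using assms by simp
    have b: "(1 - z / w) * (1 / (z - w)) = - 1 / w"
      using assms by (simp add: divide_simps)
    have "((1 - z / w) * ?e) * zeta_term w z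
        = ?e * ((1 - z / w) * (1 / (z - w))) + (1 - z / w) * (?e * (1 / w + z / w\<^sup>2))"
      unfolding zeta_term_def by (simp only: distrib_left distrib_right mult_ac add_ac)
    thus ?thesis unfolding a b by simp
  qed
  finally show ?thesis by (simp only: sigma_factor_eq)
qed

lemma sigma_prod_deriv:
  assumes "finite J" "0 \<notin> J" "z \<notin> J"
  shows "((\<lambda>z. \<Prod>w\<in>J. sigma_factor w z) has_field_derivative
      (\<Prod>w\<in>J. sigma_factor w z) * (\<Sum>w\<in>J. zeta_term w z)) (at z)"
  using assms
proof (induction J rule: finite_induct)
  case (insert w J)
  have "((\<lambda>z. sigma_factor w z * (\<Prod>w\<in>J. sigma_factor w z)) has_field_derivative
      sigma_factor w z * ((\<Prod>w\<in>J. sigma_factor w z) * (\<Sum>w\<in>J. zeta_term w z)) +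
      sigma_factor w z * zeta_term w z * (\<Prod>w\<in>J. sigma_factor w z)) (at z)"
    by (intro DERIV_mult' sigma_factor_deriv insert.IH) (use insert.prems in auto)
  thus ?case using insert.hyps by (simp add: algebra_simps)
qed auto

text \<open>On a disc all but finitely many factors have a logarithm, and the sum of these logarithms
  converges uniformly.\<close>
lemma sigma_local:
  obtains J S where "finite J" "J \<subseteq> L - {0}" "S holomorphic_on ball 0 R" "S 0 = 0"
    "{w \<in> L - {0}. norm w < R} \<subseteq> J"
    "\<And>z. norm z < R \<Longrightarrow> ((\<lambda>F. \<Prod>w\<in>F. sigma_factor w z) \<longlongrightarrow> (\<Prod>w\<in>J. sigma_factor w z) * exp (S z))
      (finite_subsets_at_top (L - {0}))"
    "\<And>z. norm z < R \<Longrightarrow> ((\<lambda>w. zeta_term w z) has_sum deriv S z) (L - {0} - J)"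
proof -
  \<comment> \<open>Outside \<open>J\<close> the quotient \<open>z / w\<close> has norm at most one
    half, so the factor is within 3/8 of 1, stays in the right half-plane and has a principal
    logarithm. The absolute value of \<open>R\<close> allows for an empty disc.\<close>
  define J where "J = {w \<in> L - {0}. norm w \<le> 2 * \<bar>R\<bar>}"
  define I where "I = L - {0} - J"
  define l where "l = (\<lambda>w z. Ln (sigma_factor w z))"
  define S where "S = (\<lambda>z. \<Sum>\<^sub>\<infinity>w\<in>I. l w z)"
  have finJ: "finite J" unfolding J_def by (rule finite_subset[OF _ finite_norm_le]) auto
  have small: "norm (sigma_factor w z - 1) \<le> 3 * norm (z / w) ^ 3 \<and> norm (sigma_factor w z - 1) < 1 / 2
      \<and> norm (z / w) \<le> 1 / 2"
    if "w \<in> I" "norm z < R" for w z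
  proof -
    have w: "norm w > 2 * R" "norm w > 0" using that by (auto simp: I_def J_def)
    have zw: "norm (z / w) \<le> 1 / 2" using w that(2) by (simp add: norm_divide divide_simps)
    have le: "norm (sigma_factor w z - 1) \<le> 3 * norm (z / w) ^ 3"
      using weierstrass_factor_bound[OF zw, of 2] by (simp only: numeral_2_eq_2 numeral_3_eq_3)
    have "norm (z / w) ^ 3 \<le> (1 / 2) ^ 3" using zw by (intro power_mono) auto
    with le zw show ?thesis by (simp add: power_divide)
  qed
  have re: "Re (sigma_factor w z) > 0" if "w \<in> I" "norm z < R" for w z
  proof -
    have "\<bar>Re (sigma_factor w z - 1)\<bar> < 1 / 2"
      using small[OF that] abs_Re_le_cmod[of "sigma_factor w z - 1"] by linarith
    hence "Re (sigma_factor w z - 1) > - (1 / 2)" by linarith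
    thus ?thesis by (simp only: minus_complex.simps one_complex.simps)
  qed
  have nonpos: "sigma_factor w z \<notin> \<real>\<^sub>\<le>\<^sub>0" if "w \<in> I" "norm z < R" for w z
    using re[OF that] complex_nonpos_Reals_iff by auto
  have l_holo: "l w holomorphic_on ball 0 R" if "w \<in> I" for w
    unfolding l_def using that by (intro holomorphic_intros nonpos) (auto simp: I_def)
  have l_bound: "norm (l w z) \<le> 6 * R ^ 3 * (1 / norm w ^ 3)" if "w \<in> I" "z \<in> ball 0 R" for w z
  proof -
    have z: "norm z < R" using that by simp
    have "norm (l w z) \<le> 2 * norm (sigma_factor w z - 1)"
      using norm_Ln_le[of "sigma_factor w z - 1"] small[OF that(1) z] by (simp add: l_def)
    also have "\<dots> \<le> 6 * norm (z / w) ^ 3" using small[OF that(1) z] by simp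
    also have "\<dots> = 6 * norm z ^ 3 / norm w ^ 3" by (simp add: norm_divide power_divide)
    also have "\<dots> \<le> 6 * R ^ 3 / norm w ^ 3"
      using z by (intro divide_right_mono mult_left_mono power_mono) auto
    finally show ?thesis by simp
  qed
  have majorant: "(\<lambda>w. 6 * R ^ 3 * (1 / norm w ^ 3)) summable_on (I - {})"
    by (rule summable_on_cmult_right, rule summable_on_subset[OF summable_inverse_cube]) (auto simp: I_def)
  have bound: "\<exists>J M. finite J \<and> M summable_on (I - J) \<and>
      (\<forall>w\<in>I-J. \<forall>z\<in>ball 0 R \<inter> cball 0 r. norm (l w z) \<le> M w)" for r
    using majorant l_bound by (intro exI[of _ "{}"] exI[of _ "\<lambda>w. 6 * R ^ 3 * (1 / norm w ^ 3)"]) auto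
  have S_holo: "S holomorphic_on ball 0 R"
    unfolding S_def by (rule holomorphic_on_infsum[OF open_ball l_holo bound])
  have S_0: "S 0 = 0" unfolding S_def l_def by simp
  have conv: "((\<lambda>F. \<Prod>w\<in>F. sigma_factor w z) \<longlongrightarrow> (\<Prod>w\<in>J. sigma_factor w z) * exp (S z))
      (finite_subsets_at_top (L - {0}))" if z: "norm z < R" for z
  proof -
    \<comment> \<open>Extending the logarithms by zero lets their sum run along the filter on all of
      \<open>L - {0}\<close>, the one in the definition of \<open>sigma\<close>; the finite sets
      there eventually contain \<open>J\<close>.\<close>
    define l' where "l' = (\<lambda>w. if w \<in> J then 0 else l w z)"
    have "((\<lambda>w. l w z) has_sum S z) I"
      unfolding S_def by (intro has_sum_infsum summable_on_locally_bounded[OF open_ball l_holo bound]) (use z in auto)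
    also have "?this \<longleftrightarrow> (l' has_sum S z) (L - {0})"
      by (rule has_sum_cong_neutral) (auto simp: l'_def I_def)
    finally have "((\<lambda>F. \<Sum>w\<in>F. l' w) \<longlongrightarrow> S z) (finite_subsets_at_top (L - {0}))"
      by (simp add: has_sum_def)
    hence "((\<lambda>F. (\<Prod>w\<in>J. sigma_factor w z) * exp (\<Sum>w\<in>F. l' w)) \<longlongrightarrow> (\<Prod>w\<in>J. sigma_factor w z) * exp (S z))
        (finite_subsets_at_top (L - {0}))"
      by (intro tendsto_intros)
    moreover have "eventually (\<lambda>F. finite F \<and> J \<subseteq> F \<and> F \<subseteq> L - {0}) (finite_subsets_at_top (L - {0}))"
      unfolding eventually_finite_subsets_at_top using finJ by (intro exI[of _ J]) (auto simp: J_def)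
    hence "eventually (\<lambda>F. (\<Prod>w\<in>J. sigma_factor w z) * exp (\<Sum>w\<in>F. l' w) = (\<Prod>w\<in>F. sigma_factor w z))
        (finite_subsets_at_top (L - {0}))"
    proof eventually_elim
      case (elim F)
      have "(\<Sum>w\<in>F. l' w) = (\<Sum>w\<in>F-J. l w z)"
        by (rule sum.mono_neutral_cong_right) (use elim in \<open>auto simp: l'_def\<close>)
      hence "exp (\<Sum>w\<in>F. l' w) = (\<Prod>w\<in>F-J. exp (l w z))"
        using elim by (simp add: exp_sum)
      also have "\<dots> = (\<Prod>w\<in>F-J. sigma_factor w z)"
      proof (rule prod.cong)
        fix w assume "w \<in> F - J"
        hence "w \<in> I" using elim by (auto simp: I_def)
        hence "sigma_factor w z \<noteq> 0" using re[of w z] z by auto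
        thus "exp (l w z) = sigma_factor w z" by (simp add: l_def)
      qed auto
      finally show ?case using prod.subset_diff[of J F "\<lambda>w. sigma_factor w z"] elim
        by (simp add: mult.commute)
    qed
    ultimately show ?thesis by (rule Lim_transform_eventually)
  qed
  have zeta_sum: "((\<lambda>w. zeta_term w z) has_sum deriv S z) I" if z: "norm z < R" for z
  proof -
    have "((\<lambda>w. (deriv ^^ 1) (l w) z) has_sum (deriv ^^ 1) S z) I"
      unfolding S_def by (rule has_sum_higher_deriv[OF open_ball l_holo bound]) (use z in auto)
    hence "((\<lambda>w. deriv (l w) z) has_sum deriv S z) I" by simp
    moreover have "deriv (l w) z = zeta_term w z" if w: "w \<in> I" for w
    proof -
      have "z \<noteq> w" "w \<noteq> 0" using w z by (auto simp: I_def J_def)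
      hence "((\<lambda>z. Ln (sigma_factor w z)) has_field_derivative
          inverse (sigma_factor w z) * (sigma_factor w z * zeta_term w z)) (at z)"
        by (intro DERIV_chain2[OF has_field_derivative_Ln] sigma_factor_deriv nonpos w z)
      moreover have "sigma_factor w z \<noteq> 0" using re[OF w z] by auto
      ultimately show ?thesis unfolding l_def by (simp add: DERIV_imp_deriv mult.assoc[symmetric])
    qed
    ultimately show ?thesis by (subst (asm) has_sum_cong)
  qed
  have "J \<subseteq> L - {0}" "{w \<in> L - {0}. norm w < R} \<subseteq> J" by (auto simp: J_def)
  with finJ S_holo S_0 conv zeta_sum show ?thesis using that unfolding I_def by blast
qed

text \<open>\<open>sigma\<close> is defined through \<open>Lim\<close>, which says nothing before
  convergence is known; here that value is tied to an actual limit.\<close>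

lemma sigma_tendsto:
  obtains p where "sigma z = z * p"
    "((\<lambda>F. \<Prod>w\<in>F. sigma_factor w z) \<longlongrightarrow> p) (finite_subsets_at_top (L - {0}))"
proof -
  obtain J S where *: "\<And>y. norm y < norm z + 1 \<Longrightarrow>
      ((\<lambda>F. \<Prod>w\<in>F. sigma_factor w y) \<longlongrightarrow> (\<Prod>w\<in>J. sigma_factor w y) * exp (S y)) (finite_subsets_at_top (L - {0}))"
    by (rule sigma_local[of "norm z + 1"]) blast
  have "((\<lambda>F. \<Prod>w\<in>F. sigma_factor w z) \<longlongrightarrow> (\<Prod>w\<in>J. sigma_factor w z) * exp (S z)) (finite_subsets_at_top (L - {0}))"
    by (rule *) simp
  moreover from this have "sigma z = z * ((\<Prod>w\<in>J. sigma_factor w z) * exp (S z))"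
    unfolding weierstrass_sigma_def sigma_factor_eq by (simp add: tendsto_Lim)
  ultimately show ?thesis using that by blast
qed

lemma sigma_local':
  obtains J S where "finite J" "J \<subseteq> L - {0}" "S holomorphic_on ball 0 R" "S 0 = 0"
    "{w \<in> L - {0}. norm w < R} \<subseteq> J"
    "\<And>z. norm z < R \<Longrightarrow> sigma z = z * ((\<Prod>w\<in>J. sigma_factor w z) * exp (S z))"
    "\<And>z. norm z < R \<Longrightarrow> ((\<lambda>w. zeta_term w z) has_sum deriv S z) (L - {0} - J)"
proof -
  obtain J S where *: "finite J" "J \<subseteq> L - {0}" "S holomorphic_on ball 0 R" "S 0 = 0"
    "{w \<in> L - {0}. norm w < R} \<subseteq> J"
    "\<And>z. norm z < R \<Longrightarrow> ((\<lambda>F. \<Prod>w\<in>F. sigma_factor w z) \<longlongrightarrow> (\<Prod>w\<in>J. sigma_factor w z) * exp (S z))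
      (finite_subsets_at_top (L - {0}))"
    "\<And>z. norm z < R \<Longrightarrow> ((\<lambda>w. zeta_term w z) has_sum deriv S z) (L - {0} - J)"
    by (rule sigma_local[of R]) blast
  have "sigma z = z * ((\<Prod>w\<in>J. sigma_factor w z) * exp (S z))" if "norm z < R" for z
    using *(6)[OF that] unfolding weierstrass_sigma_def sigma_factor_eq by (simp add: tendsto_Lim)
  with * show ?thesis using that by blast
qed

lemma sigma_minus: "sigma (-z) = - sigma z"
proof -
  obtain p where p: "sigma z = z * p"
    "((\<lambda>F. \<Prod>w\<in>F. sigma_factor w z) \<longlongrightarrow> p) (finite_subsets_at_top (L - {0}))"
    by (rule sigma_tendsto)
  obtain q where q: "sigma (-z) = -z * q"
    "((\<lambda>F. \<Prod>w\<in>F. sigma_factor w (-z)) \<longlongrightarrow> q) (finite_subsets_at_top (L - {0}))"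
    by (rule sigma_tendsto)
  have "uminus ` (L - {0}) = L - {0}"
  proof (intro equalityI subsetI)
    fix w assume "w \<in> L - {0}"
    hence "- w \<in> L - {0}" by simp
    thus "w \<in> uminus ` (L - {0})" by (rule rev_image_eqI) simp
  qed auto
  \<comment> \<open>Negation permutes the finite subsets of \<open>L - {0}\<close>, so it preserves
    the filter. It carries the partial products at \<open>z\<close> to those at \<open>-z\<close>,
    and the two limits agree.\<close>
  hence "filtermap ((`) uminus) (finite_subsets_at_top (L - {0})) = finite_subsets_at_top (L - {0})"
    using filtermap_image_finite_subsets_at_top[of uminus "L - {0}"] by simp
  with p(2) have "((\<lambda>F. \<Prod>w\<in>F. sigma_factor w z) \<longlongrightarrow> p)
      (filtermap ((`) uminus) (finite_subsets_at_top (L - {0})))" by simp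
  hence "((\<lambda>F. \<Prod>w\<in>uminus ` F. sigma_factor w z) \<longlongrightarrow> p) (finite_subsets_at_top (L - {0}))"
    unfolding filterlim_filtermap .
  moreover have "(\<Prod>w\<in>uminus ` F. sigma_factor w z) = (\<Prod>w\<in>F. sigma_factor w (-z))" for F
    by (subst prod.reindex) (auto simp: o_def)
  ultimately have "((\<lambda>F. \<Prod>w\<in>F. sigma_factor w (-z)) \<longlongrightarrow> p) (finite_subsets_at_top (L - {0}))"
    by simp
  hence "p = q" using q(2) by (intro tendsto_unique[OF finite_subsets_at_top_neq_bot])
  thus ?thesis using p q by simp
qed

text \<open>On a disc containing \<open>z\<close> the infinite tail is an exponential, so zeros come
  only from the factor \<open>z\<close> and the finitely many factors indexed by \<open>J\<close>,
  which includes all nonzero lattice points of the disc.\<close>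

lemma sigma_eq_0_iff: "sigma z = 0 \<longleftrightarrow> z \<in> L"
proof -
  obtain J S where *: "finite J" "J \<subseteq> L - {0}"
    "{w \<in> L - {0}. norm w < norm z + 1} \<subseteq> J"
    "\<And>y. norm y < norm z + 1 \<Longrightarrow> sigma y = y * ((\<Prod>w\<in>J. sigma_factor w y) * exp (S y))"
    by (rule sigma_local'[of "norm z + 1"]) blast
  have eq: "sigma z = z * ((\<Prod>w\<in>J. sigma_factor w z) * exp (S z))" using *(4)[of z] by simp
  have "sigma z = 0 \<longleftrightarrow> z = 0 \<or> (\<exists>w\<in>J. z / w = 1)"
    unfolding eq using *(1) by simp
  also have "\<dots> \<longleftrightarrow> z = 0 \<or> z \<in> J"
  proof -
    have "z / w = 1 \<longleftrightarrow> z = w" if "w \<in> J" for w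
      using that *(2) by (subst divide_eq_1_iff) auto
    thus ?thesis by auto
  qed
  also have "\<dots> \<longleftrightarrow> z \<in> L"
  proof -
    have "z \<in> J" if "z \<in> L" "z \<noteq> 0" using subsetD[OF *(3), of z] that by simp
    moreover have "z \<in> L" if "z \<in> J" using *(2) that by auto
    ultimately show ?thesis by auto
  qed
  finally show ?thesis .
qed

lemma sigma_holomorphic: "sigma holomorphic_on A"
proof -
  have "sigma field_differentiable (at z)" for z
  proof -
    obtain J S where *: "finite J" "J \<subseteq> L - {0}" "S holomorphic_on ball 0 (norm z + 1)"
      "\<And>y. norm y < norm z + 1 \<Longrightarrow> sigma y = y * ((\<Prod>w\<in>J. sigma_factor w y) * exp (S y))"
      by (rule sigma_local'[of "norm z + 1"]) blast
    have "(\<lambda>y. y * ((\<Prod>w\<in>J. sigma_factor w y) * exp (S y))) holomorphic_on ball 0 (norm z + 1)"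
      using *(2) by (intro holomorphic_intros *(3)) auto
    hence "sigma holomorphic_on ball 0 (norm z + 1)"
      by (rule holomorphic_transform) (simp add: *(4))
    thus ?thesis by (rule holomorphic_on_imp_differentiable_at) auto
  qed
  thus ?thesis by (simp add: holomorphic_on_def field_differentiable_at_within)
qed

lemma sigma_isCont: "isCont sigma z"
  using holomorphic_on_imp_continuous_on[OF sigma_holomorphic[of UNIV]]
  by (simp add: continuous_on_eq_continuous_at)

text \<open>The logarithmic derivative is assembled from the factor \<open>z\<close>, the finite
  product over \<open>J\<close>, and the derivative of the exponent \<open>S\<close>, which is the
  rest of the series of \<open>zeta\<close>.\<close>

lemma sigma_deriv:
  assumes z: "z \<notin> L"
  shows "(sigma has_field_derivative sigma z * zeta z) (at z)"
proof -
  obtain J S where *: "finite J" "J \<subseteq> L - {0}" "S holomorphic_on ball 0 (norm z + 1)"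
    "\<And>y. norm y < norm z + 1 \<Longrightarrow> sigma y = y * ((\<Prod>w\<in>J. sigma_factor w y) * exp (S y))"
    "\<And>y. norm y < norm z + 1 \<Longrightarrow> ((\<lambda>w. zeta_term w y) has_sum deriv S y) (L - {0} - J)"
    by (rule sigma_local'[of "norm z + 1"]) blast
  let ?P = "\<lambda>z. \<Prod>w\<in>J. sigma_factor w z" and ?Z = "\<Sum>w\<in>J. zeta_term w z"
  have [simp]: "z \<noteq> 0" using z by auto
  have S: "(S has_field_derivative deriv S z) (at z)"
    by (rule holomorphic_derivI[OF *(3)]) auto
  have "((\<lambda>y. y * (?P y * exp (S y))) has_field_derivative
      z * (?P z * (exp (S z) * deriv S z) + ?P z * ?Z * exp (S z)) + 1 * (?P z * exp (S z))) (at z)"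
    by (intro DERIV_mult' DERIV_ident DERIV_fun_exp S sigma_prod_deriv) (use * z in auto)
  also have "z * (?P z * (exp (S z) * deriv S z) + ?P z * ?Z * exp (S z)) + 1 * (?P z * exp (S z))
      = z * (?P z * exp (S z)) * (1 / z + (?Z + deriv S z))"
    by (simp add: distrib_left distrib_right mult_ac)
  finally have "((\<lambda>y. y * (?P y * exp (S y))) has_field_derivative
      z * (?P z * exp (S z)) * (1 / z + (?Z + deriv S z))) (at z)" .
  moreover have "z * (?P z * exp (S z)) = sigma z" using *(4)[of z] by simp
  moreover have "?Z + deriv S z = (\<Sum>\<^sub>\<infinity>w\<in>L - {0}. zeta_term w z)"
  proof -
    have "((\<lambda>w. zeta_term w z) has_sum (?Z + deriv S z)) (J \<union> (L - {0} - J))"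
      by (intro has_sum_Un_disjoint has_sum_finite *(5)) (use * in auto)
    moreover have "J \<union> (L - {0} - J) = L - {0}" using *(2) by auto
    ultimately show ?thesis by (simp add: infsumI)
  qed
  ultimately have "((\<lambda>y. y * (?P y * exp (S y))) has_field_derivative sigma z * zeta z) (at z)"
    by (simp only: zeta_def)
  moreover have "eventually (\<lambda>y. y \<in> ball 0 (norm z + 1)) (nhds z)"
    by (intro eventually_nhds_in_open) auto
  hence "eventually (\<lambda>y. y * (?P y * exp (S y)) = sigma y) (nhds z)"
    by eventually_elim (simp add: *(4))
  ultimately show ?thesis by (subst (asm) DERIV_cong_ev[OF refl _ refl])
qed

lemma zeta_term_bound:
  "\<exists>C. \<forall>w\<in>L-{0}. \<forall>z. norm z \<le> R \<and> 2 * R \<le> norm w \<longrightarrow> norm (zeta_term w z) \<le> C / norm w ^ 3"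
proof (intro exI[of _ "2 * R\<^sup>2"] ballI allI impI)
  fix w z :: complex assume w: "w \<in> L - {0}" and z: "norm z \<le> R \<and> 2 * R \<le> norm w"
  define N where "N = norm w"
  have N: "N > 0" using w by (simp add: N_def)
  have zw: "norm (z - w) \<ge> N / 2" using norm_diff_ge_half[of z R w] z by (simp add: N_def)
  hence nz: "z \<noteq> w" using N by auto
  have "zeta_term w z = z\<^sup>2 / (w\<^sup>2 * (z - w))"
    unfolding zeta_term_def using w nz by (simp add: divide_simps) (simp add: power2_eq_square algebra_simps)
  also have "norm \<dots> = norm z ^ 2 / (N\<^sup>2 * norm (z - w))"
    by (simp add: norm_mult norm_divide norm_power N_def)
  also have "\<dots> \<le> R ^ 2 / (N\<^sup>2 * (N / 2))"
    by (intro frac_le mult_left_mono power_mono) (use z zw N in auto)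
  also have "\<dots> = 2 * R\<^sup>2 / N ^ 3" by (simp add: power2_eq_square power3_eq_cube)
  finally show "norm (zeta_term w z) \<le> 2 * R\<^sup>2 / norm w ^ 3" by (simp add: N_def)
qed

lemma zeta_deriv:
  assumes z: "z \<notin> L"
  shows "(zeta has_field_derivative - wp z) (at z)"
proof -
  let ?Z = "\<lambda>z. \<Sum>\<^sub>\<infinity>w\<in>L - {0}. zeta_term w z"
  have [simp]: "z \<noteq> 0" using z by auto
  have holo: "zeta_term w holomorphic_on - (L - {0})" if "w \<in> L - {0}" for w
    unfolding zeta_term_def using that by (intro holomorphic_intros) auto
  note facts = open_compl_L(2) holo lattice_majorant[OF zeta_term_bound]
  have "((\<lambda>w. (deriv ^^ 1) (zeta_term w) z) has_sum (deriv ^^ 1) ?Z z) (L - {0})"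
    by (rule has_sum_higher_deriv[OF facts]) (use z in auto)
  hence "((\<lambda>w. deriv (zeta_term w) z) has_sum deriv ?Z z) (L - {0})" by simp
  moreover have "deriv (zeta_term w) z = - wp_term w z" if w: "w \<in> L - {0}" for w
  proof -
    have "z \<noteq> w" using z w by auto
    from has_field_derivative_inverse_power[OF this, of 1]
    have "((\<lambda>z. 1 / (z - w)) has_field_derivative - 1 / (z - w)\<^sup>2) (at z)"
      by (simp add: numeral_2_eq_2)
    hence "((\<lambda>z. 1 / (z - w) + 1 / w + z / w\<^sup>2) has_field_derivative - 1 / (z - w)\<^sup>2 + 0 + 1 / w\<^sup>2) (at z)"
      by (intro DERIV_add DERIV_const DERIV_cdivide DERIV_ident)
    hence "(zeta_term w has_field_derivative - wp_term w z) (at z)"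
      by (simp add: zeta_term_def[abs_def] wp_term_def)
    thus ?thesis by (rule DERIV_imp_deriv)
  qed
  ultimately have "((\<lambda>w. - wp_term w z) has_sum deriv ?Z z) (L - {0})"
    by (subst (asm) has_sum_cong)
  hence "deriv ?Z z = (\<Sum>\<^sub>\<infinity>w\<in>L-{0}. - wp_term w z)" by (simp add: infsumI)
  hence dZ: "deriv ?Z z = - wp_reg z" by (simp only: infsum_uminus wp_reg_def)
  have "(?Z has_field_derivative deriv ?Z z) (at z)"
    by (rule holomorphic_derivI[OF holomorphic_on_infsum[OF facts] open_compl_L(2)]) (use z in auto)
  from DERIV_add[OF has_field_derivative_inverse_power[of z 0 1] this]
  have "((\<lambda>z. 1 / z + ?Z z) has_field_derivative - wp z) (at z)"
    by (simp add: dZ wp_eq numeral_2_eq_2)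
  thus ?thesis by (simp add: zeta_def[abs_def])
qed

text \<open>By periodicity of \<open>wp\<close>, the increment of \<open>zeta\<close> under
  \<open>w\<close> has derivative zero and is a constant \<eta>; integrating the logarithmic
  derivative once more gives the exponential. The constants need no explicit value, because they
  cancel in the quotient of \<open>wp_diff_sigma\<close>.\<close>

lemma sigma_quasi_periodic:
  assumes w: "w \<in> L"
  obtains C \<eta> where "C \<noteq> 0" "\<And>z. z \<notin> L \<Longrightarrow> sigma (z + w) = C * exp (\<eta> * z) * sigma z"
proof -
  have "((\<lambda>z. zeta (z + w) - zeta z) has_field_derivative 0) (at z)" if z: "z \<notin> L" for z
  proof -
    have "((\<lambda>z. zeta (z + w)) has_field_derivative - wp (z + w)) (at z)"
      using zeta_deriv[of "z + w"] z w by (simp add: DERIV_shift)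
    from DERIV_diff[OF this zeta_deriv[OF z]] show ?thesis by (simp add: wp_periodic z w)
  qed
  hence "(\<lambda>z. zeta (z + w) - zeta z) constant_on - L"
    using has_field_derivative_0_imp_constant_on[of "- L" "\<lambda>z. zeta (z + w) - zeta z"] connected_compl_L open_compl_L(1) by auto
  then obtain \<eta> where \<eta>: "\<And>z. z \<notin> L \<Longrightarrow> zeta (z + w) - zeta z = \<eta>" by (auto simp: constant_on_def)
  define q where "q = (\<lambda>z. sigma (z + w) / sigma z * exp (- \<eta> * z))"
  have "(q has_field_derivative 0) (at z)" if z: "z \<notin> L" for z
  proof -
    have [simp]: "sigma z \<noteq> 0" using z by (simp add: sigma_eq_0_iff)
    have 1: "((\<lambda>z. sigma (z + w)) has_field_derivative sigma (z + w) * zeta (z + w)) (at z)"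
      using sigma_deriv[of "z + w"] z w by (simp add: DERIV_shift)
    have 2: "((\<lambda>z. exp (- \<eta> * z)) has_field_derivative exp (- \<eta> * z) * (- \<eta> * 1)) (at z)"
      by (intro DERIV_fun_exp DERIV_cmult DERIV_ident)
    have "(q has_field_derivative
        sigma (z + w) / sigma z * (exp (- \<eta> * z) * (- \<eta> * 1)) +
        ((sigma (z + w) * zeta (z + w) * sigma z - sigma (z + w) * (sigma z * zeta z)) / (sigma z * sigma z)) * exp (- \<eta> * z)) (at z)"
      unfolding q_def by (rule DERIV_mult'[OF DERIV_divide[OF 1 sigma_deriv[OF z]] 2]) simp
    moreover have "(sigma (z + w) * zeta (z + w) * sigma z - sigma (z + w) * (sigma z * zeta z)) / (sigma z * sigma z)
        = sigma (z + w) / sigma z * (zeta (z + w) - zeta z)"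
      by (simp add: divide_simps) (simp add: algebra_simps)
    ultimately show ?thesis using \<eta>[OF z] by simp
  qed
  hence "q constant_on - L"
    using has_field_derivative_0_imp_constant_on[of "- L" q] connected_compl_L open_compl_L(1) by auto
  then obtain C where C: "\<And>z. z \<notin> L \<Longrightarrow> q z = C" by (auto simp: constant_on_def)
  have eq: "sigma (z + w) = C * exp (\<eta> * z) * sigma z" if "z \<notin> L" for z
  proof -
    have "sigma z \<noteq> 0" using that by (simp add: sigma_eq_0_iff)
    moreover have "exp (- \<eta> * z) * exp (\<eta> * z) = 1" by (simp add: exp_add[symmetric])
    moreover have "C = sigma (z + w) / sigma z * exp (- \<eta> * z)" using C[OF that] by (simp add: q_def)
    ultimately show ?thesis by (simp add: mult.assoc)
  qed
  moreover have "C \<noteq> 0"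
  proof
    assume "C = 0"
    have "(- L) \<noteq> {}" using eventually_notin_L[of 0] eventually_happens[of "\<lambda>z. z \<notin> L" "at (0::complex)"] by auto
    then obtain z where z: "z \<notin> L" by auto
    have "sigma (z + w) = 0" using eq[OF z] \<open>C = 0\<close> by simp
    thus False using z w by (simp add: sigma_eq_0_iff)
  qed
  ultimately show ?thesis using that by blast
qed

text \<open>The normalisation of \<open>sigma\<close> at its zero; it fixes the constant in
  \<open>wp_diff_sigma\<close>.\<close>

lemma sigma_over_id: "((\<lambda>z. sigma z / z) \<longlongrightarrow> 1) (at 0)"
proof -
  obtain J S where *: "finite J" "J \<subseteq> L - {0}" "S holomorphic_on ball 0 1" "S 0 = 0"
    "\<And>y. norm y < 1 \<Longrightarrow> sigma y = y * ((\<Prod>w\<in>J. sigma_factor w y) * exp (S y))"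
    by (rule sigma_local'[of 1]) blast
  let ?g = "\<lambda>y. (\<Prod>w\<in>J. sigma_factor w y) * exp (S y)"
  have "?g holomorphic_on ball 0 1" using *(2) by (intro holomorphic_intros *(3)) auto
  hence "isCont ?g 0" by (simp add: holomorphic_on_imp_continuous_on continuous_on_interior[of "ball 0 1"])
  hence "(?g \<longlongrightarrow> ?g 0) (at 0)" by (simp add: isCont_def)
  moreover have "?g 0 = 1" by (simp add: *(4))
  moreover have "eventually (\<lambda>y. y \<in> ball 0 1) (nhds (0::complex))"
    by (intro eventually_nhds_in_open) auto
  hence "eventually (\<lambda>y. ?g y = sigma y / y) (at 0)"
    unfolding eventually_at_filter by eventually_elim (simp add: *(5))
  ultimately show ?thesis using Lim_transform_eventually[of ?g "?g 0" "at 0" "\<lambda>y. sigma y / y"] by simp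
qed

end

section \<open>Addition formulas\<close>

context period_lattice
begin

lemma not_L_I: "2 * b \<notin> L \<Longrightarrow> b \<notin> L"
  using add_in[of b b] by auto

lemma wp_isCont: "z \<notin> L \<Longrightarrow> isCont wp z"
  using wp_has_deriv DERIV_isCont by blast

lemma wp'_isCont: "z \<notin> L \<Longrightarrow> isCont wp' z"
  using wp'_has_deriv DERIV_isCont by blast

lemma tendsto_transform:
  "(f \<longlongrightarrow> l) F \<Longrightarrow> eventually (\<lambda>x. f x = g x) F \<Longrightarrow> l = l' \<Longrightarrow> (g \<longlongrightarrow> l') F"
  using Lim_transform_eventually by blast

lemma tendsto_square_wp: "((\<lambda>z. z ^ 2 * wp z) \<longlongrightarrow> 1) (at 0)"
proof -
  have "((\<lambda>z. 1 + z ^ 2 * wp_reg z) \<longlongrightarrow> 1 + 0 ^ 2 * 0) (at 0)"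
    by (intro tendsto_intros tendsto_wp_reg_0)
  moreover have "eventually (\<lambda>z. 1 + z ^ 2 * wp_reg z = z ^ 2 * wp z) (at 0)"
    using ev_at_0 by eventually_elim (simp add: wp_eq distrib_left)
  ultimately show ?thesis by (rule tendsto_transform) simp
qed

lemma tendsto_square_wp_diff: "((\<lambda>z. z ^ 2 * (wp z - c)) \<longlongrightarrow> 1) (at 0)"
proof -
  have "((\<lambda>z. z ^ 2 * wp z - z ^ 2 * c) \<longlongrightarrow> 1 - 0 ^ 2 * c) (at 0)"
    by (intro tendsto_intros tendsto_square_wp)
  thus ?thesis by (simp add: right_diff_distrib)
qed

lemma tendsto_cube_wp': "((\<lambda>z. z ^ 3 * (wp' z - c)) \<longlongrightarrow> - 2) (at 0)"
proof -
  have "isCont (deriv wp_reg) 0"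
    using holomorphic_on_imp_continuous_on[OF holomorphic_deriv[OF wp_reg_holomorphic open_compl_L(2)]]
      open_compl_L(2) zero_in_compl continuous_on_eq_continuous_at by blast
  hence "(deriv wp_reg \<longlongrightarrow> deriv wp_reg 0) (at 0)" by (simp add: isCont_def)
  hence "((\<lambda>z. - 2 + z ^ 3 * (deriv wp_reg z - c)) \<longlongrightarrow> - 2 + 0 ^ 3 * (deriv wp_reg 0 - c)) (at 0)"
    by (intro tendsto_intros)
  moreover have "eventually (\<lambda>z. - 2 + z ^ 3 * (deriv wp_reg z - c) = z ^ 3 * (wp' z - c)) (at 0)"
    using ev_at_0
  proof eventually_elim
    case (elim z)
    have "z ^ 3 * (- 2 / z ^ 3) = - 2" using elim by simp
    thus ?case unfolding deriv_near_0(1)[OF elim[THEN conjunct1]] by algebra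
  qed
  ultimately show ?thesis by (rule tendsto_transform) simp
qed

lemma tendsto_shift_0:
  assumes "(f \<longlongrightarrow> l) (at (0::complex))"
  shows "((\<lambda>z. f (z - p)) \<longlongrightarrow> l) (at p)"
  using LIM_offset[OF assms, of "- p"] by simp

lemma tendsto_id_over_sigma: "((\<lambda>z. (z - p) / sigma (z - p)) \<longlongrightarrow> 1) (at p)"
proof -
  have "((\<lambda>z. inverse (sigma z / z)) \<longlongrightarrow> inverse 1) (at 0)"
    by (intro tendsto_inverse sigma_over_id) auto
  hence "((\<lambda>z. z / sigma z) \<longlongrightarrow> 1) (at 0)" by (simp add: inverse_divide)
  thus ?thesis by (rule tendsto_shift_0)
qed

lemma tendsto_sigma: "(sigma \<longlongrightarrow> sigma p) (at p)"
  using sigma_isCont by (simp add: isCont_def)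

lemma tendsto_sigma_add: "((\<lambda>z. sigma (z + b)) \<longlongrightarrow> sigma (p + b)) (at p)"
  using LIM_offset[OF tendsto_sigma[of "p + b"], of b] by simp

lemma tendsto_wp: "p \<notin> L \<Longrightarrow> (wp \<longlongrightarrow> wp p) (at p)"
  using wp_isCont by (simp add: isCont_def)

lemma in_cosets_3: "z \<in> cosets {0, b, -b} \<longleftrightarrow> z \<in> L \<or> z - b \<in> L \<or> z + b \<in> L"
  by (simp add: cosets_def)

text \<open>The quotient \<open>f\<close> is elliptic because the two arguments in its denominator
  add up to \<open>2 * z\<close>, matching the exponentials of the numerator. At the origin a double
  zero meets a double pole; at \<open>b\<close> and \<open>-b\<close> the factor
  \<open>wp z - wp b\<close> vanishes against zeros of \<open>sigma\<close>, which are in different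
  classes since \<open>2 * b\<close> is not in \<open>L\<close>. The limit at the origin gives the
  constant.\<close>

theorem wp_diff_sigma:
  assumes a: "a \<notin> L" and b: "2 * b \<notin> L"
  shows "wp a - wp b = - (sigma (a + b) * sigma (a - b)) / (sigma a ^ 2 * sigma b ^ 2)"
proof -
  have bL: "b \<notin> L" "- b \<notin> L" using not_L_I[OF b] by auto
  have nz: "sigma b \<noteq> 0" "sigma a \<noteq> 0" using bL a by (simp_all add: sigma_eq_0_iff)
  define f where "f = (\<lambda>z. sigma z ^ 2 * (wp z - wp b) / (sigma (z + b) * sigma (z - b)))"
  let ?Q = "{0, b, -b}"
  have off: "z \<notin> L" "z - b \<notin> L" "z + b \<notin> L" "sigma z \<noteq> 0" "sigma (z - b) \<noteq> 0" "sigma (z + b) \<noteq> 0"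
    if "z \<notin> cosets ?Q" for z
    using that unfolding in_cosets_3 by (auto simp: sigma_eq_0_iff)
  have lim0: "(f \<longlongrightarrow> 1 / (sigma b * sigma (- b))) (at 0)"
  proof -
    have "((\<lambda>z. (sigma z / z) ^ 2 * (z ^ 2 * (wp z - wp b)) / (sigma (z + b) * sigma (z - b)))
        \<longlongrightarrow> 1 ^ 2 * 1 / (sigma (0 + b) * sigma (0 - b))) (at 0)"
      by (intro tendsto_intros sigma_over_id tendsto_square_wp_diff tendsto_sigma_add[of b] tendsto_sigma_add[of "- b", simplified])
         (simp add: sigma_minus nz)
    moreover have "eventually (\<lambda>z. (sigma z / z) ^ 2 * (z ^ 2 * (wp z - wp b)) / (sigma (z + b) * sigma (z - b)) = f z) (at 0)"
      using ev_at_0 by eventually_elim (simp add: f_def power_divide)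
    ultimately show ?thesis by (rule tendsto_transform) simp
  qed
  have lim_b: "((\<lambda>z. (z - p) * f z) \<longlongrightarrow> 0) (at p)" if p: "p = b \<or> p = -b" for p
  proof -
    have pL: "p \<notin> L" "2 * p \<notin> L" "wp p = wp b" using p bL b minus_in_iff[of "2 * b"] by auto
    have "((\<lambda>z. sigma z ^ 2 * (wp z - wp b) / sigma (z + p) * ((z - p) / sigma (z - p)))
        \<longlongrightarrow> sigma p ^ 2 * (wp p - wp b) / sigma (p + p) * 1) (at p)"
      by (intro tendsto_intros tendsto_id_over_sigma tendsto_sigma_add tendsto_sigma tendsto_wp pL)
         (use pL(2)[unfolded mult_2] in \<open>simp only: sigma_eq_0_iff not_False_eq_True\<close>)
    moreover have "sigma z ^ 2 * (wp z - wp b) / sigma (z + p) * ((z - p) / sigma (z - p)) = (z - p) * f z" for z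
      using p by (auto simp: f_def mult.commute)
    ultimately show ?thesis using pL(3) by simp
  qed
  have "f holomorphic_on - cosets ?Q"
    unfolding f_def
    by (intro holomorphic_intros sigma_holomorphic holomorphic_on_compose_gen[of _ _ sigma, unfolded o_def]
        holomorphic_on_subset[OF wp_holomorphic] subsetI UNIV_I)
       (auto dest: off)
  moreover have "f (z + w) = f z" if z_off: "z \<notin> cosets ?Q" and w: "w \<in> L" for z w
  proof -
    obtain C \<eta> where C: "C \<noteq> 0" "\<And>z. z \<notin> L \<Longrightarrow> sigma (z + w) = C * exp (\<eta> * z) * sigma z"
      by (rule sigma_quasi_periodic[OF w]) blast
    note z = off[OF z_off]
    have 1: "sigma (z + w + b) = C * exp (\<eta> * (z + b)) * sigma (z + b)"
      using C(2)[OF z(3)] by (simp add: add_ac)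
    have 2: "sigma (z + w - b) = C * exp (\<eta> * (z - b)) * sigma (z - b)"
      using C(2)[OF z(2)] by (simp add: algebra_simps)
    have e: "exp (\<eta> * (z + b)) * exp (\<eta> * (z - b)) = exp (\<eta> * z) ^ 2"
      by (simp add: exp_add[symmetric] power2_eq_square algebra_simps)
    let ?u = "(C * exp (\<eta> * z)) ^ 2"
    have "f (z + w) = ?u * (sigma z ^ 2 * (wp z - wp b)) /
        (C ^ 2 * (exp (\<eta> * (z + b)) * exp (\<eta> * (z - b))) * (sigma (z + b) * sigma (z - b)))"
      unfolding f_def 1 2 C(2)[OF z(1)] wp_periodic[OF z(1) w]
      by (simp add: power_mult_distrib power2_eq_square mult_ac)
    also have "\<dots> = ?u * (sigma z ^ 2 * (wp z - wp b)) / (?u * (sigma (z + b) * sigma (z - b)))"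
      unfolding e by (simp add: power_mult_distrib)
    also have "\<dots> = f z" unfolding f_def using C(1) by (subst mult_divide_mult_cancel_left) auto
    finally show ?thesis .
  qed
  moreover have "((\<lambda>z. (z - q) * f z) \<longlongrightarrow> 0) (at q)" if "q \<in> ?Q" for q
  proof (cases "q = 0")
    case True
    have "((\<lambda>z. (z - 0) * f z) \<longlongrightarrow> (0 - 0) * (1 / (sigma b * sigma (- b)))) (at 0)"
      by (intro tendsto_intros lim0)
    thus ?thesis using True by simp
  next
    case False
    thus ?thesis using that lim_b[of q] by auto
  qed
  ultimately obtain c where c: "\<And>z. z \<notin> cosets ?Q \<Longrightarrow> f z = c"
    using elliptic_constant[of ?Q f] by blast
  have "eventually (\<lambda>z. f z = c) (at 0)"
    using eventually_notin_cosets[of ?Q 0] by (auto elim!: eventually_mono intro: c)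
  hence "(f \<longlongrightarrow> c) (at 0)" by (rule tendsto_eventually)
  hence "c = 1 / (sigma b * sigma (- b))" using lim0 by (intro tendsto_unique[of "at 0" f]) auto
  hence cval: "c = - 1 / sigma b ^ 2" by (simp add: sigma_minus power2_eq_square)
  show ?thesis
  proof (cases "a \<in> cosets ?Q")
    case False
    have "sigma a ^ 2 * (wp a - wp b) / (sigma (a + b) * sigma (a - b)) = - 1 / sigma b ^ 2"
      using c[OF False] by (simp add: f_def cval)
    with off[OF False] nz show ?thesis by (simp add: field_simps)
  next
    \<comment> \<open>Here the quotient \<open>f\<close> has denominator zero and says nothing about
      \<open>a\<close>, but both sides of the identity vanish directly.\<close>
    case True
    hence "a - b \<in> L \<or> a + b \<in> L" using a by (simp add: in_cosets_3)
    hence "sigma (a + b) * sigma (a - b) = 0" by (auto simp: sigma_eq_0_iff)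
    moreover have "wp a = wp b"
      using \<open>a - b \<in> L \<or> a + b \<in> L\<close> wp_periodic[OF bL(1), of "a - b"] wp_periodic[OF bL(2), of "a + b"] by auto
    ultimately show ?thesis by simp
  qed
qed

text \<open>The fibres of \<open>wp\<close> come from the known zeros of \<open>sigma\<close>, with
  no counting of zeros by residues.\<close>

lemma wp_eq_iff:
  assumes "a \<notin> L" "2 * b \<notin> L"
  shows "wp a = wp b \<longleftrightarrow> a + b \<in> L \<or> a - b \<in> L"
proof -
  have "b \<notin> L" using not_L_I[OF assms(2)] .
  hence "wp a - wp b = 0 \<longleftrightarrow> a + b \<in> L \<or> a - b \<in> L"
    unfolding wp_diff_sigma[OF assms] using assms by (auto simp: sigma_eq_0_iff)
  thus ?thesis by simp
qed

lemma double_notin_L: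
  assumes "k \<notin> L" "wp' k \<noteq> 0"
  shows "2 * k \<notin> L"
proof
  assume "2 * k \<in> L"
  hence "wp' (-k + 2 * k) = wp' (-k)" using assms by (intro wp'_periodic) auto
  thus False using wp'_minus[OF assms(1)] assms(2) by simp
qed

lemma tendsto_difference_quotient:
  "z \<notin> L \<Longrightarrow> ((\<lambda>y. (wp y - wp z) / (y - z)) \<longlongrightarrow> wp' z) (at z)"
  using wp_has_deriv[of z] by (simp add: has_field_derivative_iff)

lemma tendsto_difference_quotient':
  "z \<notin> L \<Longrightarrow> ((\<lambda>y. (wp' y - wp' z) / (y - z)) \<longlongrightarrow> deriv wp' z) (at z)"
  using wp'_has_deriv[of z] by (simp add: has_field_derivative_iff)

text \<open>The combination \<open>g\<close> is elliptic, and its possible simple poles cancel. At 0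
  the product and the quotient term contribute residues \<mu> and \<open>-\<mu>\<close>; at
  \<open>-k\<close> the double pole of \<open>wp (z + k)\<close> meets a zero of
  \<open>wp z - lam\<close> and contributes \<open>-\<mu>\<close>, which the quotient term
  cancels.\<close>

theorem wp_shift_product:
  assumes k: "k \<notin> L" "wp' k \<noteq> 0" and z: "z \<notin> L" "z + k \<notin> L" "z - k \<notin> L"
  shows "(wp z - wp k) * (wp (z + k) - wp k) =
    deriv wp' k / 2 - wp' k / 2 * ((wp' z - wp' k) / (wp z - wp k))"
proof -
  define \<mu> where "\<mu> = wp' k"
  define lam where "lam = wp k"
  have \<mu>: "\<mu> \<noteq> 0" using k by (simp add: \<mu>_def)
  have k2: "2 * k \<notin> L" by (rule double_notin_L[OF k])
  have mk: "-k \<notin> L" using k by simp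
  define g where "g = (\<lambda>z. (wp z - lam) * (wp (z + k) - lam) + \<mu> / 2 * ((wp' z - \<mu>) / (wp z - lam)))"
  let ?Q = "{0, k, -k}"
  have off: "z \<notin> L" "z - k \<notin> L" "z + k \<notin> L" "wp z \<noteq> lam" if "z \<notin> cosets ?Q" for z
    using that wp_eq_iff[OF _ k2, of z] unfolding in_cosets_3 lam_def by auto
  have ev_off: "eventually (\<lambda>z. z \<notin> cosets ?Q \<and> z \<noteq> p) (at p)" for p
    using eventually_notin_cosets[of ?Q p] by (auto simp: eventually_at_filter elim: eventually_mono)
  have lim0: "((\<lambda>z. (z - 0) * g z) \<longlongrightarrow> 0) (at 0)"
  proof -
    have q: "((\<lambda>z. (wp (z + k) - lam) / z) \<longlongrightarrow> \<mu>) (at 0)"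
      using LIM_offset[OF tendsto_difference_quotient[OF k(1)], of k] by (simp add: lam_def \<mu>_def)
    have "((\<lambda>z. z ^ 2 * (wp z - lam) * ((wp (z + k) - lam) / z) +
        \<mu> / 2 * (z ^ 3 * (wp' z - \<mu>) / (z ^ 2 * (wp z - lam)))) \<longlongrightarrow> 1 * \<mu> + \<mu> / 2 * (-2 / 1)) (at 0)"
      by (intro tendsto_intros q tendsto_square_wp_diff tendsto_cube_wp') auto
    moreover have "eventually (\<lambda>z. z ^ 2 * (wp z - lam) * ((wp (z + k) - lam) / z) +
        \<mu> / 2 * (z ^ 3 * (wp' z - \<mu>) / (z ^ 2 * (wp z - lam))) = (z - 0) * g z) (at 0)"
      using ev_off[of 0]
    proof eventually_elim
      case (elim z)
      have "z ^ 2 * (wp z - lam) * ((wp (z + k) - lam) / z) = z * ((wp z - lam) * (wp (z + k) - lam))"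
        using elim by (simp add: power2_eq_square)
      moreover have "z ^ 3 * (wp' z - \<mu>) / (z ^ 2 * (wp z - lam)) = z * ((wp' z - \<mu>) / (wp z - lam))"
        using elim by (simp add: power2_eq_square power3_eq_cube)
      ultimately show ?case by (simp only: g_def) (simp add: distrib_left)
    qed
    ultimately show ?thesis by (rule tendsto_transform) simp
  qed
  have lim_mk: "((\<lambda>z. (z - (-k)) * g z) \<longlongrightarrow> 0) (at (-k))"
  proof -
    have s: "((\<lambda>z. (z - (-k)) ^ 2 * (wp (z - (-k)) - lam)) \<longlongrightarrow> 1) (at (-k))"
      by (rule tendsto_shift_0[OF tendsto_square_wp_diff])
    have q: "((\<lambda>z. (wp z - lam) / (z - (-k))) \<longlongrightarrow> - \<mu>) (at (-k))"
      using tendsto_difference_quotient[OF mk] wp'_minus[OF k(1)] by (simp add: lam_def \<mu>_def)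
    have w': "(wp' \<longlongrightarrow> - \<mu>) (at (-k))"
      using wp'_isCont[OF mk] wp'_minus[OF k(1)] by (simp add: isCont_def \<mu>_def)
    have "((\<lambda>z. (z - (-k)) ^ 2 * (wp (z - (-k)) - lam) * ((wp z - lam) / (z - (-k))) +
        \<mu> / 2 * ((wp' z - \<mu>) / ((wp z - lam) / (z - (-k))))) \<longlongrightarrow> 1 * (- \<mu>) + \<mu> / 2 * ((- \<mu> - \<mu>) / (- \<mu>))) (at (-k))"
      by (intro tendsto_intros q s w') (use \<mu> in auto)
    also have "1 * (- \<mu>) + \<mu> / 2 * ((- \<mu> - \<mu>) / (- \<mu>)) = 0" using \<mu> by simp
    finally have "((\<lambda>z. (z - (-k)) ^ 2 * (wp (z - (-k)) - lam) * ((wp z - lam) / (z - (-k))) +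
        \<mu> / 2 * ((wp' z - \<mu>) / ((wp z - lam) / (z - (-k))))) \<longlongrightarrow> 0) (at (-k))" .
    moreover have "eventually (\<lambda>z. (z - (-k)) ^ 2 * (wp (z - (-k)) - lam) * ((wp z - lam) / (z - (-k))) +
        \<mu> / 2 * ((wp' z - \<mu>) / ((wp z - lam) / (z - (-k)))) = (z - (-k)) * g z) (at (-k))"
      using ev_off[of "-k"]
    proof eventually_elim
      case (elim z)
      define t where "t = z - (-k)"
      have t: "t \<noteq> 0" "wp (z + k) = wp t" using elim by (auto simp: t_def add_eq_0_iff)
      have "t ^ 2 * (wp t - lam) * ((wp z - lam) / t) = t * ((wp z - lam) * (wp t - lam))"
        using t by (simp add: power2_eq_square)
      moreover have "(wp' z - \<mu>) / ((wp z - lam) / t) = t * ((wp' z - \<mu>) / (wp z - lam))"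
        by simp
      ultimately show ?case unfolding g_def t(2) t_def[symmetric] by (simp add: distrib_left)
    qed
    ultimately show ?thesis by (rule tendsto_transform) simp
  qed
  \<comment> \<open>At \<open>k\<close> the product tends to zero and the quotient to a ratio of two
    derivatives, so this limit both removes the singularity and determines the constant.\<close>
  have lim_k: "(g \<longlongrightarrow> deriv wp' k / 2) (at k)"
  proof -
    have q: "((\<lambda>z. (wp z - lam) / (z - k)) \<longlongrightarrow> \<mu>) (at k)"
      using tendsto_difference_quotient[OF k(1)] by (simp add: lam_def \<mu>_def)
    have q': "((\<lambda>z. (wp' z - \<mu>) / (z - k)) \<longlongrightarrow> deriv wp' k) (at k)"
      using tendsto_difference_quotient'[OF k(1)] by (simp add: \<mu>_def)
    have w: "(wp \<longlongrightarrow> lam) (at k)" using wp_isCont[OF k(1)] by (simp add: isCont_def lam_def)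
    have wk: "((\<lambda>z. wp (z + k)) \<longlongrightarrow> wp (k + k)) (at k)"
      using LIM_offset[OF tendsto_wp[OF k2[unfolded mult_2]], of k] by (simp only: add_diff_cancel_right')
    have "((\<lambda>z. (wp z - lam) * (wp (z + k) - lam) + \<mu> / 2 * (((wp' z - \<mu>) / (z - k)) / ((wp z - lam) / (z - k))))
        \<longlongrightarrow> (lam - lam) * (wp (k + k) - lam) + \<mu> / 2 * (deriv wp' k / \<mu>)) (at k)"
      by (intro tendsto_intros q q' w wk \<mu>) simp
    also have "(lam - lam) * (wp (k + k) - lam) + \<mu> / 2 * (deriv wp' k / \<mu>) = deriv wp' k / 2" using \<mu> by simp
    finally have "((\<lambda>z. (wp z - lam) * (wp (z + k) - lam) + \<mu> / 2 * (((wp' z - \<mu>) / (z - k)) / ((wp z - lam) / (z - k))))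
        \<longlongrightarrow> deriv wp' k / 2) (at k)" .
    moreover have "eventually (\<lambda>z. (wp z - lam) * (wp (z + k) - lam) + \<mu> / 2 * (((wp' z - \<mu>) / (z - k)) / ((wp z - lam) / (z - k)))
        = g z) (at k)"
      using ev_off[of k] by eventually_elim (simp add: g_def)
    ultimately show ?thesis by (rule tendsto_transform) simp
  qed
  have "(\<lambda>z. z + k) ` (- cosets ?Q) \<subseteq> - L" using off by auto
  hence "(wp \<circ> (\<lambda>z. z + k)) holomorphic_on - cosets ?Q"
    by (intro holomorphic_on_compose_gen[OF _ wp_holomorphic]) (auto intro!: holomorphic_intros)
  hence holo_shift: "(\<lambda>z. wp (z + k)) holomorphic_on - cosets ?Q" by (simp add: o_def)
  have sub: "- cosets ?Q \<subseteq> - L" using off(1) by auto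
  have "g holomorphic_on - cosets ?Q"
    unfolding g_def
    by (intro holomorphic_on_add holomorphic_on_mult holomorphic_on_divide holomorphic_on_diff
        holomorphic_on_const holo_shift holomorphic_on_subset[OF wp_holomorphic sub]
        holomorphic_on_subset[OF wp'_holomorphic sub]) (use off(4) in auto)
  moreover have "g (z + w) = g z" if "z \<notin> cosets ?Q" "w \<in> L" for z w
  proof -
    have "wp (z + w + k) = wp (z + k)"
      using wp_periodic[OF off(3)[OF that(1)] that(2)] by (simp add: add_ac)
    thus ?thesis unfolding g_def using off[OF that(1)] that(2) by (simp add: wp_periodic wp'_periodic)
  qed
  moreover have "((\<lambda>z. (z - q) * g z) \<longlongrightarrow> 0) (at q)" if "q \<in> ?Q" for q
  proof -
    have "((\<lambda>z. (z - k) * g z) \<longlongrightarrow> (k - k) * (deriv wp' k / 2)) (at k)"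
      by (intro tendsto_intros lim_k)
    thus ?thesis using that lim0 lim_mk by auto
  qed
  ultimately obtain c where c: "\<And>z. z \<notin> cosets ?Q \<Longrightarrow> g z = c"
    using elliptic_constant[of ?Q g] by blast
  have "eventually (\<lambda>z. g z = c) (at k)"
    using ev_off[of k] by (auto elim!: eventually_mono intro: c)
  hence "(g \<longlongrightarrow> c) (at k)" by (rule tendsto_eventually)
  hence "c = deriv wp' k / 2" using lim_k by (intro tendsto_unique[of "at k" g]) auto
  moreover have "g z = c" using z by (intro c) (simp add: in_cosets_3)
  ultimately show ?thesis unfolding g_def lam_def \<mu>_def by (simp add: eq_diff_eq)
qed

text \<open>If \<open>wp\<close> omitted \<open>x\<close>, then \<open>1 / (wp z - x)\<close> would
  be elliptic without poles and tend to zero at the lattice, hence vanish identically. The lemma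
  supplies the starting point of the lift along the path of integration.\<close>

lemma wp_surj:
  obtains v where "v \<notin> L" "wp v = x"
proof (rule ccontr)
  assume "\<not> thesis"
  hence ne: "wp v \<noteq> x" if "v \<notin> L" for v using that \<open>\<And>v. v \<notin> L \<Longrightarrow> wp v = x \<Longrightarrow> thesis\<close> by blast
  define f where "f = (\<lambda>z. 1 / (wp z - x))"
  have lim: "(f \<longlongrightarrow> 0) (at 0)"
  proof -
    have "((\<lambda>z. z ^ 2 / (z ^ 2 * (wp z - x))) \<longlongrightarrow> 0 ^ 2 / 1) (at 0)"
      by (intro tendsto_intros tendsto_square_wp_diff) auto
    moreover have "eventually (\<lambda>z. z ^ 2 / (z ^ 2 * (wp z - x)) = f z) (at 0)"
      using ev_at_0 by eventually_elim (simp add: f_def)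
    ultimately show ?thesis by (rule tendsto_transform) simp
  qed
  have "f holomorphic_on - L"
    unfolding f_def by (intro holomorphic_intros wp_holomorphic) (use ne in auto)
  moreover have "f (z + w) = f z" if "z \<notin> L" "w \<in> L" for z w
    unfolding f_def using that by (simp add: wp_periodic)
  moreover have "((\<lambda>z. (z - 0) * f z) \<longlongrightarrow> (0 - 0) * 0) (at 0)"
    by (intro tendsto_intros lim)
  ultimately obtain c where c: "\<And>z. z \<notin> L \<Longrightarrow> f z = c"
    using elliptic_constant[of "{0}" f] by auto
  have "eventually (\<lambda>z. f z = c) (at 0)"
    using eventually_notin_L[of 0] by eventually_elim (rule c)
  hence "(f \<longlongrightarrow> c) (at 0)" by (rule tendsto_eventually)
  hence c0: "c = 0" using lim by (intro tendsto_unique[of "at 0" f]) auto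
  obtain z where "z \<notin> L" using eventually_happens[OF eventually_notin_L[of 0]] by auto
  with c[of z] ne[of z] c0 show False by (simp add: f_def)
qed

end

section \<open>Elliptic integrals\<close>

context period_lattice
begin

text \<open>A lift cannot run into a lattice point while \<open>X\<close> converges: there
  \<open>(u - v)^2 * wp (u - v)\<close> would tend to 1, but it equals \<open>(u - v)^2 * X\<close>,
  which tends to 0. This serves both for closedness inside the path and for its final point.\<close>

lemma wp_eq_of_tendsto:
  assumes F: "F \<noteq> bot" and u: "(u \<longlongrightarrow> v) F" and X: "(X \<longlongrightarrow> x) F"
    and ev: "eventually (\<lambda>t. u t \<notin> L \<and> wp (u t) = X t) F"
  shows "v \<notin> L" "wp v = x"
proof -
  show v: "v \<notin> L"
  proof
    assume v: "v \<in> L"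
    have "((\<lambda>t. u t - v) \<longlongrightarrow> v - v) F" by (intro tendsto_intros u)
    hence u0: "((\<lambda>t. u t - v) \<longlongrightarrow> 0) F" by simp
    moreover have ev': "eventually (\<lambda>t. u t - v \<notin> L \<and> wp (u t - v) = X t) F"
      using ev
    proof eventually_elim
      case (elim t)
      thus ?case using wp_periodic[of "u t" "- v"] v by simp
    qed
    moreover from ev' have "eventually (\<lambda>t. u t - v \<noteq> 0) F" by eventually_elim auto
    ultimately have "filterlim (\<lambda>t. u t - v) (at 0) F" by (simp add: filterlim_at)
    from filterlim_compose[OF tendsto_square_wp this]
    have "((\<lambda>t. (u t - v) ^ 2 * wp (u t - v)) \<longlongrightarrow> 1) F" .
    moreover have "eventually (\<lambda>t. (u t - v) ^ 2 * wp (u t - v) = (u t - v) ^ 2 * X t) F"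
      using ev' by eventually_elim simp
    ultimately have "((\<lambda>t. (u t - v) ^ 2 * X t) \<longlongrightarrow> 1) F" by (rule tendsto_transform) simp
    moreover have "((\<lambda>t. (u t - v) ^ 2 * X t) \<longlongrightarrow> 0 ^ 2 * x) F"
      by (intro tendsto_intros u0 X)
    ultimately show False using tendsto_unique[OF F] by fastforce
  qed
  have "((\<lambda>t. wp (u t)) \<longlongrightarrow> wp v) F"
    by (rule isCont_tendsto_compose[OF wp_isCont[OF v] u])
  moreover have "eventually (\<lambda>t. wp (u t) = X t) F" using ev by eventually_elim simp
  ultimately have "(X \<longlongrightarrow> wp v) F" by (rule tendsto_transform) simp
  thus "wp v = x" using X tendsto_unique[OF F] by blast
qed

text \<open>Near a point that is not a branch point of \<open>wp\<close>, a lift \<open>V\<close> of \<open>X\<close> along \<open>wp\<close> satisfies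
  \<open>V' = X' / Y\<close>, so it differs from \<open>W\<close> by a constant.\<close>
lemma wp_local_lift:
  fixes X Y W :: "real \<Rightarrow> complex"
  assumes S: "open S" "t0 \<in> S"
    and dX: "\<And>t. t \<in> S \<Longrightarrow> (X has_vector_derivative X' t) (at t)"
    and dW: "\<And>t. t \<in> S \<Longrightarrow> (W has_vector_derivative X' t / Y t) (at t)"
    and Y: "continuous_on S Y" "\<And>t. t \<in> S \<Longrightarrow> Y t \<noteq> 0"
    and curve: "\<And>t v. t \<in> S \<Longrightarrow> v \<notin> L \<Longrightarrow> wp v = X t \<Longrightarrow> wp' v ^ 2 = Y t ^ 2"
    and start: "W t0 + c \<notin> L" "wp (W t0 + c) = X t0" "wp' (W t0 + c) = Y t0"
  shows "eventually (\<lambda>t. W t + c \<notin> L \<and> wp (W t + c) = X t \<and> wp' (W t + c) = Y t) (nhds t0)"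
proof -
  define v0 where "v0 = W t0 + c"
  have v0: "v0 \<in> - L" "wp v0 = X t0" "wp' v0 = Y t0" using start by (simp_all add: v0_def)
  have "wp' v0 \<noteq> 0" using v0 Y(2) S by simp
  from has_complex_derivative_locally_invertible[OF wp_holomorphic v0(1) open_compl_L(1) this]
  obtain r where r: "r > 0" "ball v0 r \<subseteq> - L" "open (wp ` ball v0 r)" "inj_on wp (ball v0 r)" by blast
  have hol: "wp holomorphic_on ball v0 r" using wp_holomorphic r(2) by (rule holomorphic_on_subset)
  from holomorphic_has_inverse[OF hol open_ball r(4)]
  obtain g where g: "g holomorphic_on (wp ` ball v0 r)"
    "\<And>z. z \<in> ball v0 r \<Longrightarrow> wp' z * deriv g (wp z) = 1" "\<And>z. z \<in> ball v0 r \<Longrightarrow> g (wp z) = z"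
    by blast
  define U where "U = wp ` ball v0 r"
  have inv: "g x \<in> ball v0 r \<and> wp (g x) = x" if "x \<in> U" for x
    using that g(3) by (auto simp: U_def)
  define V where "V = (\<lambda>t. g (X t))"
  have X_cont: "isCont X t" if "t \<in> S" for t
    using dX[OF that] has_vector_derivative_continuous by blast
  have Y_cont: "isCont Y t" if "t \<in> S" for t
    using Y(1) S(1) that by (simp add: continuous_on_eq_continuous_at)
  have "v0 \<in> ball v0 r" using r(1) by simp
  hence X0: "X t0 \<in> U" "V t0 = v0" unfolding U_def V_def v0(2)[symmetric] using g(3) by auto
  have evU: "eventually (\<lambda>t. X t \<in> U \<and> t \<in> S) (nhds t0)"
  proof -
    have "eventually (\<lambda>t. X t \<in> U) (nhds t0)"
      using topological_tendstoD[OF X_cont[OF S(2), unfolded isCont_def tendsto_at_iff_tendsto_nhds]]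
        r(3) X0(1) unfolding U_def by blast
    moreover have "eventually (\<lambda>t. t \<in> S) (nhds t0)" using S by (rule eventually_nhds_in_open)
    ultimately show ?thesis by (rule eventually_conj)
  qed
  \<comment> \<open>The curve determines \<open>wp' (V t)\<close> up to sign only. Near
    \<open>t0\<close> the sum with \<open>Y t\<close> stays away from zero by continuity, which
    selects the sign of \<open>Y t\<close>.\<close>
  have "isCont (\<lambda>t. wp' (V t) + Y t) t0"
  proof -
    have "isCont g (X t0)"
      using holomorphic_on_imp_continuous_on[OF g(1)] X0(1)
      unfolding continuous_on_eq_continuous_at[OF r(3)] U_def by (rule bspec)
    hence "isCont V t0" unfolding V_def using X_cont[OF S(2)] isCont_o2 by blast
    moreover have "isCont wp' (V t0)" using wp'_isCont v0(1) X0(2) by simp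
    ultimately have "isCont (\<lambda>t. wp' (V t)) t0" by (rule isCont_o2)
    thus ?thesis using Y_cont[OF S(2)] by (rule continuous_add)
  qed
  hence "((\<lambda>t. wp' (V t) + Y t) \<longlongrightarrow> wp' (V t0) + Y t0) (nhds t0)"
    using tendsto_at_iff_tendsto_nhds[of "\<lambda>t. wp' (V t) + Y t" t0] by (simp add: isCont_def)
  moreover have "wp' (V t0) + Y t0 \<noteq> 0" using X0(2) v0(3) Y(2)[OF S(2)] by simp
  ultimately have "eventually (\<lambda>t. wp' (V t) + Y t \<noteq> 0) (nhds t0)"
    by (rule tendsto_imp_eventually_ne)
  with evU have "eventually (\<lambda>t. X t \<in> U \<and> t \<in> S \<and> wp' (V t) + Y t \<noteq> 0) (nhds t0)"
    by eventually_elim auto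
  then obtain e where e: "e > 0" "\<And>t. dist t t0 < e \<Longrightarrow> X t \<in> U \<and> t \<in> S \<and> wp' (V t) + Y t \<noteq> 0"
    unfolding eventually_nhds_metric by blast
  have VX: "V t \<in> ball v0 r" "V t \<notin> L" "wp (V t) = X t" "wp' (V t) = Y t" if t: "t \<in> ball t0 e" for t
  proof -
    have *: "X t \<in> U" "t \<in> S" "wp' (V t) + Y t \<noteq> 0" using e(2)[of t] t by (auto simp: dist_commute)
    show 1: "V t \<in> ball v0 r" "wp (V t) = X t" using inv[OF *(1)] by (auto simp: V_def)
    show 2: "V t \<notin> L" using 1(1) r(2) by blast
    have "(wp' (V t) - Y t) * (wp' (V t) + Y t) = 0"
      using curve[OF *(2) 2 1(2)] by (simp add: power2_eq_square algebra_simps)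
    thus "wp' (V t) = Y t" using *(3) by simp
  qed
  have dV: "(V has_vector_derivative X' t / Y t) (at t)" if t: "t \<in> ball t0 e" for t
  proof -
    have *: "X t \<in> U" "t \<in> S" using e(2)[of t] t by (auto simp: dist_commute)
    have "(g has_field_derivative deriv g (X t)) (at (X t))"
      using holomorphic_derivI[OF g(1) r(3)] *(1) by (simp add: U_def)
    from field_vector_diff_chain_at[OF dX[OF *(2)] this]
    have "(V has_vector_derivative X' t * deriv g (X t)) (at t)" by (simp add: V_def o_def)
    moreover have "Y t * deriv g (X t) = 1" using g(2)[OF VX(1)[OF t]] VX(3,4)[OF t] by simp
    hence "deriv g (X t) = 1 / Y t" using Y(2)[OF *(2)] by (simp add: field_simps)
    ultimately show ?thesis by simp
  qed
  have "((\<lambda>t. V t - W t) has_derivative (\<lambda>h. 0)) (at t within ball t0 e)" if t: "t \<in> ball t0 e" for t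
  proof -
    have "t \<in> S" using e(2)[of t] t by (auto simp: dist_commute)
    from has_vector_derivative_diff[OF dV[OF t] dW[OF this]]
    have "((\<lambda>t. V t - W t) has_vector_derivative 0) (at t)" by simp
    thus ?thesis by (simp add: has_vector_derivative_def has_derivative_at_withinI)
  qed
  from has_derivative_zero_constant[OF convex_ball this]
  obtain d where d: "\<And>t. t \<in> ball t0 e \<Longrightarrow> V t - W t = d" by blast
  have "d = c" using d[of t0] e(1) X0(2) by (simp add: v0_def)
  have "eventually (\<lambda>t. t \<in> ball t0 e) (nhds t0)"
    using e(1) by (intro eventually_nhds_in_open) auto
  thus ?thesis
  proof eventually_elim
    case (elim t)
    have "W t + c = V t" using d[OF elim] \<open>d = c\<close> by (simp add: algebra_simps)
    thus ?case using VX[OF elim] by simp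
  qed
qed

text \<open>Only the open path is lifted, since at the ends \<open>X\<close> may be infinite or
  \<open>Y\<close> may tend to zero. There continuity of the indefinite integral \<open>W\<close>
  suffices; in particular no local inverse of \<open>wp\<close> is needed when \<open>x\<close> is a
  branch point.\<close>

theorem elliptic_integral_wp:
  assumes "elliptic_integral (60 * eisenstein 4) (140 * eisenstein 6) x I"
  shows "I \<notin> L" "wp I = x"
proof -
  obtain X Y :: "real \<Rightarrow> complex" where
    C1: "X C1_differentiable_on {0<..<1}" and Y_cont: "continuous_on {0<..<1} Y" and
    XY: "\<And>t. t \<in> {0<..<1} \<Longrightarrow> Y t \<noteq> 0 \<and> Y t ^ 2 = 4 * X t ^ 3 - 60 * eisenstein 4 * X t - 140 * eisenstein 6" and
    X_0: "filterlim X at_infinity (at_right 0)" and X_1: "(X \<longlongrightarrow> x) (at_left 1)" and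
    int: "((\<lambda>t. vector_derivative X (at t) / Y t) has_integral I) {0..1}"
    using assms unfolding elliptic_integral_def by blast
  define X' where "X' = (\<lambda>t. vector_derivative X (at t))"
  define f where "f = (\<lambda>t. X' t / Y t)"
  define W where "W = (\<lambda>t. integral {0..t} f)"
  define S where "S = {0<..<1::real}"
  have S: "open S" "connected S" by (simp_all add: S_def)
  have f_int: "f integrable_on {0..1}" using int by (auto simp: f_def X'_def)
  have W_cont: "continuous_on {0..1} W" unfolding W_def by (rule indefinite_integral_continuous_1[OF f_int])
  have W_ends: "W 0 = 0" "W 1 = I" using integral_unique[OF int] by (simp_all add: W_def f_def X'_def)
  have dX: "(X has_vector_derivative X' t) (at t)" if "t \<in> S" for t
    using C1 that unfolding C1_differentiable_on_eq S_def X'_def by (simp add: vector_derivative_works)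
  have "continuous_on S f"
    unfolding f_def using C1 Y_cont XY unfolding C1_differentiable_on_eq S_def X'_def
    by (intro continuous_on_divide) auto
  hence f_cont: "isCont f t" if "t \<in> S" for t using S(1) that by (simp add: continuous_on_eq_continuous_at)
  have dW: "(W has_vector_derivative X' t / Y t) (at t)" if t: "t \<in> S" for t
  proof -
    have "(W has_vector_derivative f t) (at t within ({0..1} - {}))"
      unfolding W_def using f_int f_cont[OF t] t
      by (intro integral_has_vector_derivative_continuous_at)
         (auto simp: S_def intro: continuous_at_imp_continuous_at_within)
    moreover have "at t within {0..1} = at t"
      using t by (simp add: at_within_Icc_at S_def)
    ultimately show ?thesis by (simp add: f_def)
  qed
  have W_isCont: "isCont W t" if "t \<in> S" for t
    using dW[OF that] has_vector_derivative_continuous by blast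
  have X_isCont: "isCont X t" if "t \<in> S" for t
    using dX[OF that] has_vector_derivative_continuous by blast
  have Y_isCont: "isCont Y t" if "t \<in> S" for t
    using Y_cont S(1) that by (simp add: S_def continuous_on_eq_continuous_at)
  have curve: "wp' v ^ 2 = Y t ^ 2" if "t \<in> S" "v \<notin> L" "wp v = X t" for t v
    using XY[of t] that wp_ode1[OF that(2)] by (simp add: S_def)

  \<comment> \<open>The lift starts at an interior point, where the curve is finite and unramified.
    The offset \<open>c\<close> is what \<open>W\<close> must be shifted by to match there, and
    evenness of \<open>wp\<close> adjusts the sign of the derivative.\<close>
  obtain c where c: "W (1/2) + c \<notin> L" "wp (W (1/2) + c) = X (1/2)" "wp' (W (1/2) + c) = Y (1/2)"
  proof -
    obtain v where v: "v \<notin> L" "wp v = X (1/2)" by (rule wp_surj)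
    have "1/2 \<in> S" by (simp add: S_def)
    from curve[OF this v] have "wp' v = Y (1/2) \<or> wp' v = - Y (1/2)"
      unfolding power2_eq_iff .
    hence "wp' v = Y (1/2) \<or> wp' (-v) = Y (1/2)"
      unfolding wp'_minus[OF v(1)] by (elim disjE) simp_all
    hence "\<exists>u\<in>{v, - v}. wp' u = Y (1/2)" by simp
    then obtain u where u: "u = v \<or> u = - v" "wp' u = Y (1/2)" by blast
    have uL: "u \<notin> L" "wp u = X (1/2)" using u(1) v by auto
    have e: "W (1/2) + (u - W (1/2)) = u" by simp
    show ?thesis
    proof (rule that)
      show "W (1/2) + (u - W (1/2)) \<notin> L" "wp (W (1/2) + (u - W (1/2))) = X (1/2)"
        "wp' (W (1/2) + (u - W (1/2))) = Y (1/2)"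
        unfolding e by (rule uL u(2))+
    qed
  qed
  define T where "T = {t \<in> S. W t + c \<notin> L \<and> wp (W t + c) = X t \<and> wp' (W t + c) = Y t}"
  have "open T"
  proof (rule open_subopen[THEN iffD2], rule ballI)
    fix t assume t: "t \<in> T"
    have "eventually (\<lambda>t. W t + c \<notin> L \<and> wp (W t + c) = X t \<and> wp' (W t + c) = Y t) (nhds t)"
      using t Y_cont XY curve
      by (intro wp_local_lift[OF S(1) _ dX dW]) (auto simp: T_def S_def)
    moreover have "eventually (\<lambda>t. t \<in> S) (nhds t)"
      using S t by (intro eventually_nhds_in_open) (auto simp: T_def)
    ultimately have "eventually (\<lambda>t. t \<in> T) (nhds t)"
      by eventually_elim (simp add: T_def)
    thus "\<exists>U. open U \<and> t \<in> U \<and> U \<subseteq> T" unfolding eventually_nhds by blast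
  qed
  hence opn: "openin (top_of_set S) T" by (rule open_subset[rotated]) (auto simp: T_def)
  have clo: "closedin (top_of_set S) T"
    unfolding closedin_limpt
  proof (intro conjI allI impI)
    fix t assume "t islimpt T \<and> t \<in> S"
    hence t: "at t within T \<noteq> bot" "t \<in> S" by (auto simp: trivial_limit_within)
    have in_T: "eventually (\<lambda>s. s \<in> T) (at t within T)" by (simp add: eventually_at_filter)
    have Wc: "((\<lambda>s. W s + c) \<longlongrightarrow> W t + c) (at t within T)"
      by (intro tendsto_intros tendsto_within_subset[OF W_isCont[OF t(2), unfolded isCont_def] subset_UNIV])
    have X: "(X \<longlongrightarrow> X t) (at t within T)"
      by (rule tendsto_within_subset[OF X_isCont[OF t(2), unfolded isCont_def] subset_UNIV])
    have Y: "(Y \<longlongrightarrow> Y t) (at t within T)"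
      by (rule tendsto_within_subset[OF Y_isCont[OF t(2), unfolded isCont_def] subset_UNIV])
    have ev: "eventually (\<lambda>s. W s + c \<notin> L \<and> wp (W s + c) = X s) (at t within T)"
      using in_T by eventually_elim (simp add: T_def)
    note lim = wp_eq_of_tendsto[OF t(1) Wc X ev]
    have "((\<lambda>s. wp' (W s + c)) \<longlongrightarrow> wp' (W t + c)) (at t within T)"
      by (rule isCont_tendsto_compose[OF wp'_isCont[OF lim(1)] Wc])
    moreover have "eventually (\<lambda>s. wp' (W s + c) = Y s) (at t within T)"
      using in_T by eventually_elim (simp add: T_def)
    ultimately have "(Y \<longlongrightarrow> wp' (W t + c)) (at t within T)" by (rule tendsto_transform) simp
    hence "wp' (W t + c) = Y t" using Y tendsto_unique[OF t(1)] by blast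
    thus "t \<in> T" using lim t(2) by (simp add: T_def)
  qed (auto simp: T_def)
  have "1/2 \<in> T" unfolding T_def by (intro CollectI conjI c) (simp add: S_def)
  hence "T \<noteq> {}" by blast
  moreover have "T = {} \<or> T = S"
    using S(2) opn clo by (simp only: connected_clopen)
  ultimately have "T = S" by (simp only: simp_thms)
  have lift: "W t + c \<notin> L" "wp (W t + c) = X t" if "0 < t" "t < 1" for t
  proof -
    have "t \<in> T" unfolding \<open>T = S\<close> S_def using that by simp
    thus "W t + c \<notin> L" "wp (W t + c) = X t" unfolding T_def by blast+
  qed

  have "(W \<longlongrightarrow> W 0) (at 0 within {0..1})" "(W \<longlongrightarrow> W 1) (at 1 within {0..1})"
    using W_cont by (simp_all add: continuous_on_def)
  hence W_lim: "(W \<longlongrightarrow> 0) (at_right 0)" "(W \<longlongrightarrow> I) (at_left 1)"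
    by (simp_all add: at_within_Icc_at_right at_within_Icc_at_left W_ends)
  have "c \<in> L"
  proof (rule ccontr)
    assume c: "c \<notin> L"
    have "((\<lambda>t. W t + c) \<longlongrightarrow> 0 + c) (at_right 0)" by (intro tendsto_intros W_lim)
    hence "((\<lambda>t. wp (W t + c)) \<longlongrightarrow> wp c) (at_right 0)"
      by (intro isCont_tendsto_compose[OF wp_isCont[OF c]]) simp
    moreover have "eventually (\<lambda>t. wp (W t + c) = X t) (at_right 0)"
      using eventually_at_right[of "0::real" 1] lift by (auto intro!: exI[of _ 1])
    ultimately have "(X \<longlongrightarrow> wp c) (at_right 0)" by (rule tendsto_transform) simp
    thus False using X_0 not_tendsto_and_filterlim_at_infinity[of "at_right (0::real)" X] by auto
  qed
  have "eventually (\<lambda>t. W t \<notin> L \<and> wp (W t) = X t) (at_left 1)"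
  proof -
    have "W t \<notin> L \<and> wp (W t) = X t" if "0 < t" "t < 1" for t
    proof -
      have "W t \<notin> L" using lift(1)[OF that] \<open>c \<in> L\<close> by simp
      thus ?thesis using wp_periodic[OF _ \<open>c \<in> L\<close>] lift(2)[OF that] by simp
    qed
    thus ?thesis using eventually_at_left[of 0 "1::real"] by (auto intro!: exI[of _ 0])
  qed
  from wp_eq_of_tendsto[OF _ W_lim(2) X_1 this] show "I \<notin> L" "wp I = x" by auto
qed

end

section \<open>The orbit of the map\<close>

context period_lattice
begin

text \<open>The function \<open>F\<close> with parameter \<open>k\<close>, in the shape of the
  second closed form of the theorem.\<close>

definition qrt_value :: "complex \<Rightarrow> complex \<Rightarrow> complex" where
  "qrt_value k z = - (wp' k / 2) * ((wp' z - wp' k) / (wp z - wp k)) + deriv wp' k / 2"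

text \<open>The condition keeps \<open>z\<close> and \<open>z + k\<close> away from the poles of
  \<open>wp\<close>, and keeps the denominator \<open>wp z - wp k\<close> nonzero; off this set
  \<open>qrt_value\<close> may be a default value.\<close>

definition regular :: "complex \<Rightarrow> complex \<Rightarrow> bool" where
  "regular k z \<longleftrightarrow> z \<notin> L \<and> z + k \<notin> L \<and> z - k \<notin> L"

lemma regular_minus: "regular k z \<Longrightarrow> regular k (- z)"
proof -
  assume "regular k z"
  moreover have "- z + k \<in> L \<longleftrightarrow> z - k \<in> L" "- z - k \<in> L \<longleftrightarrow> z + k \<in> L"
    using minus_in_iff[of "z - k"] minus_in_iff[of "z + k"] by simp_all
  ultimately show ?thesis by (simp add: regular_def)
qed

lemma qrt_value_product:
  assumes "k \<notin> L" "wp' k \<noteq> 0" "regular k z"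
  shows "qrt_value k z = (wp z - wp k) * (wp (z + k) - wp k)"
  using wp_shift_product[OF assms(1,2), of z] assms(3) by (simp add: qrt_value_def regular_def)

lemma wp_neq:
  assumes "k \<notin> L" "wp' k \<noteq> 0" "regular k z"
  shows "wp z \<noteq> wp k"
  using wp_eq_iff[OF _ double_notin_L[OF assms(1,2)], of z] assms(3) by (simp add: regular_def)

lemma qrt_value_reflect:
  assumes "k \<notin> L" "wp' k \<noteq> 0" "regular k z" "regular k (z + k)"
  shows "qrt_value k (- (z + k)) = qrt_value k z"
proof -
  have "- (z + k) + k = - z" by simp
  hence "qrt_value k (- (z + k)) = (wp (- (z + k)) - wp k) * (wp (- z) - wp k)"
    using qrt_value_product[OF assms(1,2) regular_minus[OF assms(4)]] by simp
  thus ?thesis unfolding qrt_value_product[OF assms(1-3)] wp_minus by (simp add: mult.commute)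
qed

lemma qrt_value_sigma:
  assumes "k \<notin> L" "wp' k \<noteq> 0" "regular k z"
  shows "qrt_value k z = sigma (z + 2 * k) * sigma (z - k) / (sigma k ^ 4 * sigma z * sigma (z + k))"
proof -
  note k2 = double_notin_L[OF assms(1,2)]
  have z: "z \<notin> L" "z + k \<notin> L" using assms(3) by (auto simp: regular_def)
  have nz: "sigma z \<noteq> 0" "sigma (z + k) \<noteq> 0" "sigma k \<noteq> 0"
    using z assms(1) by (auto simp: sigma_eq_0_iff)
  have e: "z + k + k = z + 2 * k" "z + k - k = z" by simp_all
  have "qrt_value k z = (- (sigma (z + k) * sigma (z - k)) / (sigma z ^ 2 * sigma k ^ 2)) *
      (- (sigma (z + 2 * k) * sigma z) / (sigma (z + k) ^ 2 * sigma k ^ 2))"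
    using qrt_value_product[OF assms] wp_diff_sigma[OF z(1) k2] wp_diff_sigma[OF z(2) k2]
    unfolding e by simp
  also have "\<dots> = sigma (z + 2 * k) * sigma (z - k) / (sigma k ^ 4 * sigma z * sigma (z + k))"
    using nz by (simp add: divide_simps) (simp add: power2_eq_square eval_nat_numeral)
  finally show ?thesis .
qed

lemma qrt_value_map:
  assumes k: "k \<notin> L" "wp' k \<noteq> 0" and z: "regular k z" "regular k (z + k)"
    and \<mu>: "wp' k ^ 4 = \<beta> + \<alpha> * deriv wp' k"
    and lam: "3 * wp k * wp' k ^ 2 = deriv wp' k ^ 2 / 4 + \<alpha>"
  shows "qrt_value k (- z) * qrt_value k z * qrt_value k (z + k) = \<alpha> * qrt_value k z + \<beta>"
proof -
  define J where "J = deriv wp' k"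
  define \<mu> where "\<mu> = wp' k"
  define l where "l = wp k"
  define u where "u = wp z - l"
  define u' where "u' = wp (z + k) - l"
  define y where "y = wp' z"
  define y' where "y' = wp' (z + k)"
  define H where "H = qrt_value k z"
  have zL: "z \<notin> L" "z + k \<notin> L" using z by (auto simp: regular_def)
  have nz: "u \<noteq> 0" "u' \<noteq> 0"
    using wp_neq[OF k z(1)] wp_neq[OF k z(2)] by (simp_all add: u_def u'_def l_def)
  have H: "H = - (\<mu> / 2) * ((y - \<mu>) / u) + J / 2"
    by (simp add: H_def qrt_value_def \<mu>_def y_def u_def l_def J_def)
  have Huu: "H = u * u'"
    unfolding H_def using qrt_value_product[OF k z(1)] by (simp add: u_def u'_def l_def)
  \<comment> \<open>Changing \<open>z\<close> to \<open>-z\<close> only changes the sign of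
    \<open>y\<close>, so the sum of the two values of \<open>F\<close> is free of
    \<open>y\<close>.\<close>
  have P: "qrt_value k (- z) = J - H + \<mu> ^ 2 / u"
    unfolding H qrt_value_def using nz wp'_minus[OF zL(1)]
    by (simp add: \<mu>_def[symmetric] y_def[symmetric] u_def[symmetric] l_def[symmetric] J_def[symmetric]
        divide_simps) (simp add: power2_eq_square algebra_simps)
  have N': "H = - (\<mu> / 2) * ((- y' - \<mu>) / u') + J / 2"
  proof -
    have "H = qrt_value k (- (z + k))" unfolding H_def using qrt_value_reflect[OF k z] by simp
    thus ?thesis unfolding qrt_value_def[of k "- (z + k)"] wp_minus wp'_minus[OF zL(2)]
      by (simp only: \<mu>_def y'_def u'_def l_def J_def)
  qed
  have N: "qrt_value k (z + k) = J - H + \<mu> ^ 2 / u'"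
    unfolding N' qrt_value_def using nz
    by (simp add: \<mu>_def[symmetric] y'_def[symmetric] u'_def[symmetric] l_def[symmetric] J_def[symmetric]
        divide_simps) (simp add: power2_eq_square algebra_simps)
  define e where "e = eisenstein 4"
  have J: "J = 6 * l ^ 2 - 30 * e" unfolding J_def l_def e_def by (rule wp_ode2[OF k(1)])
  have c1: "y ^ 2 = 4 * (u + l) ^ 3 - 60 * e * (u + l) - 140 * eisenstein 6"
    using wp_ode1[OF zL(1)] by (simp add: y_def u_def e_def)
  have c2: "\<mu> ^ 2 = 4 * l ^ 3 - 60 * e * l - 140 * eisenstein 6"
    using wp_ode1[OF k(1)] by (simp add: \<mu>_def l_def e_def)
  have curve: "y ^ 2 = 4 * u ^ 3 + 12 * l * u ^ 2 + 2 * J * u + \<mu> ^ 2"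
    using c1 c2 J by algebra
  have "2 * H * u = - \<mu> * (y - \<mu>) + J * u" unfolding H using nz by (simp add: field_simps)
  hence \<mu>y: "\<mu> * y = \<mu> ^ 2 + u * (J - 2 * H)" by algebra
  have lam': "12 * l * \<mu> ^ 2 = J ^ 2 + 4 * \<alpha>"
    using lam unfolding \<mu>_def l_def J_def by (simp add: field_simps)
  \<comment> \<open>Squaring the linear relation for \<open>\<mu> * y\<close> and inserting the
    curve eliminates \<open>y\<close>. The square of \<open>u\<close> comes from the common factor
    \<open>u\<close> and from replacing \<open>H\<close> by \<open>u * u'\<close>; the hypothesis on
    \<open>wp k\<close> turns the remaining constant into \<alpha>.\<close>
  have "u ^ 2 * (\<mu> ^ 2 * (u + u') - (H ^ 2 - J * H - \<alpha>)) = 0"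
    using \<mu>y curve Huu lam' by algebra
  hence sum: "\<mu> ^ 2 * (u + u') = H ^ 2 - J * H - \<alpha>" using nz by simp
  have "(\<mu> ^ 2 / u) * u = \<mu> ^ 2" "(\<mu> ^ 2 / u') * u' = \<mu> ^ 2" using nz by simp_all
  moreover have "\<mu> ^ 4 = \<beta> + \<alpha> * J" using \<mu> by (simp add: \<mu>_def J_def)
  moreover note sum Huu
  moreover define p q where "p = \<mu> ^ 2 / u" and "q = \<mu> ^ 2 / u'"
  \<comment> \<open>Since \<open>H = u * u'\<close>, the products are
    \<open>H * (p + q) = \<mu> ^ 2 * (u + u')\<close> and \<open>p * q * H = \<mu> ^ 4\<close>; with
    \<open>sum\<close>, the powers of \<open>H\<close> above the first cancel.\<close>
  ultimately have "(J - H + p) * H * (J - H + q) = \<alpha> * H + \<beta>" unfolding p_def[symmetric] q_def[symmetric]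
    by algebra
  thus ?thesis unfolding P N H_def[symmetric] p_def q_def .
qed

text \<open>The recurrence has order two, so the induction carries two consecutive values, the
  earlier one as a value at the reflected point, together with regularity of the current
  point.\<close>

lemma qrt_orbit_forward:
  fixes h :: "int \<Rightarrow> complex"
  assumes h_nz: "\<And>n. h n \<noteq> 0" and h_map: "\<And>n. h (n - 1) * h n * h (n + 1) = \<alpha> * h n + \<beta>"
    and k: "k \<notin> L" "wp' k \<noteq> 0"
    and \<mu>: "wp' k ^ 4 = \<beta> + \<alpha> * deriv wp' k"
    and lam: "3 * wp k * wp' k ^ 2 = deriv wp' k ^ 2 / 4 + \<alpha>"
    and z0: "regular k z0" "h 0 = qrt_value k z0" "h (-1) = qrt_value k (- z0)"
  shows "regular k (z0 + of_nat n * k) \<and> h (int n) = qrt_value k (z0 + of_nat n * k) \<and>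
    h (int n - 1) = qrt_value k (- (z0 + of_nat n * k))"
proof (induction n)
  case 0
  thus ?case using z0 by simp
next
  case (Suc n)
  define z where "z = z0 + of_nat n * k"
  have z: "regular k z" "h (int n) = qrt_value k z" "h (int n - 1) = qrt_value k (- z)"
    using Suc.IH by (simp_all add: z_def)
  have zk: "z0 + of_nat (Suc n) * k = z + k" by (simp add: z_def algebra_simps)
  have zL: "z \<notin> L" "z + k \<notin> L" using z(1) by (auto simp: regular_def)
  \<comment> \<open>A vanishing second factor in the product form would make \<open>h n\<close>
    zero; this is how nonvanishing of the sequence keeps the next point regular.\<close>
  have "wp (z + k) \<noteq> wp k" using h_nz[of "int n"] z(2) qrt_value_product[OF k z(1)] by auto
  hence "(z + k) + k \<notin> L" using wp_eq_iff[OF zL(2) double_notin_L[OF k]] by auto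
  hence reg: "regular k (z + k)" using zL by (simp add: regular_def)
  have "h (int n - 1) * h (int n) * h (int n + 1) = h (int n - 1) * h (int n) * qrt_value k (z + k)"
    using h_map[of "int n"] qrt_value_map[OF k z(1) reg \<mu> lam] z(2,3) by simp
  hence "h (int n + 1) = qrt_value k (z + k)" using h_nz[of "int n"] h_nz[of "int n - 1"] by simp
  moreover have "h (int n) = qrt_value k (- (z + k))" using qrt_value_reflect[OF k z(1) reg] z(2) by simp
  ultimately show ?case unfolding zk using reg by (simp add: add.commute)
qed

lemma qrt_orbit:
  fixes h :: "int \<Rightarrow> complex"
  assumes h_nz: "\<And>n. h n \<noteq> 0" and h_map: "\<And>n. h (n - 1) * h n * h (n + 1) = \<alpha> * h n + \<beta>"
    and k: "k \<notin> L" "wp' k \<noteq> 0"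
    and \<mu>: "wp' k ^ 4 = \<beta> + \<alpha> * deriv wp' k"
    and lam: "3 * wp k * wp' k ^ 2 = deriv wp' k ^ 2 / 4 + \<alpha>"
    and z0: "regular k z0" "h 0 = qrt_value k z0" "h (-1) = qrt_value k (- z0)"
  shows "regular k (z0 + of_int n * k) \<and> h n = qrt_value k (z0 + of_int n * k)"
proof (cases "n \<ge> 0")
  case True
  then obtain m where "n = int m" using nonneg_int_cases by blast
  thus ?thesis using qrt_orbit_forward[OF h_nz h_map k \<mu> lam z0, of m] by simp
next
  case False
  define m where "m = nat (- n)"
  have m: "n = - int m" using False by (simp add: m_def)
  \<comment> \<open>Reading the sequence backwards, with \<open>h (-1)\<close> and
    \<open>h 0\<close> exchanged, preserves the recurrence and replaces \<open>z0\<close> by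
    \<open>-z0\<close>. The value wanted is \<open>h' (m - 1) = h (- m)\<close>, the second
    component of the forward statement.\<close>
  define h' where "h' = (\<lambda>n. h (- 1 - n))"
  have map': "h' (n - 1) * h' n * h' (n + 1) = \<alpha> * h' n + \<beta>" for n
    using h_map[of "- 1 - n"] by (simp add: h'_def algebra_simps)
  have "h' 0 = qrt_value k (- z0)" "h' (-1) = qrt_value k (- (- z0))"
    using z0 by (simp_all add: h'_def)
  from qrt_orbit_forward[OF _ map' k \<mu> lam regular_minus[OF z0(1)] this, of m]
  have *: "regular k (- z0 + of_nat m * k)" "h' (int m - 1) = qrt_value k (- (- z0 + of_nat m * k))"
    using h_nz by (simp_all add: h'_def)
  have e: "- (- z0 + of_nat m * k) = z0 + of_int n * k" by (simp add: m)
  show ?thesis using regular_minus[OF *(1)] *(2) unfolding e by (simp add: h'_def m)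
qed

end

text \<open>By the recurrence at \<open>n\<close>, the invariant at \<open>n\<close> and at
  \<open>n + 1\<close> both equal
  \<open>h (n - 1) + h n + h (n + 1) + \<alpha> / h n\<close>.\<close>

lemma somos5_J_const:
  assumes h_nz: "\<And>n. h n \<noteq> 0" and h_map: "\<And>n. h (n - 1) * h n * h (n + 1) = \<alpha> * h n + \<beta>"
  shows "somos5_J \<alpha> \<beta> h m = somos5_J \<alpha> \<beta> h n"
proof -
  have step: "somos5_J \<alpha> \<beta> h (n + 1) = somos5_J \<alpha> \<beta> h n" for n
  proof -
    have nz: "h (n - 1) \<noteq> 0" "h n \<noteq> 0" "h (n + 1) \<noteq> 0" using h_nz by auto
    have 1: "\<alpha> / h (n - 1) + \<beta> / (h (n - 1) * h n) = h (n + 1)"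
      using h_map[of n] nz by (simp add: field_simps)
    have 2: "\<alpha> / h (n + 1) + \<beta> / (h n * h (n + 1)) = h (n - 1)"
      using h_map[of n] nz by (simp add: field_simps)
    have "somos5_J \<alpha> \<beta> h n = h (n - 1) + h n + \<alpha> / h n + (\<alpha> / h (n - 1) + \<beta> / (h (n - 1) * h n))"
      by (simp add: somos5_J_def distrib_left)
    moreover have "somos5_J \<alpha> \<beta> h (n + 1) = h n + h (n + 1) + \<alpha> / h n + (\<alpha> / h (n + 1) + \<beta> / (h n * h (n + 1)))"
      by (simp add: somos5_J_def distrib_left)
    ultimately show ?thesis unfolding 1 2 by simp
  qed
  have "somos5_J \<alpha> \<beta> h n = somos5_J \<alpha> \<beta> h 0" for n
  proof (induction n rule: int_induct[where k = 0])
    case (step1 i) thus ?case using step[of i] by simp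
  next
    case (step2 i) thus ?case using step[of "i - 1"] by simp
  qed simp
  thus ?thesis by metis
qed

section \<open>From the initial data to a point of the curve, and the solution\<close>

context period_lattice
begin

text \<open>The initial values themselves give a point of the curve with abscissa \<open>x0\<close>,
  whose ordinate times \<mu> is \<open>(x0 - l) * (hm - h0)\<close>. Hence the ordinate
  \<open>wp'\<close> at the integral agrees with it up to sign, and the required choice of signs
  exists.\<close>

lemma somos5_curve_identity:
  fixes J \<mu> l x0 \<alpha> \<beta> hm h0 y :: complex
  assumes nz: "hm \<noteq> 0" "h0 \<noteq> 0" "\<mu> \<noteq> 0" "hm + h0 - J \<noteq> 0"
    and J: "J = hm + h0 + \<alpha> * (1 / hm + 1 / h0) + \<beta> / (hm * h0)"
    and \<mu>: "\<mu> ^ 4 = \<beta> + \<alpha> * J"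
    and l: "12 * l * \<mu> ^ 2 = J ^ 2 + 4 * \<alpha>"
    and x0: "x0 = l + \<mu> ^ 2 / (hm + h0 - J)"
    and y: "y ^ 2 = 4 * (x0 - l) ^ 3 + 12 * l * (x0 - l) ^ 2 + 2 * J * (x0 - l) + \<mu> ^ 2"
  shows "(\<mu> * y) ^ 2 = ((x0 - l) * (hm - h0)) ^ 2"
proof -
  define D where "D = hm + h0 - J"
  define u where "u = x0 - l"
  define p where "p = hm * h0"
  define s where "s = hm + h0"
  have D: "D \<noteq> 0" using nz by (simp add: D_def)
  have u: "u * D = \<mu> ^ 2" using D by (simp add: u_def x0 D_def)
  have "p * J = p * s + \<alpha> * s + \<beta>"
    unfolding J p_def s_def using nz by (simp add: field_simps)
  hence p: "p * D = - (\<alpha> * s + \<beta>)" unfolding D_def s_def[symmetric] by algebra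
  have Ds: "D = s - J" by (simp add: D_def s_def)
  have y': "y ^ 2 = 4 * u ^ 3 + 12 * l * u ^ 2 + 2 * J * u + \<mu> ^ 2" using y by (simp add: u_def)
  define M where "M = \<mu> ^ 2"
  have M: "M ^ 2 = \<beta> + \<alpha> * J" using \<mu> by (simp add: M_def power_mult[symmetric])
  \<comment> \<open>With \<open>M = u * D\<close>, every term acquires the factor
    \<open>u ^ 2\<close>. What remains is a polynomial in \<open>D\<close> that vanishes by the
    relations for \<open>p * D\<close>, \<open>M ^ 2\<close> and \<open>12 * l * M\<close>.\<close>
  have "D * (M * (4 * u ^ 3 + 12 * l * u ^ 2 + 2 * J * u + M) - u ^ 2 * (s ^ 2 - 4 * p)) = 0"
  proof -
    have s: "s = D + J" by (simp add: Ds)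
    have "4 * M ^ 2 + 12 * l * M * D + 2 * J * D ^ 2 + D ^ 3 - D * s ^ 2 + 4 * (p * D) = 0"
      unfolding M p l[folded M_def] s by algebra
    moreover have "D * (M * (4 * u ^ 3 + 12 * l * u ^ 2 + 2 * J * u + M) - u ^ 2 * (s ^ 2 - 4 * p)) =
        u ^ 2 * (4 * M ^ 2 + 12 * l * M * D + 2 * J * D ^ 2 + D ^ 3 - D * s ^ 2 + 4 * (p * D))"
      unfolding u[folded M_def, symmetric] by algebra
    ultimately show ?thesis by simp
  qed
  hence "M * (4 * u ^ 3 + 12 * l * u ^ 2 + 2 * J * u + M) = u ^ 2 * (s ^ 2 - 4 * p)" using D by simp
  hence "\<mu> ^ 2 * y ^ 2 = u ^ 2 * (s ^ 2 - 4 * p)" unfolding y' M_def .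
  moreover have "s ^ 2 - 4 * p = (hm - h0) ^ 2" unfolding s_def p_def by algebra
  ultimately show ?thesis unfolding power_mult_distrib u_def by simp
qed

lemma somos5_solution:
  fixes h :: "int \<Rightarrow> complex"
  assumes h_nz: "\<And>n. h n \<noteq> 0" and h_map: "\<And>n. h (n - 1) * h n * h (n + 1) = \<alpha> * h n + \<beta>"
    and J: "J = somos5_J \<alpha> \<beta> h 0"
    and \<mu>: "\<mu> ^ 4 = \<beta> + \<alpha> * J" "\<mu> \<noteq> 0"
    and lam: "lam = 1 / (3 * \<mu> ^ 2) * (J ^ 2 / 4 + \<alpha>)"
    and g2: "60 * eisenstein 4 = 12 * lam ^ 2 - 2 * J"
    and g3: "140 * eisenstein 6 = 4 * lam ^ 3 - (60 * eisenstein 4) * lam - \<mu> ^ 2"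
    and D: "h (-1) + h 0 - J \<noteq> 0"
    and x0: "x0 = lam + \<mu> ^ 2 / (h (-1) + h 0 - J)"
    and I0: "I0 \<notin> L" "wp I0 = x0" and Ik: "Ik \<notin> L" "wp Ik = lam"
  shows "\<exists>k\<in>{Ik, - Ik}. \<exists>z0\<in>{I0, - I0}. wp' k = \<mu> \<and> wp' k * wp' z0 = (x0 - lam) * (h (-1) - h 0)"
      (is ?signs)
    and "\<lbrakk>k \<in> {Ik, - Ik}; z0 \<in> {I0, - I0}; wp' k = \<mu>; wp' k * wp' z0 = (x0 - lam) * (h (-1) - h 0)\<rbrakk> \<Longrightarrow>
      h n = sigma (z0 + of_int (n + 2) * k) * sigma (z0 + of_int (n - 1) * k) /
              (sigma k ^ 4 * sigma (z0 + of_int n * k) * sigma (z0 + of_int (n + 1) * k)) \<and>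
      h n = - (wp' k / 2) * ((wp' (z0 + of_int n * k) - wp' k) / (wp (z0 + of_int n * k) - wp k)) + deriv wp' k / 2"
      (is "\<lbrakk>_; _; _; _\<rbrakk> \<Longrightarrow> ?solution")
proof -
  have lam': "3 * lam * \<mu> ^ 2 = J ^ 2 / 4 + \<alpha>" unfolding lam using \<mu>(2) by simp
  have l12: "12 * lam * \<mu> ^ 2 = J ^ 2 + 4 * \<alpha>" using lam' by algebra
  have nz: "h (-1) \<noteq> 0" "h 0 \<noteq> 0" using h_nz by auto
  have J': "J = h (-1) + h 0 + \<alpha> * (1 / h (-1) + 1 / h 0) + \<beta> / (h (-1) * h 0)"
    unfolding J somos5_J_def by simp
  have "wp' I0 ^ 2 = 4 * (x0 - lam) ^ 3 + 12 * lam * (x0 - lam) ^ 2 + 2 * J * (x0 - lam) + \<mu> ^ 2"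
    using wp_ode1[OF I0(1)] g2 g3 unfolding I0(2) by algebra
  from somos5_curve_identity[OF nz \<mu>(2) D J' \<mu>(1) l12 x0 this]
  have "\<mu> * wp' I0 = (x0 - lam) * (h (-1) - h 0) \<or> \<mu> * wp' I0 = - ((x0 - lam) * (h (-1) - h 0))"
    unfolding power2_eq_iff .
  moreover have "\<mu> * wp' (- I0) = - (\<mu> * wp' I0)" by (simp add: wp'_minus[OF I0(1)])
  ultimately have "\<mu> * wp' I0 = (x0 - lam) * (h (-1) - h 0) \<or> \<mu> * wp' (- I0) = (x0 - lam) * (h (-1) - h 0)"
    by (elim disjE) simp_all
  moreover have "wp' Ik ^ 2 = \<mu> ^ 2"
    using wp_ode1[OF Ik(1)] g2 g3 unfolding Ik(2) by algebra
  hence "wp' Ik = \<mu> \<or> wp' (- Ik) = \<mu>"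
    unfolding power2_eq_iff wp'_minus[OF Ik(1)] by (elim disjE) simp_all
  ultimately show ?signs by auto
  show ?solution
    if k: "k \<in> {Ik, - Ik}" and z0: "z0 \<in> {I0, - I0}" and wp'k: "wp' k = \<mu>"
      and wp'z0: "wp' k * wp' z0 = (x0 - lam) * (h (-1) - h 0)"
  proof -
    have kL: "k \<notin> L" "wp k = lam" using k Ik by auto
    have zL: "z0 \<notin> L" "wp z0 = x0" using z0 I0 by auto
    have k': "wp' k \<noteq> 0" using wp'k \<mu>(2) by simp
    have wp''k: "deriv wp' k = J"
      using wp_ode2[OF kL(1)] g2 unfolding kL(2) by algebra
    define u where "u = x0 - lam"
    define y where "y = wp' z0"
    have u: "u \<noteq> 0" "u * (h (-1) + h 0 - J) = \<mu> ^ 2" using D \<mu>(2) by (simp_all add: u_def x0)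
    have uy: "\<mu> * y = u * (h (-1) - h 0)" using wp'z0 wp'k by (simp add: u_def y_def)
    have reg: "regular k z0"
      using wp_eq_iff[OF zL(1) double_notin_L[OF kL(1) k']] u(1) zL by (simp add: regular_def u_def kL(2))
    \<comment> \<open>The sign condition gives \<open>h (-1) - h 0\<close> and the choice of
      \<open>x0\<close> gives \<open>h (-1) + h 0\<close>; solving for the two initial values yields
      \<open>F\<close> at \<open>z0\<close> and at \<open>-z0\<close>.\<close>
    have "2 * u * qrt_value k z0 = u * J - \<mu> * (y - \<mu>)"
      unfolding qrt_value_def wp''k wp'k zL(2) kL(2) u_def[symmetric] y_def[symmetric]
      using u(1) by (simp add: field_simps)
    hence "2 * u * (qrt_value k z0 - h 0) = 0" using uy u(2) by algebra
    hence h0: "h 0 = qrt_value k z0" using u(1) by simp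
    have "2 * u * qrt_value k (- z0) = u * J + \<mu> * (y + \<mu>)"
      unfolding qrt_value_def wp''k wp'k wp_minus zL(2) kL(2) wp'_minus[OF zL(1)] u_def[symmetric] y_def[symmetric]
      using u(1) by (simp add: field_simps)
    hence "2 * u * (qrt_value k (- z0) - h (-1)) = 0" using uy u(2) by algebra
    hence hm: "h (-1) = qrt_value k (- z0)" using u(1) by simp
    have "wp' k ^ 4 = \<beta> + \<alpha> * deriv wp' k" "3 * wp k * wp' k ^ 2 = deriv wp' k ^ 2 / 4 + \<alpha>"
      using \<mu>(1) lam' by (simp_all add: wp'k wp''k kL(2))
    from qrt_orbit[OF h_nz h_map kL(1) k' this reg h0 hm, of n]
    have orbit: "regular k (z0 + of_int n * k)" "h n = qrt_value k (z0 + of_int n * k)" by auto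
    have e: "z0 + of_int n * k + 2 * k = z0 + of_int (n + 2) * k"
      "z0 + of_int n * k - k = z0 + of_int (n - 1) * k"
      "z0 + of_int n * k + k = z0 + of_int (n + 1) * k"
      by (simp_all add: ring_distribs)
    show ?thesis
      using orbit(2) qrt_value_sigma[OF kL(1) k' orbit(1)] unfolding e qrt_value_def by simp
  qed
qed

end

theorem theorem2p7:
  fixes \<alpha> \<beta> :: complex and h :: "int \<Rightarrow> complex"
  assumes h_nonzero: "\<forall>n. h n \<noteq> 0"
    and h_map: "\<forall>n. h (n - 1) * h n * h (n + 1) = \<alpha> * h n + \<beta>"
  shows "(\<forall>m n. somos5_J \<alpha> \<beta> h m = somos5_J \<alpha> \<beta> h n) \<and>
    (\<forall>J \<mu> lam g2 g3 x0 \<Lambda> I_kappa I_zero.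
       J = somos5_J \<alpha> \<beta> h 0 \<and>
       \<mu> ^ 4 = \<beta> + \<alpha> * J \<and> \<mu> \<noteq> 0 \<and>
       lam = 1 / (3 * \<mu> ^ 2) * (J ^ 2 / 4 + \<alpha>) \<and>
       g2 = 12 * lam ^ 2 - 2 * J \<and>
       g3 = 4 * lam ^ 3 - g2 * lam - \<mu> ^ 2 \<and>
       h (-1) + h 0 - J \<noteq> 0 \<and>
       x0 = lam + \<mu> ^ 2 / (h (-1) + h 0 - J) \<and>
       nonsingular_curve g2 g3 \<and>
       is_period_lattice g2 g3 \<Lambda> \<and>
       elliptic_integral g2 g3 x0 I_zero \<and>
       elliptic_integral g2 g3 lam I_kappa \<longrightarrow>
       (let \<sigma> = weierstrass_sigma \<Lambda>;
            wp = weierstrass_wp \<Lambda>;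
            wp' = deriv wp;
            wp'' = deriv wp';
            signs_ok = (\<lambda>\<kappa> z0. wp' \<kappa> = \<mu> \<and> wp' \<kappa> * wp' z0 = (x0 - lam) * (h (-1) - h 0))
        in (\<exists>\<kappa>\<in>{I_kappa, - I_kappa}. \<exists>z0\<in>{I_zero, - I_zero}. signs_ok \<kappa> z0) \<and>
           (\<forall>\<kappa>\<in>{I_kappa, - I_kappa}. \<forall>z0\<in>{I_zero, - I_zero}.
              wp z0 = x0 \<and> wp \<kappa> = lam \<and>
              (signs_ok \<kappa> z0 \<longrightarrow>
                (\<forall>n::int.
                   h n = \<sigma> (z0 + of_int (n + 2) * \<kappa>) * \<sigma> (z0 + of_int (n - 1) * \<kappa>) /
                         (\<sigma> \<kappa> ^ 4 * \<sigma> (z0 + of_int n * \<kappa>) * \<sigma> (z0 + of_int (n + 1) * \<kappa>)) \<and>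
                   h n = - (wp' \<kappa> / 2) *
                           ((wp' (z0 + of_int n * \<kappa>) - wp' \<kappa>) / (wp (z0 + of_int n * \<kappa>) - wp \<kappa>)) +
                         wp'' \<kappa> / 2)))))"
proof (intro conjI allI impI)
  show "somos5_J \<alpha> \<beta> h m = somos5_J \<alpha> \<beta> h n" for m n
    using h_nonzero h_map by (intro somos5_J_const) auto
next
  fix J \<mu> lam g2 g3 x0 :: complex and \<Lambda> and I_kappa I_zero :: complex
  assume A: "J = somos5_J \<alpha> \<beta> h 0 \<and>
       \<mu> ^ 4 = \<beta> + \<alpha> * J \<and> \<mu> \<noteq> 0 \<and>
       lam = 1 / (3 * \<mu> ^ 2) * (J ^ 2 / 4 + \<alpha>) \<and>
       g2 = 12 * lam ^ 2 - 2 * J \<and>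
       g3 = 4 * lam ^ 3 - g2 * lam - \<mu> ^ 2 \<and>
       h (-1) + h 0 - J \<noteq> 0 \<and>
       x0 = lam + \<mu> ^ 2 / (h (-1) + h 0 - J) \<and>
       nonsingular_curve g2 g3 \<and>
       is_period_lattice g2 g3 \<Lambda> \<and>
       elliptic_integral g2 g3 x0 I_zero \<and>
       elliptic_integral g2 g3 lam I_kappa"
  then obtain w1 w2 where w: "Im (w2 / w1) \<noteq> 0" "\<Lambda> = complex_lattice w1 w2"
    and g_sums: "g2 = 60 * (\<Sum>\<^sub>\<infinity>\<omega>\<in>\<Lambda> - {0}. 1 / \<omega> ^ 4)" "g3 = 140 * (\<Sum>\<^sub>\<infinity>\<omega>\<in>\<Lambda> - {0}. 1 / \<omega> ^ 6)"
    unfolding is_period_lattice_def by blast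
  \<comment> \<open>A basis is chosen only to enter the locale; \<open>sigma\<close>,
    \<open>wp\<close> and the Eisenstein sums depend on \<Lambda> alone.\<close>
  interpret period_lattice w1 w2 \<Lambda> by unfold_locales (use w in auto)
  have g: "g2 = 60 * eisenstein 4" "g3 = 140 * eisenstein 6"
    using g_sums unfolding eisenstein_def by blast+
  have "elliptic_integral (60 * eisenstein 4) (140 * eisenstein 6) x0 I_zero"
    and "elliptic_integral (60 * eisenstein 4) (140 * eisenstein 6) lam I_kappa"
    using A unfolding g by blast+
  note I0 = elliptic_integral_wp[OF this(1)] and Ik = elliptic_integral_wp[OF this(2)]
  have h_nz: "h n \<noteq> 0" and map: "h (n - 1) * h n * h (n + 1) = \<alpha> * h n + \<beta>" for n
    using h_nonzero h_map by auto
  have lam_eq: "lam = 1 / (3 * \<mu> ^ 2) * (J ^ 2 / 4 + \<alpha>)"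
    and x0_eq: "x0 = lam + \<mu> ^ 2 / (h (-1) + h 0 - J)"
    and g2_eq: "60 * eisenstein 4 = 12 * lam ^ 2 - 2 * J"
    and g3_eq: "140 * eisenstein 6 = 4 * lam ^ 3 - (60 * eisenstein 4) * lam - \<mu> ^ 2"
    and others: "J = somos5_J \<alpha> \<beta> h 0" "\<mu> ^ 4 = \<beta> + \<alpha> * J" "\<mu> \<noteq> 0" "h (-1) + h 0 - J \<noteq> 0"
    using A unfolding g by blast+
  note sol = somos5_solution[OF h_nz map others(1-3) lam_eq g2_eq g3_eq others(4) x0_eq I0 Ik]
  have wp_values: "wp z0 = x0 \<and> wp \<kappa> = lam" if "\<kappa> \<in> {I_kappa, - I_kappa}" "z0 \<in> {I_zero, - I_zero}" for \<kappa> z0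
    using that I0(2) Ik(2) by auto
  show "let \<sigma> = weierstrass_sigma \<Lambda>;
            wp = weierstrass_wp \<Lambda>;
            wp' = deriv wp;
            wp'' = deriv wp';
            signs_ok = (\<lambda>\<kappa> z0. wp' \<kappa> = \<mu> \<and> wp' \<kappa> * wp' z0 = (x0 - lam) * (h (-1) - h 0))
        in (\<exists>\<kappa>\<in>{I_kappa, - I_kappa}. \<exists>z0\<in>{I_zero, - I_zero}. signs_ok \<kappa> z0) \<and>
           (\<forall>\<kappa>\<in>{I_kappa, - I_kappa}. \<forall>z0\<in>{I_zero, - I_zero}.
              wp z0 = x0 \<and> wp \<kappa> = lam \<and>
              (signs_ok \<kappa> z0 \<longrightarrow>
                (\<forall>n::int.
                   h n = \<sigma> (z0 + of_int (n + 2) * \<kappa>) * \<sigma> (z0 + of_int (n - 1) * \<kappa>) /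
                         (\<sigma> \<kappa> ^ 4 * \<sigma> (z0 + of_int n * \<kappa>) * \<sigma> (z0 + of_int (n + 1) * \<kappa>)) \<and>
                   h n = - (wp' \<kappa> / 2) *
                           ((wp' (z0 + of_int n * \<kappa>) - wp' \<kappa>) / (wp (z0 + of_int n * \<kappa>) - wp \<kappa>)) +
                         wp'' \<kappa> / 2)))"
    unfolding Let_def
  proof (intro conjI ballI impI allI)
    show "\<exists>\<kappa>\<in>{I_kappa, - I_kappa}. \<exists>z0\<in>{I_zero, - I_zero}.
        wp' \<kappa> = \<mu> \<and> wp' \<kappa> * wp' z0 = (x0 - lam) * (h (-1) - h 0)"
      by (rule sol(1))
  next
    fix \<kappa> z0 assume "\<kappa> \<in> {I_kappa, - I_kappa}" "z0 \<in> {I_zero, - I_zero}"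
    thus "wp z0 = x0" "wp \<kappa> = lam" using wp_values by auto
  next
    fix \<kappa> z0 n
    assume "\<kappa> \<in> {I_kappa, - I_kappa}" "z0 \<in> {I_zero, - I_zero}"
      "wp' \<kappa> = \<mu> \<and> wp' \<kappa> * wp' z0 = (x0 - lam) * (h (-1) - h 0)"
    note result = sol(2)[OF this(1,2) this(3)[THEN conjunct1] this(3)[THEN conjunct2], of n]
    show "h n = sigma (z0 + of_int (n + 2) * \<kappa>) * sigma (z0 + of_int (n - 1) * \<kappa>) /
        (sigma \<kappa> ^ 4 * sigma (z0 + of_int n * \<kappa>) * sigma (z0 + of_int (n + 1) * \<kappa>))"
      by (rule result[THEN conjunct1])
    show "h n = - (wp' \<kappa> / 2) *
        ((wp' (z0 + of_int n * \<kappa>) - wp' \<kappa>) / (wp (z0 + of_int n * \<kappa>) - wp \<kappa>)) + deriv wp' \<kappa> / 2"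
      by (rule result[THEN conjunct2])
  qed
qed

end
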